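(* Let $\{Z_i\}_{i\ge0}$ be i.i.d. random elements of a measurable space $(\mathcal{Z},\mathcal{B}(\mathcal{Z}))$, let $r\ge1$ be a fixed integer, and let $h:\mathcal{Z}^r\to\mathbb{R}^d$ be a symmetric measurable kernel with $\mathbb{E}[h(Z_0,\dots,Z_{r-1})]=0$ and $\mathbb{E}\big[\|h(Z_0,\dots,Z_{r-1})\|^3\big]<\infty$. Suppose that the covariance matrix $\operatorname{Var}\big(\mathbb{E}[h(Z_0,\dots,Z_{r-1})\mid Z_0]\big)$ has smallest eigenvalue strictly positive. For $n\ge r$ let $$U_n:=\binom nr^{-1}\sum_{0\le i_1<\cdots<i_r\le n-1}h(Z_{i_1},\dots,Z_{i_r}).$$ Then there is a constant $C<\infty$ not depending on $n$ such that for all $n\ge r$, $$\mathcal{W}_1\Big(\mathcal{L}\big(\tfrac{\sqrt n\,U_n}{r}\big),\ \mathcal{N}\big(0,\operatorname{Var}(\mathbb{E}[h(Z_0,\dots,Z_{r-1})\mid Z_0])\big)\Big)\le C\,n^{-1/2}.$$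
   Context: $\mathcal{L}(\cdot)$ denotes the law of a random variable, $\operatorname{Var}$ of a random vector is its covariance matrix, and $\mathcal{N}(0,\Sigma)$ is the centered Gaussian law with covariance $\Sigma$. The Wasserstein-$1$ distance of probability measures $\nu,\mu$ on $\mathbb{R}^d$ is $\mathcal{W}_1(\nu,\mu)=\inf_{\gamma}\mathbb{E}_{(X,Y)\sim\gamma}\|X-Y\|$, the infimum over couplings $\gamma$ of $(\nu,\mu)$. Symmetric kernel means invariant under permutations of its $r$ arguments. *)

theory Defs
  imports "HOL-Probability.Probability"
begin

definition couplings ::
    "'a::topological_space measure \<Rightarrow> 'a measure \<Rightarrow> ('a \<times> 'a) measure set" where
  "couplings \<nu> \<mu> =
     {\<gamma>. sets \<gamma> = sets (borel \<Otimes>\<^sub>M borel) \<and> distr \<gamma> borel fst = \<nu> \<and> distr \<gamma> borel snd = \<mu>}"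

definition wasserstein1 ::
    "'a::real_normed_vector measure \<Rightarrow> 'a measure \<Rightarrow> ennreal" where
  "wasserstein1 \<nu> \<mu> =
     (INF \<gamma> \<in> couplings \<nu> \<mu>. \<integral>\<^sup>+ p. ennreal (norm (fst p - snd p)) \<partial>\<gamma>)"

definition std_gaussian :: "(real ^ 'd) measure" where
  "std_gaussian = density lborel (\<lambda>x. ennreal (\<Prod>i\<in>UNIV. std_normal_density (x $ i)))"

(* The law of A G with G standard Gaussian and A A^T = Sigma. By rotation invariance of the
   standard Gaussian law it does not depend on the root A; a root exists iff Sigma is symmetric
   and positive semidefinite, so degenerate Sigma are covered. *)
definition centered_gaussian :: "real ^ 'd ^ 'd \<Rightarrow> (real ^ 'd) measure" where
  "centered_gaussian \<Sigma> =
     (let A = (SOME A :: real ^ 'd ^ 'd. A ** transpose A = \<Sigma>)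
      in distr std_gaussian borel (\<lambda>x. A *v x))"

definition covariance_matrix :: "'w measure \<Rightarrow> ('w \<Rightarrow> real ^ 'd) \<Rightarrow> real ^ 'd ^ 'd" where
  "covariance_matrix M X =
     (\<chi> i j. \<integral>\<omega>. (X \<omega> $ i - (\<integral>\<omega>'. X \<omega>' $ i \<partial>M)) * (X \<omega> $ j - (\<integral>\<omega>'. X \<omega>' $ j \<partial>M)) \<partial>M)"

definition eigenvalues :: "real ^ 'd ^ 'd \<Rightarrow> real set" where
  "eigenvalues A = {c. \<exists>v. v \<noteq> 0 \<and> A *v v = c *\<^sub>R v}"

(* Meant for symmetric A, for which the set of real eigenvalues is finite and nonempty. *)
definition smallest_eigenvalue :: "real ^ 'd ^ 'd \<Rightarrow> real" where
  "smallest_eigenvalue A = Min (eigenvalues A)"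

(* E[X | Y], componentwise, for Y taking values in the measurable space S. *)
definition vec_cond_exp ::
    "'w measure \<Rightarrow> 'z measure \<Rightarrow> ('w \<Rightarrow> 'z) \<Rightarrow> ('w \<Rightarrow> real ^ 'd) \<Rightarrow> 'w \<Rightarrow> real ^ 'd" where
  "vec_cond_exp M S Y X \<omega> =
     (\<chi> i. real_cond_exp M (vimage_algebra (space M) Y S) (\<lambda>\<omega>'. X \<omega>' $ i) \<omega>)"

definition iid :: "'w measure \<Rightarrow> 'z measure \<Rightarrow> (nat \<Rightarrow> 'w \<Rightarrow> 'z) \<Rightarrow> bool" where
  "iid M S Z \<longleftrightarrow>
     prob_space.indep_vars M (\<lambda>_. S) Z UNIV \<and> (\<forall>i. distr M S (Z i) = distr M S (Z 0))"

(* The r-fold power of S: an r-tuple is a function on {..<r}, undefined elsewhere. *)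
abbreviation tuples :: "nat \<Rightarrow> 'z measure \<Rightarrow> (nat \<Rightarrow> 'z) measure" where
  "tuples r S \<equiv> Pi\<^sub>M {..<r} (\<lambda>_. S)"

definition symmetric_kernel :: "nat \<Rightarrow> 'z measure \<Rightarrow> ((nat \<Rightarrow> 'z) \<Rightarrow> 'b) \<Rightarrow> bool" where
  "symmetric_kernel r S h \<longleftrightarrow>
     (\<forall>\<pi> z. \<pi> permutes {..<r} \<longrightarrow> z \<in> space (tuples r S) \<longrightarrow> h (z \<circ> \<pi>) = h z)"

(* Index tuples i_1 < ... < i_r are the strictly increasing maps {..<r} -> {..<n}. *)
definition U_statistic ::
    "nat \<Rightarrow> ((nat \<Rightarrow> 'z) \<Rightarrow> real ^ 'd) \<Rightarrow> (nat \<Rightarrow> 'w \<Rightarrow> 'z) \<Rightarrow> nat \<Rightarrow> 'w \<Rightarrow> real ^ 'd" where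
  "U_statistic r h Z n \<omega> =
     (1 / real (n choose r)) *\<^sub>R
       (\<Sum>i \<in> {i \<in> {..<r} \<rightarrow>\<^sub>E {..<n}. strict_mono_on {..<r} i}. h (\<lambda>k\<in>{..<r}. Z (i k) \<omega>))"

end

theory Submission
  imports Defs
begin

text \<open>
  By Kantorovich duality it suffices to compare the expectations of 1-Lipschitz functions \<open>f\<close>.
  Hoeffding's decomposition replaces \<open>sqrt n U\<^sub>n / r\<close> by \<open>n\<close> to the power \<open>-1/2\<close> times the sum of the
  \<open>g (Z\<^sub>i)\<close>, where \<open>g z\<close> is the conditional expectation of the kernel given \<open>Z\<^sub>0 = z\<close>. The
  error is of order \<open>n\<close> to the power \<open>-1/2\<close> in \<open>L\<^sup>1\<close>, because after subtracting the projections two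
  summands are uncorrelated unless their index sets share at least two indices.

  After normalising the covariance it remains to bound \<open>E f(S\<^sub>n) - E f(T\<^sub>n)\<close> by a constant \<open>A\<close>, uniformly
  in \<open>n\<close>, where \<open>S\<^sub>n\<close> and \<open>T\<^sub>n\<close> are sums of \<open>n\<close> independent copies of an isotropic and of a standard
  Gaussian vector. Smooth \<open>f\<close> by a Gaussian law of fixed variance \<open>e\<close> and exchange the summands one by one.
  The \<open>k\<close>-th exchange contributes \<open>E \<phi>\<^sub>k(S\<^sub>k)\<close>, where \<open>\<phi>\<^sub>k\<close> has a Lipschitz constant of order
  \<open>n - k + e\<close> to the power \<open>-3/2\<close> and \<open>E \<phi>\<^sub>k(T\<^sub>k)\<close> is of order \<open>1/n\<close>. By induction, passing from \<open>S\<^sub>k\<close> to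
  \<open>T\<^sub>k\<close> costs at most \<open>A\<close> times the Lipschitz constant. These costs sum to at most \<open>A/2\<close> for large \<open>e\<close>, and no
  logarithmic factor appears.
\<close>

section \<open>Kantorovich duality\<close>

text \<open>A Lipschitz \<open>f\<close> has no Taylor expansion, so the exchange of a summand is
  expanded in the Gaussian density instead. After smoothing for time \<open>t\<close>, an increment
  \<open>v\<close> becomes a shift of the Gaussian by \<open>v / sqrt t\<close>; on that scale
  \<open>f\<close> varies like \<open>L sqrt t\<close>, and a cubic remainder leaves a cost of order
  \<open>L / t\<close> per exchange. Summed over \<open>t = n - k - 1 + e\<close>, this alone would
  give a logarithm. The exchange function is therefore first averaged over a Gaussian sum: heat
  times add, the total time is at least \<open>n\<close>, and \<open>n\<close> exchanges cost a
  constant. What the true sum adds to this sees only the Lipschitz constant of the exchange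
  function, and the induction can close because every bound is linear in \<open>L\<close>. The rate
  itself is scaling: the estimate concerns unnormalised sums, and the factor
  \<open>1 / sqrt n\<close> enters through the Lipschitz constant of the test function. On the side
  of the projection, two random \<open>r\<close>-subsets share two indices with probability of order
  \<open>1 / n\<^sup>2\<close>, so the remainder of \<open>U\<^sub>n\<close> has a second moment of
  that order.\<close>

lemma compact_box_fun: "compact {w :: 'i \<Rightarrow> real. \<forall>x. w x \<in> {0..c}}"
proof -
  have "compactin (product_topology (\<lambda>_. euclidean) UNIV) (PiE UNIV (\<lambda>_::'i. {0..c::real}))"
    unfolding compactin_PiE by (simp add: )
  moreover have "PiE UNIV (\<lambda>_::'i. {0..c::real}) = {w. \<forall>x. w x \<in> {0..c}}" by auto
  ultimately show ?thesis by (simp add: euclidean_product_topology)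
qed

lemma sum_last_cyclic:
  fixes u :: "nat \<Rightarrow> real"
  assumes "m > 0"
  shows "(\<Sum>i<m. u (Suc i mod m)) = (\<Sum>i<m. u i)"
proof -
  obtain k where k: "m = Suc k" using assms gr0_implies_Suc by blast
  have "(\<Sum>i<m. u (Suc i mod m)) = (\<Sum>i<k. u (Suc i mod m)) + u 0" by (simp add: k)
  also have "(\<Sum>i<k. u (Suc i mod m)) = (\<Sum>i<k. u (Suc i))" by (intro sum.cong) (auto simp: k)
  also have "\<dots> + u 0 = (\<Sum>i<m. u i)" by (simp add: k sum.lessThan_Suc_shift del: sum.lessThan_Suc)
  finally show ?thesis .
qed

text \<open>Plans are total functions, forced to vanish off \<open>F \<times> F\<close>. They form a
  closed subset of a product of intervals over the whole type, so compactness is Tychonoff's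
  theorem.\<close>

definition transport_plans :: "'a set \<Rightarrow> ('a \<Rightarrow> real) \<Rightarrow> ('a \<Rightarrow> real) \<Rightarrow> ('a \<times> 'a \<Rightarrow> real) set" where
  "transport_plans F p q = {w. (\<forall>x. 0 \<le> w x) \<and> (\<forall>x. x \<notin> F \<times> F \<longrightarrow> w x = 0) \<and>
     (\<forall>a\<in>F. (\<Sum>b\<in>F. w (a, b)) = p a) \<and> (\<forall>b\<in>F. (\<Sum>a\<in>F. w (a, b)) = q b)}"

lemma transport_plans_nonneg: "w \<in> transport_plans F p q \<Longrightarrow> 0 \<le> w x"
  and transport_plans_outside: "w \<in> transport_plans F p q \<Longrightarrow> x \<notin> F \<times> F \<Longrightarrow> w x = 0"
  unfolding transport_plans_def by blast+

text \<open>The cost is continuous and the set of plans is compact, so only nonemptiness asks for a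
  construction.\<close>

lemma optimal_transport_plan:
  fixes c :: "'a \<times> 'a \<Rightarrow> real"
  assumes "finite F" "\<And>a. a \<in> F \<Longrightarrow> p a \<ge> 0" "\<And>a. a \<in> F \<Longrightarrow> q a \<ge> 0" "sum p F = sum q F"
  obtains w where "w \<in> transport_plans F p q"
    "\<And>v. v \<in> transport_plans F p q \<Longrightarrow> (\<Sum>x\<in>F\<times>F. w x * c x) \<le> (\<Sum>x\<in>F\<times>F. v x * c x)"
proof -
  let ?K = "transport_plans F p q"
  have le: "w x \<le> sum p F" if "w \<in> ?K" for w x
  proof (cases "x \<in> F \<times> F")
    case True
    then obtain a b where x: "x = (a, b)" "a \<in> F" "b \<in> F" by auto
    have "w (a, b) \<le> (\<Sum>b\<in>F. w (a, b))"
      using that x assms(1) by (intro member_le_sum) (auto simp: transport_plans_def)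
    also have "\<dots> = p a" using that x by (auto simp: transport_plans_def)
    also have "\<dots> \<le> sum p F" using x assms by (intro member_le_sum) auto
    finally show ?thesis using x by simp
  next
    case False
    then show ?thesis using that assms by (cases x) (auto simp: transport_plans_def intro!: sum_nonneg)
  qed
  have sub: "?K = {w. \<forall>x. w x \<in> {0..sum p F}} \<inter> ?K"
    using le by (auto simp: transport_plans_def)
  have cl: "closed ?K"
    unfolding transport_plans_def Ball_def
    by (intro closed_Collect_conj closed_Collect_all closed_Collect_imp closed_Collect_le closed_Collect_eq
        open_Collect_const continuous_intros continuous_on_product_coordinates)
  have "compact ?K"
    by (subst sub) (intro compact_Int_closed compact_box_fun cl)
  moreover have "?K \<noteq> {}"
  proof (cases "sum p F = 0")
    case True
    then have "(\<lambda>_. 0) \<in> ?K" using assms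
      by (auto simp: transport_plans_def sum_nonneg_eq_0_iff)
    then show ?thesis by auto
  next
    case False
    \<comment> \<open>The product plan, divided by the common total mass; the hypothesis
      \<open>sum p F = sum q F\<close> makes both marginals correct.\<close>
    then have "(\<lambda>x. if x \<in> F \<times> F then p (fst x) * q (snd x) / sum p F else 0) \<in> ?K"
      using assms by (auto simp: transport_plans_def sum_nonneg
          simp flip: sum_distrib_left sum_distrib_right sum_divide_distrib)
    then show ?thesis by auto
  qed
  moreover have "continuous_on ?K (\<lambda>w. \<Sum>x\<in>F\<times>F. w x * c x)"
    by (intro continuous_intros continuous_on_product_then_coordinatewise[OF continuous_on_id])
  ultimately obtain w where "w \<in> ?K" "\<forall>v\<in>?K. (\<Sum>x\<in>F\<times>F. w x * c x) \<le> (\<Sum>x\<in>F\<times>F. v x * c x)"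
    using continuous_attains_inf by blast
  then show ?thesis using that by blast
qed

text \<open>Transferring a small mass along the cycle does not lower the cost.\<close>

lemma optimal_cyclically_monotone:
  fixes c :: "'a \<times> 'a \<Rightarrow> real"
  assumes F: "finite F" and w: "w \<in> transport_plans F p q"
    and opt: "\<And>v. v \<in> transport_plans F p q \<Longrightarrow> (\<Sum>x\<in>F\<times>F. w x * c x) \<le> (\<Sum>x\<in>F\<times>F. v x * c x)"
    and m: "m > 0" and pos: "\<And>i. i < m \<Longrightarrow> w (a i, b i) > 0"
  shows "(\<Sum>i<m. c (a i, b i)) \<le> (\<Sum>i<m. c (a i, b (Suc i mod m)))"
proof -
  let ?s = "\<lambda>i. Suc i mod m"
  have inF: "a i \<in> F" "b i \<in> F" if "i < m" for i
    using pos[OF that] w by (auto simp: transport_plans_def) (metis less_irrefl)+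
  have sm: "?s i < m" for i using m by simp
  \<comment> \<open>The pairs \<open>(a i, b i)\<close> may coincide, so up to \<open>m\<close>
    units can be taken from one entry of \<open>w\<close>; hence the division by
    \<open>m\<close>.\<close>
  define e where "e = Min ((\<lambda>i. w (a i, b i)) ` {..<m}) / m"
  have ne: "(\<lambda>i. w (a i, b i)) ` {..<m} \<noteq> {}" using m by auto
  have e: "e > 0" unfolding e_def using pos m ne by (auto intro!: divide_pos_pos simp: Min_gr_iff)
  have em: "e * m \<le> w (a i, b i)" if "i < m" for i
    using m that by (auto simp: e_def)
  \<comment> \<open>The reassignment of targets along the cycle. Each source and each target is used
    as often before as after, so all row and column sums of \<open>D\<close> vanish.\<close>
  define D where "D x = (\<Sum>i<m. (of_bool (x = (a i, b (?s i))) :: real)) - (\<Sum>i<m. of_bool (x = (a i, b i)))" for x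
  define v where "v x = w x + e * D x" for x
  have "v \<in> transport_plans F p q"
    unfolding transport_plans_def
  proof (intro CollectI conjI allI ballI impI)
    fix x
    show "0 \<le> v x"
    proof (cases "\<exists>i<m. x = (a i, b i)")
      case True
      then obtain i where i: "i < m" "x = (a i, b i)" by auto
      have "(\<Sum>i<m. of_bool (x = (a i, b i)) :: real) \<le> (\<Sum>i<m. 1)" by (intro sum_mono) auto
      moreover have "(\<Sum>i<m. of_bool (x = (a i, b (?s i))) :: real) \<ge> 0" by (intro sum_nonneg) auto
      ultimately have "D x \<ge> - real m" by (simp add: D_def)
      then have "e * D x \<ge> e * - m" using e by (intro mult_left_mono) auto
      then show ?thesis using em[OF i(1)] i unfolding v_def by simp
    next
      case False
      then have "(\<Sum>i<m. of_bool (x = (a i, b i)) :: real) = 0" by (intro sum.neutral) auto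
      then have "D x \<ge> 0" by (auto simp: D_def intro!: sum_nonneg)
      then show ?thesis using e w by (cases x) (auto simp: v_def transport_plans_def intro!: add_nonneg_nonneg)
    qed
  next
    fix x assume "x \<notin> F \<times> F"
    then have "x \<noteq> (a i, b j)" if "i < m" "j < m" for i j using inF that by auto
    then have "D x = 0" using sm by (simp add: D_def)
    then show "v x = 0" using w \<open>x \<notin> F \<times> F\<close>
      by (simp add: v_def transport_plans_outside)
  next
    fix y assume y: "y \<in> F"
    have "(\<Sum>z\<in>F. (of_bool ((y, z) = (a i, b j)) :: real)) = of_bool (y = a i)" if "i < m" "j < m" for i j
      using inF[OF that(2)] F by (cases "y = a i") (auto simp: of_bool_def if_distrib sum.delta)
    then have "(\<Sum>z\<in>F. D (y, z)) = 0"
      unfolding D_def sum_subtractf using sm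
      by (subst sum.swap, subst (2) sum.swap) (simp del: prod.inject)
    then show "(\<Sum>z\<in>F. v (y, z)) = p y"
      using w y by (simp add: v_def sum.distrib transport_plans_def flip: sum_distrib_left)
  next
    fix y assume y: "y \<in> F"
    have "(\<Sum>z\<in>F. (of_bool ((z, y) = (a i, b j)) :: real)) = of_bool (y = b j)" if "i < m" "j < m" for i j
      using inF[OF that(1)] F by (cases "y = b j") (auto simp: of_bool_def if_distrib sum.delta)
    then have "(\<Sum>z\<in>F. D (z, y)) = 0"
      unfolding D_def sum_subtractf using sm sum_last_cyclic[OF m, of "\<lambda>i. of_bool (y = b i)"]
      by (subst sum.swap, subst (2) sum.swap) (simp del: prod.inject)
    then show "(\<Sum>z\<in>F. v (z, y)) = q y"
      using w y by (simp add: v_def sum.distrib transport_plans_def flip: sum_distrib_left)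
  qed
  from opt[OF this] have "0 \<le> e * (\<Sum>x\<in>F\<times>F. D x * c x)"
    by (simp add: v_def distrib_right sum.distrib sum_distrib_left mult.assoc)
  then have "0 \<le> (\<Sum>x\<in>F\<times>F. D x * c x)" using e by (simp add: zero_le_mult_iff)
  moreover have "(\<Sum>x\<in>F\<times>F. (of_bool (x = (a i, b j)) :: real) * c x) = c (a i, b j)" if "i < m" "j < m" for i j
    using inF that F by (simp add: of_bool_def if_distrib[of "\<lambda>t. t * _"] sum.delta cong: if_cong)
  then have "(\<Sum>x\<in>F\<times>F. D x * c x) = (\<Sum>i<m. c (a i, b (?s i))) - (\<Sum>i<m. c (a i, b i))"
    unfolding D_def left_diff_distrib sum_subtractf sum_distrib_right using sm
    by (subst sum.swap, subst (2) sum.swap) simp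
  ultimately show ?thesis by simp
qed

text \<open>The dual potential is the cheapest chain through the support of the optimal plan; cyclical
  monotonicity bounds the cost of a chain from below by the cost of closing it up.\<close>

lemma finite_kantorovich_duality:
  fixes F :: "'a::metric_space set"
  assumes F: "finite F" and nn: "\<And>a. a \<in> F \<Longrightarrow> p a \<ge> 0" "\<And>a. a \<in> F \<Longrightarrow> q a \<ge> 0" and eq: "sum p F = sum q F"
  obtains w f where "w \<in> transport_plans F p q" "1-lipschitz_on UNIV f"
    "(\<Sum>x\<in>F\<times>F. w x * dist (fst x) (snd x)) \<le> (\<Sum>a\<in>F. p a * f a) - (\<Sum>a\<in>F. q a * f a)"
proof -
  let ?c = "\<lambda>x. dist (fst x) (snd x)"
  obtain w where w: "w \<in> transport_plans F p q"
    and opt: "\<And>v. v \<in> transport_plans F p q \<Longrightarrow> (\<Sum>x\<in>F\<times>F. w x * ?c x) \<le> (\<Sum>x\<in>F\<times>F. v x * ?c x)"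
    using optimal_transport_plan[OF assms, of ?c] by blast
  define G where "G = {x. w x > 0}"
  have w0: "w x \<ge> 0" "x \<notin> F \<times> F \<Longrightarrow> w x = 0" for x
    using w transport_plans_nonneg transport_plans_outside by blast+
  have GF: "G \<subseteq> F \<times> F" using w0(2) unfolding G_def by (metis less_irrefl mem_Collect_eq subsetI)
  then have finG: "finite G" using F by (meson finite_SigmaI finite_subset)
  show ?thesis
  proof (cases "G = {}")
    case True
    then have "w x = 0" for x using w0(1)[of x] unfolding G_def by (metis empty_iff less_eq_real_def mem_Collect_eq)
    then have "(\<Sum>x\<in>F\<times>F. w x * ?c x) \<le> (\<Sum>a\<in>F. p a * 0) - (\<Sum>a\<in>F. q a * 0)" by simp
    moreover have "1-lipschitz_on UNIV (\<lambda>_::'a. 0::real)" by (auto intro: lipschitz_onI)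
    ultimately show ?thesis using that w by blast
  next
    case False
    define chains where "chains = {xs. xs \<noteq> [] \<and> set xs \<subseteq> G}"
    \<comment> \<open>Rockafellar's construction: from \<open>x\<close> go to the target of the
      first pair, back along that pair to its source, on to the target of the next pair, and so on.
      Moves to a target are paid for, moves back along a pair of the support are credited.\<close>
    define cost where "cost x xs = dist x (snd (xs ! 0)) - dist (fst (xs ! 0)) (snd (xs ! 0))
      + (\<Sum>i<length xs - 1. dist (fst (xs ! i)) (snd (xs ! Suc i)) - dist (fst (xs ! Suc i)) (snd (xs ! Suc i)))"
      for x and xs :: "('a \<times> 'a) list"
    have cost_Cons: "cost (b) ((a, b) # xs) = cost a xs - dist a b" if "xs \<in> chains" for a b xs
    proof -
      obtain y ys where "xs = y # ys" using \<open>xs \<in> chains\<close> by (cases xs) (auto simp: chains_def)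
      then show ?thesis
        by (simp add: cost_def sum.lessThan_Suc_shift del: sum.lessThan_Suc)
    qed
    \<comment> \<open>The dearest edge that can close a chain up, from its last source to its first
      target. It bounds all chain costs from below, uniformly in \<open>x\<close>, so that the
      infimum is finite.\<close>
    define K where "K = Max ((\<lambda>(x, y). dist (fst x) (snd y)) ` (G \<times> G))"
    have lower: "- K \<le> cost x xs" if xs: "xs \<in> chains" for x xs
    proof -
      define m where "m = length xs"
      have m: "m > 0" using xs by (auto simp: chains_def m_def)
      have xG: "xs ! i \<in> G" if "i < m" for i using xs that by (auto simp: chains_def m_def)
      then have "w (fst (xs ! i), snd (xs ! i)) > 0" if "i < m" for i using that by (auto simp: G_def)
      from optimal_cyclically_monotone[OF F w opt m, of "\<lambda>i. fst (xs ! i)" "\<lambda>i. snd (xs ! i)", OF _ this]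
      have cm: "(\<Sum>i<m. dist (fst (xs ! i)) (snd (xs ! i))) \<le> (\<Sum>i<m. dist (fst (xs ! i)) (snd (xs ! (Suc i mod m))))"
        by simp
      obtain k where k: "m = Suc k" using m gr0_implies_Suc by blast
      have "(\<Sum>i<m. dist (fst (xs ! i)) (snd (xs ! (Suc i mod m))))
          = (\<Sum>i<k. dist (fst (xs ! i)) (snd (xs ! Suc i))) + dist (fst (xs ! k)) (snd (xs ! 0))"
        by (simp add: k)
      moreover have "(\<Sum>i<m. dist (fst (xs ! i)) (snd (xs ! i)))
          = dist (fst (xs ! 0)) (snd (xs ! 0)) + (\<Sum>i<k. dist (fst (xs ! Suc i)) (snd (xs ! Suc i)))"
        by (simp add: k sum.lessThan_Suc_shift del: sum.lessThan_Suc)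
      moreover have "dist (fst (xs ! k)) (snd (xs ! 0)) \<le> K"
        unfolding K_def using finG xG[of k] xG[of 0] by (intro Max_ge) (auto simp: k)
      ultimately have "- K \<le> - dist (fst (xs ! 0)) (snd (xs ! 0))
        + (\<Sum>i<k. dist (fst (xs ! i)) (snd (xs ! Suc i)) - dist (fst (xs ! Suc i)) (snd (xs ! Suc i)))"
        using cm unfolding sum_subtractf by linarith
      moreover have "length xs - 1 = k" using k by (simp add: m_def)
      ultimately show ?thesis unfolding cost_def by (smt (verit) zero_le_dist)
    qed
    obtain g where "g \<in> G" using False by auto
    then have ne: "chains \<noteq> {}" by (auto simp: chains_def intro!: exI[of _ "[g]"])
    have bdd: "bdd_below (cost x ` chains)" for x using lower by (auto intro!: bdd_belowI)
    define f where "f x = (INF xs\<in>chains. cost x xs)" for x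
    have lip: "f x \<le> f y + dist x y" for x y
    proof -
      have "f x - dist x y \<le> cost y xs" if "xs \<in> chains" for xs
      proof -
        have "f x \<le> cost x xs" unfolding f_def using bdd that by (intro cINF_lower)
        also have "\<dots> \<le> cost y xs + dist x y"
          unfolding cost_def using dist_triangle[of x "snd (xs ! 0)" y] by simp
        finally show ?thesis by simp
      qed
      then have "f x - dist x y \<le> f y" unfolding f_def[of y] by (intro cINF_greatest ne)
      then show ?thesis by simp
    qed
    have f_lip: "1-lipschitz_on UNIV f"
      using lip by (intro lipschitz_onI) (auto simp: dist_real_def abs_le_iff algebra_simps, metis dist_commute)
    \<comment> \<open>Prepending \<open>(a, b)\<close> to a chain from \<open>a\<close> gives a
      chain from \<open>b\<close> whose first move costs nothing, since it ends where it
      starts.\<close>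
    have slack: "dist a b \<le> f a - f b" if "(a, b) \<in> G" for a b
    proof -
      have "f b + dist a b \<le> cost a xs" if xs: "xs \<in> chains" for xs
      proof -
        have "(a, b) # xs \<in> chains" using xs \<open>(a, b) \<in> G\<close> by (auto simp: chains_def)
        then have "f b \<le> cost b ((a, b) # xs)" unfolding f_def using bdd by (intro cINF_lower)
        then show ?thesis using cost_Cons[OF xs] by simp
      qed
      then have "f b + dist a b \<le> f a" unfolding f_def[of a] by (intro cINF_greatest ne)
      then show ?thesis by simp
    qed
    have "(\<Sum>x\<in>F\<times>F. w x * ?c x) \<le> (\<Sum>x\<in>F\<times>F. w x * (f (fst x) - f (snd x)))"
      using slack w0 by (intro sum_mono) (metis G_def less_eq_real_def mem_Collect_eq mult_left_mono mult_zero_left prod.collapse)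
    also have "\<dots> = (\<Sum>x\<in>F\<times>F. w x * f (fst x)) - (\<Sum>x\<in>F\<times>F. w x * f (snd x))"
      by (simp add: right_diff_distrib sum_subtractf)
    also have "(\<Sum>x\<in>F\<times>F. w x * f (fst x)) = (\<Sum>a\<in>F. \<Sum>b\<in>F. w (a, b) * f a)"
      by (simp add: sum.cartesian_product case_prod_beta)
    also have "\<dots> = (\<Sum>a\<in>F. p a * f a)"
      using w by (intro sum.cong) (auto simp: transport_plans_def simp flip: sum_distrib_right)
    also have "(\<Sum>x\<in>F\<times>F. w x * f (snd x)) = (\<Sum>a\<in>F. \<Sum>b\<in>F. w (a, b) * f b)"
      by (simp add: sum.cartesian_product case_prod_beta)
    also have "\<dots> = (\<Sum>b\<in>F. \<Sum>a\<in>F. w (a, b) * f b)" by (rule sum.swap)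
    also have "\<dots> = (\<Sum>a\<in>F. q a * f a)"
      using w by (intro sum.cong) (auto simp: transport_plans_def simp flip: sum_distrib_right)
    finally show ?thesis using that w f_lip by blast
  qed
qed

section \<open>Approximation by maps of finite range\<close>

fun nearest_approx :: "(nat \<Rightarrow> 'a::metric_space) \<Rightarrow> nat \<Rightarrow> 'a \<Rightarrow> 'a" where
  "nearest_approx a 0 x = a 0"
| "nearest_approx a (Suc n) x = (if dist x (a (Suc n)) < dist x (nearest_approx a n x) then a (Suc n) else nearest_approx a n x)"

lemma nearest_approx_mem: "nearest_approx a n x \<in> a ` {..n}"
  by (induction n) (auto simp: le_Suc_eq)

lemma nearest_approx_le: "i \<le> n \<Longrightarrow> dist x (nearest_approx a n x) \<le> dist x (a i)"
  by (induction n) (auto simp: le_Suc_eq)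

lemma nearest_approx_measurable [measurable]:
  fixes a :: "nat \<Rightarrow> 'a::{metric_space, second_countable_topology}"
  shows "nearest_approx a n \<in> borel_measurable borel"
proof (induction n)
  case (Suc n)
  note [measurable] = this
  show ?case unfolding nearest_approx.simps by measurable
qed simp

text \<open>\<open>T\<close> picks the nearest among the first points of a dense sequence. The error
  tends to zero pointwise and is dominated by the distance to the point \<open>a 0\<close>, so
  dominated convergence applies and one index serves both laws.\<close>

lemma finite_range_approximation:
  fixes \<nu> \<mu> :: "'a::{real_normed_vector, second_countable_topology} measure"
  assumes "prob_space \<nu>" "prob_space \<mu>" "sets \<nu> = sets borel" "sets \<mu> = sets borel"
    "integrable \<nu> norm" "integrable \<mu> norm" "e > 0"
  obtains T :: "'a \<Rightarrow> 'a" where "T \<in> borel_measurable borel" "finite (range T)"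
    "integrable \<nu> (\<lambda>x. dist x (T x))" "(\<integral>x. dist x (T x) \<partial>\<nu>) < e"
    "integrable \<mu> (\<lambda>x. dist x (T x))" "(\<integral>x. dist x (T x) \<partial>\<mu>) < e"
proof -
  obtain D :: "'a set" where D: "countable D" "\<And>X. open X \<Longrightarrow> X \<noteq> {} \<Longrightarrow> \<exists>d\<in>D. d \<in> X"
    using countable_dense_setE by blast
  have Dne: "D \<noteq> {}" using D(2)[of UNIV] by auto
  define a where "a = from_nat_into D"
  have dense: "\<exists>i. dist x (a i) < r" if "r > 0" for x r
  proof -
    have "\<exists>d\<in>D. d \<in> ball x r" using that by (intro D(2)) auto
    then show ?thesis unfolding a_def by (metis D(1) from_nat_into_surj mem_ball)
  qed
  have key: "integrable \<rho> (\<lambda>x. dist x (nearest_approx a n x))"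
      "(\<lambda>n. \<integral>x. dist x (nearest_approx a n x) \<partial>\<rho>) \<longlonglongrightarrow> 0"
    if \<rho>: "prob_space \<rho>" "sets \<rho> = sets borel" "integrable \<rho> norm" for \<rho> :: "'a measure" and n
  proof -
    interpret prob_space \<rho> by fact
    note [measurable_cong] = \<rho>(2)
    have i0: "integrable \<rho> (\<lambda>x. dist x (a 0))"
      by (rule Bochner_Integration.integrable_bound[of _ "\<lambda>x. norm x + norm (a 0)"])
        (use \<rho>(3) norm_triangle_ineq4 in \<open>auto simp: dist_norm\<close>)
    show "integrable \<rho> (\<lambda>x. dist x (nearest_approx a n x))" for n
      by (rule Bochner_Integration.integrable_bound[OF i0]) (auto simp: nearest_approx_le)
    have "(\<lambda>n. dist x (nearest_approx a n x)) \<longlonglongrightarrow> 0" for x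
    proof (rule LIMSEQ_I)
      fix r :: real assume "r > 0"
      then obtain i where "dist x (a i) < r" using dense by blast
      then show "\<exists>no. \<forall>n\<ge>no. norm (dist x (nearest_approx a n x) - 0) < r"
        by (auto intro!: exI[of _ i] le_less_trans[OF nearest_approx_le])
    qed
    then have "(\<lambda>n. \<integral>x. dist x (nearest_approx a n x) \<partial>\<rho>) \<longlonglongrightarrow> (\<integral>x. 0 \<partial>\<rho>)"
      by (intro integral_dominated_convergence[OF _ _ i0]) (auto simp: nearest_approx_le)
    then show "(\<lambda>n. \<integral>x. dist x (nearest_approx a n x) \<partial>\<rho>) \<longlonglongrightarrow> 0" by simp
  qed
  have "\<forall>\<^sub>F n in sequentially. (\<integral>x. dist x (nearest_approx a n x) \<partial>\<nu>) < e \<and> (\<integral>x. dist x (nearest_approx a n x) \<partial>\<mu>) < e"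
    using order_tendstoD(2)[OF key(2)[OF assms(1,3,5)] assms(7)] order_tendstoD(2)[OF key(2)[OF assms(2,4,6)] assms(7)]
    by eventually_elim auto
  then obtain n where n: "(\<integral>x. dist x (nearest_approx a n x) \<partial>\<nu>) < e" "(\<integral>x. dist x (nearest_approx a n x) \<partial>\<mu>) < e"
    by (auto simp: eventually_sequentially)
  have "finite (range (nearest_approx a n))"
    by (rule finite_subset[of _ "a ` {..n}"]) (use nearest_approx_mem in auto)
  then show ?thesis using that[of "nearest_approx a n"] n key(1) assms by auto
qed

lemma lipschitz_abs_le:
  fixes f :: "'a::metric_space \<Rightarrow> real"
  assumes "L-lipschitz_on UNIV f"
  shows "\<bar>f x - f y\<bar> \<le> L * dist x y"
  using lipschitz_onD[OF assms] by (auto simp: dist_real_def)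

lemma lipschitz_borel_measurable:
  fixes f :: "'a::metric_space \<Rightarrow> real"
  assumes "L-lipschitz_on UNIV f"
  shows "f \<in> borel_measurable borel"
  using lipschitz_on_continuous_on[OF assms] by (rule borel_measurable_continuous_onI)

lemma lipschitz_integrable:
  fixes f :: "'a::{real_normed_vector, second_countable_topology} \<Rightarrow> real"
  assumes "prob_space \<mu>" "sets \<mu> = sets borel" "integrable \<mu> norm" "L-lipschitz_on UNIV f"
  shows "integrable \<mu> f"
proof -
  interpret prob_space \<mu> by fact
  note [measurable_cong] = assms(2)
  have [measurable]: "f \<in> borel_measurable borel" using lipschitz_borel_measurable[OF assms(4)] .
  show ?thesis
  proof (rule Bochner_Integration.integrable_bound[of _ "\<lambda>x. L * norm x + norm (f 0)"])
    show "AE x in \<mu>. norm (f x) \<le> norm (L * norm x + norm (f 0))"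
    proof (rule AE_I2)
      fix x
      have "\<bar>f x - f 0\<bar> \<le> L * norm x" using lipschitz_abs_le[OF assms(4), of x 0] by simp
      then show "norm (f x) \<le> norm (L * norm x + norm (f 0))"
        by (simp add: abs_if split: if_splits)
    qed
  qed (use assms(3) in auto)
qed

section \<open>Lifting a finite plan to a coupling\<close>

lemma finite_range_sum_indicator:
  fixes g :: "'b \<Rightarrow> 'c::comm_semiring_1"
  assumes "finite (range T)"
  shows "g (T y) = (\<Sum>b\<in>range T. g b * indicator (T -` {b}) y)"
proof -
  have "(\<Sum>b\<in>range T. g b * indicator (T -` {b}) y) = (\<Sum>b\<in>range T. if b = T y then g b else 0)"
    by (intro sum.cong) (auto simp: indicator_def)
  then show ?thesis using assms by (simp add: sum.delta')
qed

text \<open>There are finitely many fibres, so those of measure zero form a null set together. Off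
  it, dividing by the mass of a fibre is legitimate.\<close>

lemma AE_measure_fibre_nonzero:
  assumes "prob_space \<nu>" and fin: "finite (range T)" and T: "\<And>a. T -` {a} \<in> sets \<nu>"
  shows "AE x in \<nu>. measure \<nu> (T -` {T x}) \<noteq> 0"
proof -
  interpret prob_space \<nu> by fact
  have "AE x in \<nu>. \<forall>a\<in>range T. prob (T -` {a}) = 0 \<longrightarrow> x \<notin> T -` {a}"
  proof (intro AE_finite_allI fin)
    fix a
    show "AE x in \<nu>. prob (T -` {a}) = 0 \<longrightarrow> x \<notin> T -` {a}"
    proof (cases "prob (T -` {a}) = 0")
      case True
      then have "T -` {a} \<in> null_sets \<nu>" using T by (auto simp: emeasure_eq_measure)
      then have "AE x in \<nu>. x \<notin> T -` {a}" by (rule AE_not_in)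
      then show ?thesis by simp
    qed simp
  qed
  then show ?thesis by eventually_elim auto
qed

text \<open>A finite plan \<open>w\<close> between the images under \<open>T\<close> is lifted to a coupling that has density
  \<open>w (a, b) / (\<nu>(T = a) \<mu>(T = b))\<close> with respect to the product measure; division by zero only
  happens on null sets.\<close>

lemma coupling_from_plan:
  fixes \<nu> \<mu> :: "'a::{real_normed_vector, second_countable_topology} measure" and T :: "'a \<Rightarrow> 'a"
  assumes "prob_space \<nu>" "prob_space \<mu>" and sets_\<nu>: "sets \<nu> = sets borel" and sets_\<mu>: "sets \<mu> = sets borel"
    and T[measurable]: "T \<in> borel_measurable borel" and fin: "finite (range T)"
    and w: "w \<in> transport_plans (range T) (\<lambda>a. measure \<nu> (T -` {a})) (\<lambda>a. measure \<mu> (T -` {a}))"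
  obtains \<gamma> where "\<gamma> \<in> couplings \<nu> \<mu>"
    "(\<integral>\<^sup>+ p. ennreal (dist (T (fst p)) (T (snd p))) \<partial>\<gamma>) = ennreal (\<Sum>x\<in>range T\<times>range T. w x * dist (fst x) (snd x))"
proof -
  interpret nu: prob_space \<nu> by fact
  interpret mu: prob_space \<mu> by fact
  note [measurable_cong] = sets_\<nu> sets_\<mu>
  let ?F = "range T"
  define p where "p a = measure \<nu> (T -` {a})" for a
  define q where "q a = measure \<mu> (T -` {a})" for a
  have sp: "space \<nu> = UNIV" "space \<mu> = UNIV"
    using sets_eq_imp_space_eq[OF sets_\<nu>] sets_eq_imp_space_eq[OF sets_\<mu>] by simp_all
  have w0: "0 \<le> w x" for x using w by (rule transport_plans_nonneg)
  have row: "(\<Sum>b\<in>?F. w (a, b)) = p a" and col: "(\<Sum>b\<in>?F. w (b, a)) = q a" if "a \<in> ?F" for a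
    using w that by (auto simp: transport_plans_def p_def q_def)
  \<comment> \<open>A fibre without mass forces a zero row, respectively a zero column, of the plan.
    So \<open>x / 0 = 0\<close> in the density \<open>k\<close> loses nothing of
    \<open>w\<close>.\<close>
  have wp: "w (a, b) = 0" if "a \<in> ?F" "b \<in> ?F" "p a = 0" for a b
    using row[OF that(1)] that w0 sum_nonneg_eq_0_iff[OF fin, of "\<lambda>b. w (a, b)"] by auto
  have wq: "w (a, b) = 0" if "a \<in> ?F" "b \<in> ?F" "q b = 0" for a b
    using col[OF that(2)] that w0 sum_nonneg_eq_0_iff[OF fin, of "\<lambda>a. w (a, b)"] by auto
  have Tset[measurable]: "T -` {a} \<in> sets borel" for a
    using measurable_sets[OF T, of "{a}"] by simp
  define k where "k a b = w (a, b) / (p a * q b)" for a b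
  have k0: "0 \<le> k a b" for a b using w0 by (simp add: k_def p_def q_def)
  \<comment> \<open>As \<open>T\<close> has finite range, every function of \<open>T\<close> is a
    finite combination of indicators of fibres. This gives measurability for arbitrary
    \<open>g\<close>.\<close>
  have decomp: "(\<lambda>y. g (T y)) = (\<lambda>y. \<Sum>b\<in>?F. g b * indicator (T -` {b}) y)" for g :: "'a \<Rightarrow> ennreal"
    using finite_range_sum_indicator[OF fin] by blast
  have decomp2: "(\<lambda>x. g (T (fst x)) (T (snd x))) = (\<lambda>x. \<Sum>z\<in>?F\<times>?F. g (fst z) (snd z) * indicator (T -` {fst z} \<times> T -` {snd z}) x)"
    for g :: "'a \<Rightarrow> 'a \<Rightarrow> ennreal"
  proof
    fix x
    have "(\<Sum>z\<in>?F\<times>?F. g (fst z) (snd z) * indicator (T -` {fst z} \<times> T -` {snd z}) x) = (\<Sum>z\<in>?F\<times>?F. if z = (T (fst x), T (snd x)) then g (fst z) (snd z) else 0)"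
      by (intro sum.cong) (auto simp: indicator_def mem_Times_iff)
    then show "g (T (fst x)) (T (snd x)) = (\<Sum>z\<in>?F\<times>?F. g (fst z) (snd z) * indicator (T -` {fst z} \<times> T -` {snd z}) x)"
      using fin by (simp add: sum.delta')
  qed
  have nn_nu: "(\<integral>\<^sup>+ y. g (T y) \<partial>\<nu>) = (\<Sum>b\<in>?F. g b * ennreal (p b))" for g :: "'a \<Rightarrow> ennreal"
    by (subst decomp) (simp add: nn_integral_sum nn_integral_cmult p_def nu.emeasure_eq_measure)
  have nn_mu: "(\<integral>\<^sup>+ y. g (T y) \<partial>\<mu>) = (\<Sum>b\<in>?F. g b * ennreal (q b))" for g :: "'a \<Rightarrow> ennreal"
    by (subst decomp) (simp add: nn_integral_sum nn_integral_cmult q_def mu.emeasure_eq_measure)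
  have meas1[measurable]: "(\<lambda>y. ennreal (k a (T y))) \<in> borel_measurable borel" for a
    by (subst decomp[of "\<lambda>b. ennreal (k a b)"]) measurable
  have meas1'[measurable]: "(\<lambda>y. ennreal (k (T y) a)) \<in> borel_measurable borel" for a
    by (subst decomp[of "\<lambda>b. ennreal (k b a)"]) measurable
  have meas2[measurable]: "(\<lambda>x. g (T (fst x)) (T (snd x))) \<in> borel_measurable (borel \<Otimes>\<^sub>M borel)" for g :: "'a \<Rightarrow> 'a \<Rightarrow> ennreal"
    by (subst decomp2) measurable
  define \<gamma> where "\<gamma> = density (\<nu> \<Otimes>\<^sub>M \<mu>) (\<lambda>x. ennreal (k (T (fst x)) (T (snd x))))"
  interpret pair_sigma_finite \<nu> \<mu> ..
  have pairsets: "sets (\<nu> \<Otimes>\<^sub>M \<mu>) = sets (borel \<Otimes>\<^sub>M borel)" by (intro sets_pair_measure_cong sets_\<nu> sets_\<mu>)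
  note [measurable_cong] = pairsets
  have \<gamma>int: "(\<integral>\<^sup>+ x. g x \<partial>\<gamma>) = (\<integral>\<^sup>+ x. \<integral>\<^sup>+ y. ennreal (k (T x) (T y)) * g (x, y) \<partial>\<mu> \<partial>\<nu>)"
    if [measurable]: "g \<in> borel_measurable (borel \<Otimes>\<^sub>M borel)" for g
    unfolding \<gamma>_def by (simp add: nn_integral_density mu.nn_integral_fst[symmetric])
  \<comment> \<open>The marginal density is \<open>1\<close> except over fibres without mass, where
    division by zero makes it \<open>0\<close>; this exception is removed by \<open>null1\<close>
    and \<open>null2\<close>.\<close>
  have marg1: "(\<Sum>b\<in>?F. ennreal (k a b) * ennreal (q b)) = of_bool (p a \<noteq> 0)" if a: "a \<in> ?F" for a
  proof -
    have "(\<Sum>b\<in>?F. ennreal (k a b) * ennreal (q b)) = ennreal (\<Sum>b\<in>?F. k a b * q b)"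
      using k0 by (simp add: q_def sum_ennreal flip: ennreal_mult)
    also have "(\<Sum>b\<in>?F. k a b * q b) = (\<Sum>b\<in>?F. w (a, b) / p a)"
      using wq[OF a] by (intro sum.cong) (auto simp: k_def)
    also have "\<dots> = of_bool (p a \<noteq> 0)" using row[OF a] by (simp flip: sum_divide_distrib)
    finally show ?thesis by simp
  qed
  have marg2: "(\<Sum>a\<in>?F. ennreal (k a b) * ennreal (p a)) = of_bool (q b \<noteq> 0)" if b: "b \<in> ?F" for b
  proof -
    have "(\<Sum>a\<in>?F. ennreal (k a b) * ennreal (p a)) = ennreal (\<Sum>a\<in>?F. k a b * p a)"
      using k0 by (simp add: p_def sum_ennreal flip: ennreal_mult)
    also have "(\<Sum>a\<in>?F. k a b * p a) = (\<Sum>a\<in>?F. w (a, b) / q b)"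
      using wp[OF _ b] by (intro sum.cong) (auto simp: k_def)
    also have "\<dots> = of_bool (q b \<noteq> 0)" using col[OF b] by (simp flip: sum_divide_distrib)
    finally show ?thesis by simp
  qed
  have inner1: "(\<integral>\<^sup>+ y. ennreal (k (T x) (T y)) \<partial>\<mu>) = of_bool (p (T x) \<noteq> 0)" for x
    using nn_mu[of "\<lambda>b. ennreal (k (T x) b)"] marg1 by simp
  have inner2: "(\<integral>\<^sup>+ x. ennreal (k (T x) (T y)) \<partial>\<nu>) = of_bool (q (T y) \<noteq> 0)" for y
    using nn_nu[of "\<lambda>a. ennreal (k a (T y))"] marg2 by simp
  have null1: "AE x in \<nu>. p (T x) \<noteq> 0"
    unfolding p_def by (rule AE_measure_fibre_nonzero[OF assms(1) fin]) simp
  have null2: "AE x in \<mu>. q (T x) \<noteq> 0"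
    unfolding q_def by (rule AE_measure_fibre_nonzero[OF assms(2) fin]) simp
  have d1: "distr \<gamma> borel fst = \<nu>"
  proof (rule measure_eqI)
    fix A assume "A \<in> sets (distr \<gamma> borel fst)"
    then have A[measurable]: "A \<in> sets borel" by simp
    have "emeasure (distr \<gamma> borel fst) A = (\<integral>\<^sup>+ x. indicator A (fst x) \<partial>\<gamma>)"
      by (subst emeasure_distr) (auto simp: \<gamma>_def simp flip: nn_integral_indicator intro!: nn_integral_cong split: split_indicator)
    also have "\<dots> = (\<integral>\<^sup>+ x. \<integral>\<^sup>+ y. ennreal (k (T x) (T y)) * indicator A x \<partial>\<mu> \<partial>\<nu>)"
      by (subst \<gamma>int) simp_all
    also have "\<dots> = (\<integral>\<^sup>+ x. indicator A x * of_bool (p (T x) \<noteq> 0) \<partial>\<nu>)"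
      by (subst nn_integral_multc) (simp_all add: inner1 mult.commute)
    also have "\<dots> = (\<integral>\<^sup>+ x. indicator A x \<partial>\<nu>)"
      by (rule nn_integral_cong_AE) (use null1 in eventually_elim, auto)
    finally show "emeasure (distr \<gamma> borel fst) A = emeasure \<nu> A" by simp
  qed (simp add: sets_\<nu>)
  have d2: "distr \<gamma> borel snd = \<mu>"
  proof (rule measure_eqI)
    fix A assume "A \<in> sets (distr \<gamma> borel snd)"
    then have A[measurable]: "A \<in> sets borel" by simp
    have "emeasure (distr \<gamma> borel snd) A = (\<integral>\<^sup>+ x. indicator A (snd x) \<partial>\<gamma>)"
      by (subst emeasure_distr) (auto simp: \<gamma>_def simp flip: nn_integral_indicator intro!: nn_integral_cong split: split_indicator)
    also have "\<dots> = (\<integral>\<^sup>+ x. \<integral>\<^sup>+ y. ennreal (k (T x) (T y)) * indicator A y \<partial>\<mu> \<partial>\<nu>)"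
      by (subst \<gamma>int) simp_all
    also have "\<dots> = (\<integral>\<^sup>+ y. \<integral>\<^sup>+ x. ennreal (k (T x) (T y)) * indicator A y \<partial>\<nu> \<partial>\<mu>)"
      using meas2[of "\<lambda>a b. ennreal (k a b)"] by (intro Fubini'[symmetric]) (auto simp: case_prod_beta)
    also have "\<dots> = (\<integral>\<^sup>+ y. indicator A y * of_bool (q (T y) \<noteq> 0) \<partial>\<mu>)"
      by (subst nn_integral_multc) (simp_all add: inner2 mult.commute)
    also have "\<dots> = (\<integral>\<^sup>+ x. indicator A x \<partial>\<mu>)"
      by (rule nn_integral_cong_AE) (use null2 in eventually_elim, auto)
    finally show "emeasure (distr \<gamma> borel snd) A = emeasure \<mu> A" by simp
  qed (simp add: sets_\<mu>)
  have "\<gamma> \<in> couplings \<nu> \<mu>" using d1 d2 pairsets by (simp add: couplings_def \<gamma>_def)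
  moreover have "(\<integral>\<^sup>+ p. ennreal (dist (T (fst p)) (T (snd p))) \<partial>\<gamma>) = ennreal (\<Sum>x\<in>range T\<times>range T. w x * dist (fst x) (snd x))"
  proof -
    have "(\<integral>\<^sup>+ p. ennreal (dist (T (fst p)) (T (snd p))) \<partial>\<gamma>)
       = (\<integral>\<^sup>+ x. \<integral>\<^sup>+ y. ennreal (k (T x) (T y)) * ennreal (dist (T x) (T y)) \<partial>\<mu> \<partial>\<nu>)"
      by (subst \<gamma>int) simp_all
    also have "\<dots> = (\<Sum>a\<in>?F. (\<Sum>b\<in>?F. ennreal (k a b) * ennreal (dist a b) * ennreal (q b)) * ennreal (p a))"
      by (simp add: nn_mu[of "\<lambda>b. ennreal (k _ b) * ennreal (dist _ b)"]
        nn_nu[of "\<lambda>a. \<Sum>b\<in>?F. ennreal (k a b) * ennreal (dist a b) * ennreal (q b)"])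
    also have "\<dots> = ennreal (\<Sum>a\<in>?F. \<Sum>b\<in>?F. k a b * dist a b * q b * p a)"
      using k0 by (simp add: sum_distrib_right p_def q_def sum_ennreal sum_nonneg flip: ennreal_mult)
    also have "(\<Sum>a\<in>?F. \<Sum>b\<in>?F. k a b * dist a b * q b * p a) = (\<Sum>a\<in>?F. \<Sum>b\<in>?F. w (a, b) * dist a b)"
      by (intro sum.cong refl) (auto simp: k_def wp wq)
    also have "\<dots> = (\<Sum>x\<in>?F\<times>?F. w x * dist (fst x) (snd x))"
      by (simp add: sum.cartesian_product case_prod_beta)
    finally show ?thesis .
  qed
  ultimately show ?thesis by (rule that)
qed

text \<open>The direction of duality that bounds the transport cost from above. The potential found
  for the images under \<open>T\<close> is 1-Lipschitz on the whole space and not just on the range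
  of \<open>T\<close>, so the hypothesis \<open>le\<close> applies to it as it stands.\<close>

theorem wasserstein1_le_lipschitz:
  fixes \<nu> \<mu> :: "'a::{real_normed_vector, second_countable_topology} measure"
  assumes "prob_space \<nu>" "prob_space \<mu>" and sets_\<nu>: "sets \<nu> = sets borel" and sets_\<mu>: "sets \<mu> = sets borel"
    and "integrable \<nu> norm" "integrable \<mu> norm"
    and le: "\<And>f. 1-lipschitz_on UNIV f \<Longrightarrow> (\<integral>x. f x \<partial>\<nu>) - (\<integral>x. f x \<partial>\<mu>) \<le> c"
  shows "wasserstein1 \<nu> \<mu> \<le> ennreal c"
proof -
  interpret nu: prob_space \<nu> by fact
  interpret mu: prob_space \<mu> by fact
  note [measurable_cong] = sets_\<nu> sets_\<mu>
  have sp: "space \<nu> = UNIV" "space \<mu> = UNIV"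
    using sets_eq_imp_space_eq[OF sets_\<nu>] sets_eq_imp_space_eq[OF sets_\<mu>] by simp_all
  have c0: "c \<ge> 0" using le[of "\<lambda>_. 0"] by (simp add: lipschitz_on_def)
  show ?thesis
  proof (rule ennreal_le_epsilon)
    fix e :: real assume "e > 0"
    \<comment> \<open>Four errors of this size occur: \<open>f\<close> against \<open>f\<close>
      after \<open>T\<close> under each law, and a point against its image under \<open>T\<close> in
      each marginal of the coupling.\<close>
    then have e4: "e / 4 > 0" by simp
    obtain T where T[measurable]: "T \<in> borel_measurable borel" and fin: "finite (range T)"
      and Ti: "integrable \<nu> (\<lambda>x. dist x (T x))" "integrable \<mu> (\<lambda>x. dist x (T x))"
      and Te: "(\<integral>x. dist x (T x) \<partial>\<nu>) < e / 4" "(\<integral>x. dist x (T x) \<partial>\<mu>) < e / 4"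
      using finite_range_approximation[OF assms(1-6) e4] by metis
    let ?F = "range T"
    define p where "p = (\<lambda>a. measure \<nu> (T -` {a}))"
    define q where "q = (\<lambda>a. measure \<mu> (T -` {a}))"
    have Tset[measurable]: "T -` {a} \<in> sets borel" for a
      using measurable_sets[OF T, of "{a}"] by simp
    have int_nu: "(\<integral>y. g (T y) \<partial>\<nu>) = (\<Sum>b\<in>?F. p b * g b)" for g :: "'a \<Rightarrow> real"
      by (subst finite_range_sum_indicator[OF fin, of g]) (simp add: p_def sp nu.emeasure_eq_measure mult.commute)
    have int_mu: "(\<integral>y. g (T y) \<partial>\<mu>) = (\<Sum>b\<in>?F. q b * g b)" for g :: "'a \<Rightarrow> real"
      by (subst finite_range_sum_indicator[OF fin, of g]) (simp add: q_def sp mu.emeasure_eq_measure mult.commute)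
    have "sum p ?F = sum q ?F"
      using int_nu[of "\<lambda>_. 1"] int_mu[of "\<lambda>_. 1"] by (simp add: nu.prob_space mu.prob_space)
    then obtain w f where w: "w \<in> transport_plans ?F p q" and f: "1-lipschitz_on UNIV f"
      and wf: "(\<Sum>x\<in>?F\<times>?F. w x * dist (fst x) (snd x)) \<le> (\<Sum>a\<in>?F. p a * f a) - (\<Sum>a\<in>?F. q a * f a)"
      using finite_kantorovich_duality[OF fin, of p q] by (auto simp: p_def q_def)
    obtain \<gamma> where \<gamma>: "\<gamma> \<in> couplings \<nu> \<mu>" and \<gamma>T:
      "(\<integral>\<^sup>+ p. ennreal (dist (T (fst p)) (T (snd p))) \<partial>\<gamma>) = ennreal (\<Sum>x\<in>?F\<times>?F. w x * dist (fst x) (snd x))"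
      using coupling_from_plan[OF assms(1-4) T fin] w unfolding p_def q_def by blast
    have \<gamma>s[measurable_cong]: "sets \<gamma> = sets (borel \<Otimes>\<^sub>M borel)" and \<gamma>1: "distr \<gamma> borel fst = \<nu>" and \<gamma>2: "distr \<gamma> borel snd = \<mu>"
      using \<gamma> by (auto simp: couplings_def)
    have fi: "integrable \<nu> f" "integrable \<mu> f" using lipschitz_integrable f assms by blast+
    have [measurable]: "f \<in> borel_measurable borel" using lipschitz_borel_measurable[OF f] .
    have ffin: "finite (range (\<lambda>x. f (T x)))" using fin by (metis finite_imageI image_image)
    then have "bounded (range (\<lambda>x. f (T x)))" by (rule finite_imp_bounded)
    then obtain B where B: "\<bar>f (T x)\<bar> \<le> B" for x by (auto simp: bounded_iff)
    have fTi: "integrable \<nu> (\<lambda>x. f (T x))" "integrable \<mu> (\<lambda>x. f (T x))"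
      using B by (auto intro!: nu.integrable_const_bound[of _ B] mu.integrable_const_bound[of _ B])
    have fT: "\<bar>f x - f (T x)\<bar> \<le> dist x (T x)" for x using lipschitz_abs_le[OF f] by simp
    have "(\<integral>y. f (T y) \<partial>\<nu>) \<le> (\<integral>y. f y + dist y (T y) \<partial>\<nu>)"
      using fT by (intro integral_mono fTi Bochner_Integration.integrable_add fi Ti) (auto simp: abs_le_iff algebra_simps)
    moreover have "(\<integral>y. f y - dist y (T y) \<partial>\<mu>) \<le> (\<integral>y. f (T y) \<partial>\<mu>)"
      using fT by (intro integral_mono fTi Bochner_Integration.integrable_diff fi Ti) (auto simp: abs_le_iff algebra_simps)
    ultimately have "(\<Sum>x\<in>?F\<times>?F. w x * dist (fst x) (snd x)) \<le> c + e / 4 + e / 4"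
      using wf le[OF f] Te unfolding int_nu[symmetric] int_mu[symmetric]
      by (simp add: fi Ti)
    moreover have "(\<integral>\<^sup>+ p. ennreal (dist (fst p) (T (fst p))) \<partial>\<gamma>) \<le> ennreal (e / 4)"
    proof -
      have "(\<integral>\<^sup>+ p. ennreal (dist (fst p) (T (fst p))) \<partial>\<gamma>) = (\<integral>\<^sup>+ x. ennreal (dist x (T x)) \<partial>\<nu>)"
        by (subst \<gamma>1[symmetric], subst nn_integral_distr) auto
      also have "\<dots> = ennreal (\<integral>x. dist x (T x) \<partial>\<nu>)" by (intro nn_integral_eq_integral Ti) auto
      finally show ?thesis using Te by (simp add: ennreal_leI)
    qed
    moreover have "(\<integral>\<^sup>+ p. ennreal (dist (snd p) (T (snd p))) \<partial>\<gamma>) \<le> ennreal (e / 4)"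
    proof -
      have "(\<integral>\<^sup>+ p. ennreal (dist (snd p) (T (snd p))) \<partial>\<gamma>) = (\<integral>\<^sup>+ x. ennreal (dist x (T x)) \<partial>\<mu>)"
        by (subst \<gamma>2[symmetric], subst nn_integral_distr) auto
      also have "\<dots> = ennreal (\<integral>x. dist x (T x) \<partial>\<mu>)" by (intro nn_integral_eq_integral Ti) auto
      finally show ?thesis using Te by (simp add: ennreal_leI)
    qed
    moreover have "(\<integral>\<^sup>+ p. ennreal (norm (fst p - snd p)) \<partial>\<gamma>) \<le>
       (\<integral>\<^sup>+ p. ennreal (dist (fst p) (T (fst p))) + ennreal (dist (T (fst p)) (T (snd p))) + ennreal (dist (snd p) (T (snd p))) \<partial>\<gamma>)"
    proof (rule nn_integral_mono)
      fix x :: "'a \<times> 'a"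
      have "norm (fst x - snd x) \<le> dist (fst x) (T (fst x)) + dist (T (fst x)) (T (snd x)) + dist (snd x) (T (snd x))"
        unfolding dist_norm[symmetric] using dist_triangle[of "fst x" "snd x" "T (fst x)"] dist_triangle[of "T (fst x)" "snd x" "T (snd x)"]
        by (simp add: dist_commute)
      then show "ennreal (norm (fst x - snd x)) \<le> ennreal (dist (fst x) (T (fst x))) + ennreal (dist (T (fst x)) (T (snd x))) + ennreal (dist (snd x) (T (snd x)))"
        by (simp add: ennreal_leI flip: ennreal_plus)
    qed
    moreover have "\<dots> = (\<integral>\<^sup>+ p. ennreal (dist (fst p) (T (fst p))) \<partial>\<gamma>) + (\<integral>\<^sup>+ p. ennreal (dist (T (fst p)) (T (snd p))) \<partial>\<gamma>)
       + (\<integral>\<^sup>+ p. ennreal (dist (snd p) (T (snd p))) \<partial>\<gamma>)"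
      by (subst nn_integral_add; (subst nn_integral_add)?) auto
    ultimately have "(\<integral>\<^sup>+ p. ennreal (norm (fst p - snd p)) \<partial>\<gamma>) \<le> ennreal (e / 4) + ennreal (c + e / 4 + e / 4) + ennreal (e / 4)"
      unfolding \<gamma>T by (smt (verit) add_mono ennreal_leI order_trans)
    also have "\<dots> = ennreal c + ennreal e" using c0 \<open>e > 0\<close> by (simp flip: ennreal_plus)
    finally show "wasserstein1 \<nu> \<mu> \<le> ennreal c + ennreal e"
      unfolding wasserstein1_def using \<gamma> by (meson INF_lower2)
  qed
qed

section \<open>The standard Gaussian law\<close>

lemma integral_lborel_prod:
  fixes f :: "'a::euclidean_space \<Rightarrow> real \<Rightarrow> real"
  assumes int: "\<And>b. b \<in> Basis \<Longrightarrow> integrable lborel (f b)"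
  shows "integrable lborel (\<lambda>x. \<Prod>b\<in>Basis. f b (x \<bullet> b))"
    and "(\<integral>x. (\<Prod>b\<in>Basis. f b (x \<bullet> b)) \<partial>lborel) = (\<Prod>b\<in>Basis. (\<integral>x. f b x \<partial>lborel))"
proof -
  interpret product_sigma_finite "\<lambda>_::'a. lborel::real measure" ..
  have [measurable]: "\<And>b. b \<in> Basis \<Longrightarrow> f b \<in> borel_measurable borel"
    using borel_measurable_integrable[OF int] by simp
  have *: "(lborel :: 'a measure) = distr (\<Pi>\<^sub>M b\<in>Basis. lborel) borel (\<lambda>f. \<Sum>b\<in>Basis. f b *\<^sub>R b)"
    unfolding lborel_eq_real by (simp add: lborel_def)
  have ip: "integrable (\<Pi>\<^sub>M b\<in>Basis. lborel) (\<lambda>x. \<Prod>b\<in>Basis. f b (x b))"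
    by (intro product_integrable_prod int) auto
  show "integrable lborel (\<lambda>x. \<Prod>b\<in>Basis. f b (x \<bullet> b))"
    unfolding * by (subst integrable_distr_eq) (use ip in simp_all)
  show "(\<integral>x. (\<Prod>b\<in>Basis. f b (x \<bullet> b)) \<partial>lborel) = (\<Prod>b\<in>Basis. (\<integral>x. f b x \<partial>lborel))"
    unfolding * by (subst integral_distr) (simp_all add: product_integral_prod int)
qed

definition gauss_density :: "real ^ 'd \<Rightarrow> real" where
  "gauss_density x = (\<Prod>i\<in>UNIV. std_normal_density (x $ i))"

lemma gauss_density_eq:
  "gauss_density (x :: real ^ 'd) = (1 / sqrt (2 * pi)) ^ CARD('d) * exp (- (norm x)\<^sup>2 / 2)"
proof -
  have "(norm x)\<^sup>2 = (\<Sum>i\<in>UNIV. (x $ i)\<^sup>2)"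
    by (simp only: power2_norm_eq_inner inner_vec_def) (simp add: power2_eq_square)
  then show ?thesis
    by (simp add: gauss_density_def std_normal_density_def prod.distrib prod_dividef exp_sum[symmetric]
        sum_negf power_one_over flip: sum_divide_distrib)
qed

lemma gauss_density_nonneg [simp]: "gauss_density x \<ge> 0"
  by (simp add: gauss_density_eq)

lemma gauss_density_measurable [measurable]: "gauss_density \<in> borel_measurable borel"
  unfolding gauss_density_eq[abs_def] by measurable

lemma std_gaussian_eq_density: "std_gaussian = density lborel (\<lambda>x. ennreal (gauss_density x))"
  by (simp add: std_gaussian_def gauss_density_def)

lemma sets_std_gaussian [simp, measurable_cong]: "sets std_gaussian = sets borel"
  and space_std_gaussian [simp]: "space std_gaussian = UNIV"
  by (simp_all add: std_gaussian_eq_density)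

lemma prod_Basis_vec: "(\<Prod>b\<in>Basis. F b) = (\<Prod>i\<in>UNIV. F (axis i (1::real) :: real ^ 'd))"
proof -
  have inj: "inj (\<lambda>i. axis i (1::real) :: real ^ 'd)" by (auto simp: inj_def axis_eq_axis)
  have B: "(Basis :: (real ^ 'd) set) = range (\<lambda>i. axis i 1)" by (auto simp: Basis_vec_def)
  show ?thesis unfolding B by (simp add: prod.reindex[OF inj] o_def)
qed

lemma std_gaussian_prod:
  fixes u :: "'d::finite \<Rightarrow> real \<Rightarrow> real"
  assumes "\<And>i. integrable lborel (\<lambda>x. std_normal_density x * u i x)"
  shows "integrable lborel (\<lambda>x. gauss_density x * (\<Prod>i\<in>UNIV. u i (x $ i)))"
    and "(\<integral>x. gauss_density x * (\<Prod>i\<in>UNIV. u i (x $ i)) \<partial>lborel) = (\<Prod>i\<in>UNIV. \<integral>x. std_normal_density x * u i x \<partial>lborel)"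
proof -
  \<comment> \<open>The product formula for \<open>lborel\<close> is indexed by basis vectors,
    \<open>u\<close> by coordinates; the description operator recovers the coordinate.\<close>
  define f where "f b x = std_normal_density x * u (THE i. b = axis i 1) x" for b :: "real ^ 'd" and x
  have [simp]: "(THE k. axis i (1::real) = (axis k 1 :: real ^ 'd)) = i" for i by (auto simp: axis_eq_axis)
  have int: "integrable lborel (f b)" if "b \<in> Basis" for b
    using that assms by (auto simp: Basis_vec_def f_def[abs_def])
  have 1: "(\<Prod>b\<in>Basis. f b (x \<bullet> b)) = gauss_density x * (\<Prod>i\<in>UNIV. u i (x $ i))" for x
    by (simp add: prod_Basis_vec f_def prod.distrib gauss_density_def inner_axis)
  have 2: "(\<Prod>b\<in>Basis. \<integral>x. f b x \<partial>lborel) = (\<Prod>i\<in>UNIV. \<integral>x. std_normal_density x * u i x \<partial>lborel)"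
    by (simp add: prod_Basis_vec f_def)
  show "integrable lborel (\<lambda>x. gauss_density x * (\<Prod>i\<in>UNIV. u i (x $ i)))"
    "(\<integral>x. gauss_density x * (\<Prod>i\<in>UNIV. u i (x $ i)) \<partial>lborel) = (\<Prod>i\<in>UNIV. \<integral>x. std_normal_density x * u i x \<partial>lborel)"
    using integral_lborel_prod[of f, OF int] unfolding 1 2 by simp_all
qed

lemma integral_std_gaussian:
  fixes f :: "real ^ 'd \<Rightarrow> 'b::{banach, second_countable_topology}"
  assumes "f \<in> borel_measurable borel"
  shows "(\<integral>x. f x \<partial>std_gaussian) = (\<integral>x. gauss_density x *\<^sub>R f x \<partial>lborel)"
    and "integrable std_gaussian f \<longleftrightarrow> integrable lborel (\<lambda>x. gauss_density x *\<^sub>R f x)"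
  using assms by (simp_all add: std_gaussian_eq_density integral_density integrable_density)

lemma gauss_density_integral: "integrable lborel gauss_density" "(\<integral>x. gauss_density x \<partial>lborel) = 1"
  using std_gaussian_prod[of "\<lambda>_ _. 1"] by simp_all

lemma nn_integral_gauss_density: "(\<integral>\<^sup>+x. ennreal (gauss_density x) \<partial>lborel) = 1"
  by (subst nn_integral_eq_integral) (simp_all add: gauss_density_integral)

lemma prob_space_std_gaussian: "prob_space std_gaussian"
  by (rule prob_spaceI) (simp add: std_gaussian_eq_density emeasure_density nn_integral_gauss_density)

lemma measure_std_gaussian_UNIV [simp]: "measure std_gaussian UNIV = 1"
  using prob_space.prob_space[OF prob_space_std_gaussian] by simp

lemma std_gaussian_moments:
  shows "(\<integral>x. x $ i \<partial>std_gaussian) = 0"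
    and "(\<integral>x. x $ i * x $ j \<partial>std_gaussian) = (if i = j then 1 else 0)"
proof -
  have int: "integrable lborel (\<lambda>x. std_normal_density x * x)" "integrable lborel (\<lambda>x. std_normal_density x * (x * x))"
    using integrable_std_normal_moment[of 1] integrable_std_normal_moment[of 2] by (simp_all add: power2_eq_square)
  have val: "(\<integral>x. std_normal_density x * x \<partial>lborel) = 0" "(\<integral>x. std_normal_density x * (x * x) \<partial>lborel) = 1"
    using integral_std_normal_moment_odd[of 0] integral_std_normal_moment_even[of 1]
    by (simp_all add: power2_eq_square fact_numeral)
  let ?u = "\<lambda>k x. if k = i then x else (1::real)"
  let ?v = "\<lambda>k x. (if k = i then x else (1::real)) * (if k = j then x else 1)"
  have u: "integrable lborel (\<lambda>x. std_normal_density x * ?u k x)" for k using int by (cases "k = i") simp_all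
  have v: "integrable lborel (\<lambda>x. std_normal_density x * ?v k x)" for k using int by (cases "k = i"; cases "k = j") simp_all
  have pu: "(\<Prod>k\<in>UNIV. if k = i then y $ k else 1) = y $ i" for i and y :: "real ^ 'a" by (simp add: prod.delta)
  have pv: "(\<Prod>k\<in>UNIV. ?v k (y $ k)) = y $ i * y $ j" for y :: "real ^ 'a" unfolding prod.distrib pu ..
  show "(\<integral>x. x $ i \<partial>std_gaussian) = 0"
  proof -
    have "(\<integral>x. x $ i \<partial>std_gaussian) = (\<Prod>k\<in>UNIV. \<integral>x. std_normal_density x * ?u k x \<partial>lborel)"
      using std_gaussian_prod(2)[of ?u, OF u] unfolding pu by (simp add: integral_std_gaussian)
    also have "\<dots> = 0" by (rule prod_zero, simp, rule bexI[of _ i]) (simp_all add: val)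
    finally show ?thesis .
  qed
  have "(\<integral>x. x $ i * x $ j \<partial>std_gaussian) = (\<Prod>k\<in>UNIV. \<integral>x. std_normal_density x * ?v k x \<partial>lborel)"
    using std_gaussian_prod(2)[of ?v, OF v] unfolding pv by (simp add: integral_std_gaussian)
  also have "\<dots> = (\<Prod>k\<in>UNIV. if i = j \<or> k \<noteq> i \<and> k \<noteq> j then 1 else 0)"
    by (intro prod.cong refl, rename_tac k, case_tac "k = i"; case_tac "k = j") (auto simp: val)
  also have "\<dots> = (if i = j then 1 else 0)" by auto
  finally show "(\<integral>x. x $ i * x $ j \<partial>std_gaussian) = (if i = j then 1 else 0)" .
qed

section \<open>Tails, translations and sums of Gaussian vectors\<close>

lemma lborel_affine_nn_integral:
  fixes f :: "'a::euclidean_space \<Rightarrow> ennreal"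
  assumes [measurable]: "f \<in> borel_measurable borel" and "c \<noteq> 0"
  shows "(\<integral>\<^sup>+x. f x \<partial>lborel) = ennreal (\<bar>c\<bar> ^ DIM('a)) * (\<integral>\<^sup>+x. f (t + c *\<^sub>R x) \<partial>lborel)"
  by (subst lborel_affine[OF assms(2), of t])
    (simp add: nn_integral_density nn_integral_distr nn_integral_cmult)

text \<open>Half of the Gaussian exponent absorbs the growth: \<open>r ^ k \<le> exp (k * r)\<close>
  and \<open>(a + k) * r - r\<^sup>2 / 2 \<le> (a + k)\<^sup>2 - r\<^sup>2 / 4\<close>. What remains
  is a Gaussian of variance 2.\<close>

lemma integrable_gauss_exp_power:
  "integrable std_gaussian (\<lambda>x::real^'d. norm x ^ k * exp (a * norm x))"
proof -
  define K where "K = exp ((a + k)\<^sup>2) * (1 / sqrt (2 * pi)) ^ CARD('d)"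
  have bound: "gauss_density x * (norm x ^ k * exp (a * norm x)) \<le> K * exp (- (norm x)\<^sup>2 / 4)" for x :: "real^'d"
  proof -
    define r where "r = norm x"
    have r: "r \<ge> 0" by (simp add: r_def)
    have "r \<le> exp r" using exp_ge_add_one_self[of r] by linarith
    then have "r ^ k \<le> exp r ^ k" using r by (rule power_mono)
    then have "r ^ k * (exp (a * r) * exp (- r\<^sup>2 / 2)) \<le> exp r ^ k * (exp (a * r) * exp (- r\<^sup>2 / 2))"
      by (intro mult_right_mono) auto
    also have "\<dots> = exp ((a + k) * r - r\<^sup>2 / 2)" by (simp add: exp_add[symmetric] algebra_simps flip: exp_of_nat_mult)
    also have "(a + k) * r - r\<^sup>2 / 2 \<le> (a + k)\<^sup>2 + - r\<^sup>2 / 4"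
      using zero_le_power2[of "a + k - r / 2"] by (simp add: power2_eq_square algebra_simps)
    then have "exp ((a + k) * r - r\<^sup>2 / 2) \<le> exp ((a + k)\<^sup>2 + - r\<^sup>2 / 4)" by simp
    finally have "(1 / sqrt (2 * pi)) ^ CARD('d) * (r ^ k * (exp (a * r) * exp (- r\<^sup>2 / 2))) \<le>
      (1 / sqrt (2 * pi)) ^ CARD('d) * exp ((a + k)\<^sup>2 + - r\<^sup>2 / 4)" by (intro mult_left_mono) auto
    then show ?thesis by (simp only: gauss_density_eq K_def r_def exp_add mult_ac)
  qed
  have "integrable lborel (\<lambda>x::real^'d. exp (- (norm x)\<^sup>2 / 4))"
  proof (rule integrableI_bounded)
    have "(\<integral>\<^sup>+x. ennreal (norm (exp (- (norm (x::real^'d))\<^sup>2 / 4))) \<partial>lborel) =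
      ennreal (sqrt 2 ^ CARD('d)) * (\<integral>\<^sup>+x. ennreal (norm (exp (- (norm (0 + sqrt 2 *\<^sub>R (x::real^'d)))\<^sup>2 / 4))) \<partial>lborel)"
      by (subst lborel_affine_nn_integral[of _ "sqrt 2" 0]) simp_all
    also have "(\<integral>\<^sup>+x. ennreal (norm (exp (- (norm (0 + sqrt 2 *\<^sub>R (x::real^'d)))\<^sup>2 / 4))) \<partial>lborel)
      = (\<integral>\<^sup>+x. ennreal (sqrt (2 * pi) ^ CARD('d)) * ennreal (gauss_density (x::real^'d)) \<partial>lborel)"
      by (intro nn_integral_cong) (simp add: gauss_density_eq power_mult_distrib power_one_over flip: ennreal_mult)
    also have "\<dots> = ennreal (sqrt (2 * pi) ^ CARD('d))" by (simp add: nn_integral_cmult nn_integral_gauss_density)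
    finally show "(\<integral>\<^sup>+x. ennreal (norm (exp (- (norm (x::real^'d))\<^sup>2 / 4))) \<partial>lborel) < \<infinity>"
      by (simp add: ennreal_mult_less_top)
  qed simp
  then have i: "integrable lborel (\<lambda>x::real^'d. K * exp (- (norm x)\<^sup>2 / 4))" by simp
  show ?thesis
    unfolding std_gaussian_eq_density
    by (subst integrable_density) (auto intro!: Bochner_Integration.integrable_bound[OF i] AE_I2 order.trans[OF bound])
qed

lemma integrable_gauss_power: "integrable std_gaussian (\<lambda>x::real^'d. norm x ^ k)"
  using integrable_gauss_exp_power[of k 0] by simp

lemma integrable_gauss_dominated:
  fixes f :: "real^'d \<Rightarrow> real"
  assumes "f \<in> borel_measurable borel" "\<And>x. \<bar>f x\<bar> \<le> c * (norm x ^ k * exp (a * norm x))"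
  shows "integrable std_gaussian f"
  by (rule Bochner_Integration.integrable_bound[OF integrable_mult_right[OF integrable_gauss_exp_power[of k a], of c]])
    (use assms in \<open>auto intro: order.trans[OF _ abs_ge_self]\<close>)

text \<open>\<open>tilt y w\<close> is the density at \<open>y\<close> of the normal law with mean \<open>w\<close> relative to the standard one.\<close>

definition tilt :: "'a::real_inner \<Rightarrow> 'a \<Rightarrow> real" where
  "tilt y w = exp (y \<bullet> w - (w \<bullet> w) / 2)"

lemma tilt_measurable [measurable]: "(\<lambda>y::real^'d. tilt y w) \<in> borel_measurable borel"
  unfolding tilt_def by measurable

lemma gauss_density_shift: "gauss_density (y - w) = gauss_density y * tilt y w"
proof -
  have "- (norm (y - w))\<^sup>2 / 2 = - (norm y)\<^sup>2 / 2 + (y \<bullet> w - (w \<bullet> w) / 2)"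
    by (simp add: power2_norm_eq_inner inner_diff_left inner_diff_right inner_commute field_simps)
  then show ?thesis by (simp only: gauss_density_eq tilt_def exp_add mult.assoc)
qed

text \<open>The Cameron-Martin formula. It moves an increment from the test function into the
  density, which is smooth in \<open>w\<close> whatever \<open>f\<close> is.\<close>

lemma integral_gauss_shift:
  fixes f :: "real^'d \<Rightarrow> real"
  assumes [measurable]: "f \<in> borel_measurable borel"
  shows "(\<integral>y. f (y + w) \<partial>std_gaussian) = (\<integral>y. f y * tilt y w \<partial>std_gaussian)"
    and "integrable std_gaussian (\<lambda>y. f (y + w)) \<longleftrightarrow> integrable std_gaussian (\<lambda>y. f y * tilt y w)"
proof -
  have eq: "gauss_density (y - w) *\<^sub>R f y = gauss_density y *\<^sub>R (f y * tilt y w)" for y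
    by (simp add: gauss_density_shift)
  have "(\<integral>y. gauss_density (y - w) *\<^sub>R f y \<partial>lborel) = (\<integral>y. gauss_density (y - w) *\<^sub>R f y \<partial>(distr lborel borel ((+) w)))"
    by (simp add: lborel_distr_plus)
  also have "\<dots> = (\<integral>y. gauss_density y *\<^sub>R f (y + w) \<partial>lborel)"
    by (subst integral_distr) (simp_all add: add.commute)
  finally show "(\<integral>y. f (y + w) \<partial>std_gaussian) = (\<integral>y. f y * tilt y w \<partial>std_gaussian)"
    unfolding eq by (simp add: integral_std_gaussian)
  have "integrable lborel (\<lambda>y. gauss_density (y - w) *\<^sub>R f y) \<longleftrightarrow> integrable (distr lborel borel ((+) w)) (\<lambda>y. gauss_density (y - w) *\<^sub>R f y)"
    by (simp add: lborel_distr_plus)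
  also have "\<dots> = integrable lborel (\<lambda>y. gauss_density y *\<^sub>R f (y + w))"
    by (subst integrable_distr_eq) (simp_all add: add.commute)
  finally show "integrable std_gaussian (\<lambda>y. f (y + w)) \<longleftrightarrow> integrable std_gaussian (\<lambda>y. f y * tilt y w)"
    unfolding eq by (simp add: integral_std_gaussian)
qed

lemma nn_integral_std_gaussian:
  assumes "f \<in> borel_measurable borel"
  shows "(\<integral>\<^sup>+x. f x \<partial>std_gaussian) = (\<integral>\<^sup>+x. ennreal (gauss_density x) * f x \<partial>lborel)"
  using assms by (simp add: std_gaussian_eq_density nn_integral_density)

text \<open>Completing the square:
  \<open>\<bar>(c z - b y) / a\<bar>\<^sup>2 + \<bar>y\<bar>\<^sup>2 = \<bar>z\<bar>\<^sup>2 + (c / a)\<^sup>2 \<bar>y - (b / c) z\<bar>\<^sup>2\<close>.\<close>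

lemma nn_integral_gauss_add:
  fixes f :: "real^'d \<Rightarrow> ennreal"
  assumes [measurable]: "f \<in> borel_measurable borel" and ab: "a > 0" "b \<ge> 0" and c: "c = sqrt (a\<^sup>2 + b\<^sup>2)"
  shows "(\<integral>\<^sup>+y. \<integral>\<^sup>+x. f (a *\<^sub>R x + b *\<^sub>R y) \<partial>std_gaussian \<partial>std_gaussian) = (\<integral>\<^sup>+z. f (c *\<^sub>R z) \<partial>std_gaussian)"
proof -
  have c2: "c\<^sup>2 = a\<^sup>2 + b\<^sup>2" and c0: "c > 0" using c ab by (auto simp: add_pos_nonneg)
  let ?g = "gauss_density :: real^'d \<Rightarrow> real"
  let ?k = "ennreal ((c / a) ^ CARD('d))"
  have sq: "?g ((c / a) *\<^sub>R z - (b / a) *\<^sub>R y) * ?g y = ?g z * ?g (- (b / a) *\<^sub>R z + (c / a) *\<^sub>R y)" for y z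
  proof -
    define s where "s = c / a"
    define u where "u = b / a"
    have su: "s * s = 1 + u * u" using c2 ab by (simp add: s_def u_def power2_eq_square field_simps)
    have "(norm (s *\<^sub>R z - u *\<^sub>R y))\<^sup>2 + (norm y)\<^sup>2 = (s * s) * (z \<bullet> z) - 2 * s * u * (y \<bullet> z) + (1 + u * u) * (y \<bullet> y)"
      by (simp add: power2_norm_eq_inner inner_diff_left inner_diff_right inner_commute algebra_simps)
    also have "\<dots> = (norm z)\<^sup>2 + (norm (- u *\<^sub>R z + s *\<^sub>R y))\<^sup>2"
      using arg_cong[OF su, of "\<lambda>t. t * (y \<bullet> y)"] arg_cong[OF su, of "\<lambda>t. t * (z \<bullet> z)"]
      by (simp add: power2_norm_eq_inner inner_diff_left inner_diff_right inner_commute algebra_simps)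
    finally have "(norm ((c / a) *\<^sub>R z - (b / a) *\<^sub>R y))\<^sup>2 + (norm y)\<^sup>2 = (norm z)\<^sup>2 + (norm (- (b / a) *\<^sub>R z + (c / a) *\<^sub>R y))\<^sup>2"
      by (simp add: s_def u_def)
    then show ?thesis by (simp add: gauss_density_eq mult_exp_exp mult_ac flip: add_divide_distrib)
  qed
  have "(\<integral>\<^sup>+y. \<integral>\<^sup>+x. f (a *\<^sub>R x + b *\<^sub>R y) \<partial>std_gaussian \<partial>std_gaussian)
    = (\<integral>\<^sup>+y. ennreal (?g y) * (\<integral>\<^sup>+x. ennreal (?g x) * f (a *\<^sub>R x + b *\<^sub>R y) \<partial>lborel) \<partial>lborel)"
    by (simp add: nn_integral_std_gaussian)
  \<comment> \<open>Substitution \<open>x = (c / a) z - (b / a) y\<close>, for which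
    \<open>a x + b y = c z\<close>. Its Jacobian \<open>?k\<close> is used up later, when the
    Gaussian in \<open>y\<close> centred at a multiple of \<open>z\<close> is integrated.\<close>
  also have "\<dots> = (\<integral>\<^sup>+y. ennreal (?g y) * (?k * (\<integral>\<^sup>+z. ennreal (?g ((c / a) *\<^sub>R z - (b / a) *\<^sub>R y)) * f (c *\<^sub>R z) \<partial>lborel)) \<partial>lborel)"
  proof (intro nn_integral_cong arg_cong2[where f="(*)"] refl)
    fix y :: "real^'d"
    show "(\<integral>\<^sup>+x. ennreal (?g x) * f (a *\<^sub>R x + b *\<^sub>R y) \<partial>lborel) = ?k * (\<integral>\<^sup>+z. ennreal (?g ((c / a) *\<^sub>R z - (b / a) *\<^sub>R y)) * f (c *\<^sub>R z) \<partial>lborel)"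
      using c0 ab by (subst lborel_affine_nn_integral[of _ "c / a" "- (b / a) *\<^sub>R y"]) (simp_all add: scaleR_add_right scaleR_diff_right algebra_simps)
  qed
  also have "\<dots> = (\<integral>\<^sup>+y. \<integral>\<^sup>+z. ?k * (ennreal (?g z) * ennreal (?g (- (b / a) *\<^sub>R z + (c / a) *\<^sub>R y)) * f (c *\<^sub>R z)) \<partial>lborel \<partial>lborel)"
    unfolding ennreal_mult[OF gauss_density_nonneg gauss_density_nonneg, symmetric] sq[symmetric]
    by (subst nn_integral_cmult[symmetric]; (subst nn_integral_cmult[symmetric])?) (simp_all add: ennreal_mult mult_ac)
  also have "\<dots> = (\<integral>\<^sup>+z. \<integral>\<^sup>+y. ?k * (ennreal (?g z) * ennreal (?g (- (b / a) *\<^sub>R z + (c / a) *\<^sub>R y)) * f (c *\<^sub>R z)) \<partial>lborel \<partial>lborel)"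
    by (rule lborel_pair.Fubini') simp
  also have "\<dots> = (\<integral>\<^sup>+z. ennreal (?g z) * f (c *\<^sub>R z) * (?k * (\<integral>\<^sup>+y. ennreal (?g (- (b / a) *\<^sub>R z + (c / a) *\<^sub>R y)) \<partial>lborel)) \<partial>lborel)"
    by (simp add: nn_integral_cmult[symmetric] mult_ac)
  also have "\<dots> = (\<integral>\<^sup>+z. f (c *\<^sub>R z) \<partial>std_gaussian)"
  proof -
    have "?k * (\<integral>\<^sup>+y. ennreal (?g (- (b / a) *\<^sub>R z + (c / a) *\<^sub>R y)) \<partial>lborel) = 1" for z
      using c0 ab lborel_affine_nn_integral[of "\<lambda>x. ennreal (?g x)" "c / a" "- (b / a) *\<^sub>R z"]
      by (simp add: nn_integral_gauss_density)
    then show ?thesis by (simp add: nn_integral_std_gaussian)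
  qed
  finally show ?thesis .
qed

section \<open>Taylor expansion of the tilt\<close>

lemma exp_taylor2_remainder:
  fixes u :: real
  shows "\<bar>exp u - (1 + u + u\<^sup>2 / 2)\<bar> \<le> exp \<bar>u\<bar> * \<bar>u\<bar> ^ 3 / 6"
proof -
  obtain t where t: "\<bar>t\<bar> \<le> \<bar>u\<bar>" "exp u = (\<Sum>m<3. u ^ m / fact m) + exp t / fact 3 * u ^ 3"
    using Maclaurin_exp_le[of u 3] by auto
  then have "exp u - (1 + u + u\<^sup>2 / 2) = exp t / 6 * u ^ 3"
    by (simp add: eval_nat_numeral)
  also have "\<bar>\<dots>\<bar> = exp t / 6 * \<bar>u\<bar> ^ 3" by (simp add: abs_mult power_abs)
  also have "\<dots> \<le> exp \<bar>u\<bar> / 6 * \<bar>u\<bar> ^ 3" using t(1) by (intro mult_right_mono) auto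
  finally show ?thesis by simp
qed

lemma exp_taylor0_remainder:
  fixes u :: real
  shows "\<bar>exp u - 1\<bar> \<le> exp \<bar>u\<bar> * \<bar>u\<bar>"
proof -
  obtain t where t: "\<bar>t\<bar> \<le> \<bar>u\<bar>" "exp u = (\<Sum>m<1. u ^ m / fact m) + exp t / fact 1 * u ^ 1"
    using Maclaurin_exp_le[of u 1] by auto
  then have "exp u - 1 = exp t * u" by simp
  also have "\<bar>\<dots>\<bar> = exp t * \<bar>u\<bar>" by (simp add: abs_mult)
  also have "\<dots> \<le> exp \<bar>u\<bar> * \<bar>u\<bar>" using t(1) by (intro mult_right_mono) auto
  finally show ?thesis .
qed

text \<open>The Taylor polynomial of degree two of \<open>tilt y w\<close> in \<open>w\<close>.\<close>

definition tilt2 :: "'a::real_inner \<Rightarrow> 'a \<Rightarrow> real" where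
  "tilt2 y w = 1 + y \<bullet> w + ((y \<bullet> w)\<^sup>2 - w \<bullet> w) / 2"

lemma tilt2_measurable [measurable]: "(\<lambda>y::real^'d. tilt2 y w) \<in> borel_measurable borel"
  unfolding tilt2_def by measurable

lemma tilt_exponent_bound:
  fixes y w :: "'a::real_inner"
  assumes "norm w \<le> 1"
  shows "\<bar>y \<bullet> w - (w \<bullet> w) / 2\<bar> \<le> norm w * (1 + norm y)" "\<bar>y \<bullet> w - (w \<bullet> w) / 2\<bar> \<le> 1 + norm y"
proof -
  have "w \<bullet> w \<le> norm w * 1" unfolding dot_square_norm power2_eq_square using assms by (intro mult_left_mono) auto
  moreover have "\<bar>y \<bullet> w\<bar> \<le> norm w * norm y" using Cauchy_Schwarz_ineq2[of y w] by (simp add: mult.commute)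
  moreover have "\<bar>y \<bullet> w - (w \<bullet> w) / 2\<bar> \<le> \<bar>y \<bullet> w\<bar> + w \<bullet> w"
    using inner_ge_zero[of w] by linarith
  ultimately show 1: "\<bar>y \<bullet> w - (w \<bullet> w) / 2\<bar> \<le> norm w * (1 + norm y)" by (simp add: algebra_simps)
  have "norm w * (1 + norm y) \<le> 1 * (1 + norm y)" using assms by (intro mult_right_mono) auto
  then show "\<bar>y \<bullet> w - (w \<bullet> w) / 2\<bar> \<le> 1 + norm y" using order.trans[OF 1] by simp
qed

text \<open>Expand the exponential to second order in
  \<open>u = y \<bullet> w - (w \<bullet> w) / 2\<close>. Of \<open>u\<^sup>2 / 2\<close>, the
  polynomial \<open>tilt2\<close> keeps only \<open>(y \<bullet> w)\<^sup>2 / 2\<close>; the dropped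
  terms are of third and fourth order in \<open>w\<close>.\<close>

lemma tilt_remainder_small:
  fixes y w :: "'a::real_inner"
  assumes w: "norm w \<le> 1"
  shows "\<bar>tilt y w - tilt2 y w\<bar> \<le> norm w ^ 3 * ((1 + norm y) ^ 3 * exp (1 + norm y))"
proof -
  define a where "a = y \<bullet> w"
  define b where "b = w \<bullet> w"
  define u where "u = a - b / 2"
  define s where "s = norm w"
  define r where "r = norm y"
  have sr: "0 \<le> s" "s \<le> 1" "0 \<le> r" by (auto simp: s_def r_def w)
  have b: "b = s\<^sup>2" by (simp add: b_def s_def power2_norm_eq_inner)
  have a: "\<bar>a\<bar> \<le> s * r" using Cauchy_Schwarz_ineq2[of y w] by (simp add: a_def s_def r_def mult.commute)
  have u: "\<bar>u\<bar> \<le> s * (1 + r)" "\<bar>u\<bar> \<le> 1 + r"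
    using tilt_exponent_bound[OF w, of y] by (simp_all add: u_def a_def b_def s_def r_def)
  have "tilt y w - tilt2 y w = (exp u - (1 + u + u\<^sup>2 / 2)) + (- (a * b) / 2 + b\<^sup>2 / 8)"
    by (simp add: tilt_def tilt2_def a_def[symmetric] b_def[symmetric] u_def power2_eq_square algebra_simps add_divide_distrib diff_divide_distrib)
  also have "\<bar>\<dots>\<bar> \<le> exp (1 + r) * (s * (1 + r)) ^ 3 / 6 + (s ^ 3 * r / 2 + s ^ 3 / 8)"
  proof (rule order.trans[OF abs_triangle_ineq], rule add_mono)
    have "\<bar>exp u - (1 + u + u\<^sup>2 / 2)\<bar> \<le> exp \<bar>u\<bar> * \<bar>u\<bar> ^ 3 / 6" by (rule exp_taylor2_remainder)
    also have "\<dots> \<le> exp (1 + r) * (s * (1 + r)) ^ 3 / 6"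
      using u sr by (intro divide_right_mono mult_mono power_mono) auto
    finally show "\<bar>exp u - (1 + u + u\<^sup>2 / 2)\<bar> \<le> exp (1 + r) * (s * (1 + r)) ^ 3 / 6" .
    have "\<bar>a * b\<bar> \<le> (s * r) * s\<^sup>2" using a by (auto simp: abs_mult b intro!: mult_right_mono)
    then have "\<bar>a * b\<bar> \<le> s ^ 3 * r" by (simp add: eval_nat_numeral mult_ac)
    moreover have "b\<^sup>2 \<le> s ^ 3" using sr power_decreasing[of 3 4 s] by (simp add: b flip: power_mult)
    ultimately show "\<bar>- (a * b) / 2 + b\<^sup>2 / 8\<bar> \<le> s ^ 3 * r / 2 + s ^ 3 / 8"
      using zero_le_power2[of b] by arith
  qed
  also have "\<dots> = s ^ 3 * (exp (1 + r) * (1 + r) ^ 3 / 6 + r / 2 + 1 / 8)"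
    unfolding power_mult_distrib by (simp add: distrib_left mult_ac)
  also have "\<dots> \<le> s ^ 3 * ((1 + r) ^ 3 * exp (1 + r))"
  proof (intro mult_left_mono)
    have "1 * (1 + r) \<le> exp (1 + r) * (1 + r) ^ 3"
      using sr power_increasing[of 1 3 "1 + r"] by (intro mult_mono) auto
    then show "exp (1 + r) * (1 + r) ^ 3 / 6 + r / 2 + 1 / 8 \<le> (1 + r) ^ 3 * exp (1 + r)"
      using sr by (simp add: mult.commute)
  qed (use sr in auto)
  finally show ?thesis by (simp add: s_def r_def)
qed

lemma integrable_gauss_poly_exp:
  "integrable std_gaussian (\<lambda>y::real^'d. norm y ^ j * ((1 + norm y) ^ k * exp (1 + norm y)))"
proof (rule integrable_gauss_dominated[of _ "exp 1" j "real k + 1"])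
  fix y :: "real^'d"
  have "(1 + norm y) ^ k \<le> exp (norm y) ^ k" by (intro power_mono) auto
  then have "(1 + norm y) ^ k * exp (1 + norm y) \<le> exp (norm y) ^ k * exp (1 + norm y)" by (intro mult_right_mono) auto
  also have "\<dots> = exp 1 * exp ((real k + 1) * norm y)" by (simp add: exp_add[symmetric] algebra_simps flip: exp_of_nat_mult)
  finally have "norm y ^ j * ((1 + norm y) ^ k * exp (1 + norm y)) \<le> norm y ^ j * (exp 1 * exp ((real k + 1) * norm y))"
    by (intro mult_left_mono) auto
  then show "\<bar>norm y ^ j * ((1 + norm y) ^ k * exp (1 + norm y))\<bar> \<le> exp 1 * (norm y ^ j * exp ((real k + 1) * norm y))"
    by (simp add: mult_ac abs_mult)
qed measurable

lemma integrable_gauss_norm [simp]: "integrable std_gaussian (\<lambda>y::real^'d. norm y)"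
  using integrable_gauss_power[of 1] by simp

lemma integrable_gauss_norm_tilt:
  "integrable std_gaussian (\<lambda>y::real^'d. norm y * tilt y w)"
  "(\<integral>y. norm y * tilt y w \<partial>(std_gaussian :: (real^'d) measure)) \<le> (\<integral>y. norm y \<partial>(std_gaussian :: (real^'d) measure)) + norm w"
proof -
  interpret prob_space "std_gaussian :: (real^'d) measure" by (rule prob_space_std_gaussian)
  have i: "integrable std_gaussian (\<lambda>y::real^'d. norm (y + w))"
    by (rule Bochner_Integration.integrable_bound[of _ "\<lambda>y. norm y + norm w"])
      (auto simp: norm_triangle_ineq)
  then show "integrable std_gaussian (\<lambda>y::real^'d. norm y * tilt y w)"
    by (subst integral_gauss_shift(2)[symmetric]) simp_all
  have "(\<integral>y. norm y * tilt y w \<partial>(std_gaussian :: (real^'d) measure)) = (\<integral>y. norm (y + w) \<partial>(std_gaussian :: (real^'d) measure))"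
    by (subst integral_gauss_shift(1)[symmetric]) simp_all
  also have "\<dots> \<le> (\<integral>y. norm y + norm w \<partial>(std_gaussian :: (real^'d) measure))"
    by (intro integral_mono i) (auto simp: norm_triangle_ineq)
  finally show "(\<integral>y. norm y * tilt y w \<partial>(std_gaussian :: (real^'d) measure)) \<le> (\<integral>y. norm y \<partial>(std_gaussian :: (real^'d) measure)) + norm w"
    by (simp add: prob_space)
qed

lemma integrable_gauss_tilt:
  "integrable std_gaussian (\<lambda>y::real^'d. tilt y w)" "(\<integral>y. tilt y w \<partial>(std_gaussian :: (real^'d) measure)) = 1"
proof -
  interpret prob_space "std_gaussian :: (real^'d) measure" by (rule prob_space_std_gaussian)
  show "integrable std_gaussian (\<lambda>y::real^'d. tilt y w)"
    using integral_gauss_shift(2)[of "\<lambda>_::real^'d. 1" w] by simp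
  show "(\<integral>y. tilt y w \<partial>(std_gaussian :: (real^'d) measure)) = 1"
    using integral_gauss_shift(1)[of "\<lambda>_::real^'d. 1" w] by (simp add: prob_space)
qed

lemma tilt2_abs_le:
  fixes y w :: "'a::real_inner"
  shows "\<bar>tilt2 y w\<bar> \<le> 1 + norm y * norm w + ((norm y * norm w)\<^sup>2 + (norm w)\<^sup>2) / 2"
proof -
  have a: "\<bar>y \<bullet> w\<bar> \<le> norm y * norm w" by (rule Cauchy_Schwarz_ineq2)
  then have "(y \<bullet> w)\<^sup>2 \<le> (norm y * norm w)\<^sup>2" by (metis abs_ge_zero power2_abs power_mono)
  moreover have "\<bar>1 + a + (A - s) / 2\<bar> \<le> 1 + c + (C + s) / 2"
    if "\<bar>a\<bar> \<le> c" "A \<le> C" "0 \<le> A" "0 \<le> s" for a c s A C :: real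
  proof (rule abs_leI)
    show "1 + a + (A - s) / 2 \<le> 1 + c + (C + s) / 2"
      using abs_le_D1[OF that(1)] that by (simp add: field_simps)
    show "- (1 + a + (A - s) / 2) \<le> 1 + c + (C + s) / 2"
      using abs_le_D2[OF that(1)] that by (simp add: field_simps)
  qed
  ultimately show ?thesis using a unfolding tilt2_def power2_norm_eq_inner[symmetric] by simp
qed

lemma integrable_gauss_norm_tilt2:
  "integrable std_gaussian (\<lambda>y::real^'d. norm y * \<bar>tilt2 y w\<bar>)"
proof (rule Bochner_Integration.integrable_bound)
  show "integrable std_gaussian (\<lambda>y::real^'d. norm y ^ 1 + norm w * norm y ^ 2 + ((norm w)\<^sup>2 / 2) * norm y ^ 3 + ((norm w)\<^sup>2 / 2) * norm y ^ 1)"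
    by (intro Bochner_Integration.integrable_add integrable_mult_right integrable_gauss_power)
  show "AE y::real^'d in std_gaussian. norm (norm y * \<bar>tilt2 y w\<bar>) \<le> norm (norm y ^ 1 + norm w * norm y ^ 2 + ((norm w)\<^sup>2 / 2) * norm y ^ 3 + ((norm w)\<^sup>2 / 2) * norm y ^ 1)"
  proof (rule AE_I2)
    fix y :: "real^'d"
    have "norm y * \<bar>tilt2 y w\<bar> \<le> norm y * (1 + norm y * norm w + ((norm y * norm w)\<^sup>2 + (norm w)\<^sup>2) / 2)"
      by (intro mult_left_mono tilt2_abs_le) auto
    also have "\<dots> = norm y ^ 1 + norm w * norm y ^ 2 + ((norm w)\<^sup>2 / 2) * norm y ^ 3 + ((norm w)\<^sup>2 / 2) * norm y ^ 1"
      by (simp add: power2_eq_square power3_eq_cube algebra_simps)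
    finally show "norm (norm y * \<bar>tilt2 y w\<bar>) \<le> norm (norm y ^ 1 + norm w * norm y ^ 2 + ((norm w)\<^sup>2 / 2) * norm y ^ 3 + ((norm w)\<^sup>2 / 2) * norm y ^ 1)"
      by (simp add: abs_mult)
  qed
qed measurable

text \<open>The weight \<open>norm y\<close> is the growth of a Lipschitz function around a point.
  For small \<open>w\<close> the bound is Taylor's; for \<open>norm w \<ge> 1\<close> the two
  functions are bounded separately, because lower powers of \<open>norm w\<close> are then at most
  its cube.\<close>

lemma gauss_tilt_remainder:
  obtains C where "C \<ge> 0" "\<And>w. integrable std_gaussian (\<lambda>y::real^'d. norm y * \<bar>tilt y w - tilt2 y w\<bar>)"
    "\<And>w. (\<integral>y. norm y * \<bar>tilt y w - tilt2 y w\<bar> \<partial>(std_gaussian :: (real^'d) measure)) \<le> C * norm w ^ 3"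
proof -
  let ?G = "std_gaussian :: (real^'d) measure"
  interpret prob_space ?G by (rule prob_space_std_gaussian)
  define m where "m k = (\<integral>y. norm y ^ k \<partial>?G)" for k
  have m0: "m k \<ge> 0" for k by (simp add: m_def)
  define C1 where "C1 = (\<integral>y. norm y ^ 1 * ((1 + norm y) ^ 3 * exp (1 + norm y)) \<partial>?G)"
  define C2 where "C2 = (m 1 + 1) + (m 1 + m 2 + m 3 + m 1)"
  have C1: "C1 \<ge> 0" by (simp add: C1_def)
  have C2: "C2 \<ge> 0" using m0 by (simp add: C2_def)
  have int: "integrable ?G (\<lambda>y. norm y * \<bar>tilt y w - tilt2 y w\<bar>)" for w
  proof (rule Bochner_Integration.integrable_bound[OF Bochner_Integration.integrable_add[OF integrable_gauss_norm_tilt(1)[of w] integrable_gauss_norm_tilt2[of w]]])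
    show "AE y in ?G. norm (norm y * \<bar>tilt y w - tilt2 y w\<bar>) \<le> norm (norm y * tilt y w + norm y * \<bar>tilt2 y w\<bar>)"
    proof (rule AE_I2)
      fix y :: "real^'d"
      have "tilt y w \<ge> 0" by (simp add: tilt_def)
      then have "\<bar>tilt y w - tilt2 y w\<bar> \<le> tilt y w + \<bar>tilt2 y w\<bar>" by linarith
      then have "norm y * \<bar>tilt y w - tilt2 y w\<bar> \<le> norm y * (tilt y w + \<bar>tilt2 y w\<bar>)" by (intro mult_left_mono) auto
      then show "norm (norm y * \<bar>tilt y w - tilt2 y w\<bar>) \<le> norm (norm y * tilt y w + norm y * \<bar>tilt2 y w\<bar>)"
        by (simp add: abs_mult distrib_left)
    qed
  qed measurable
  have bound: "(\<integral>y. norm y * \<bar>tilt y w - tilt2 y w\<bar> \<partial>?G) \<le> (C1 + C2) * norm w ^ 3" for w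
  proof (cases "norm w \<le> 1")
    case True
    have "(\<integral>y. norm y * \<bar>tilt y w - tilt2 y w\<bar> \<partial>?G) \<le> (\<integral>y. norm w ^ 3 * (norm y ^ 1 * ((1 + norm y) ^ 3 * exp (1 + norm y))) \<partial>?G)"
    proof (intro integral_mono int integrable_mult_right integrable_gauss_poly_exp)
      fix y :: "real^'d"
      show "norm y * \<bar>tilt y w - tilt2 y w\<bar> \<le> norm w ^ 3 * (norm y ^ 1 * ((1 + norm y) ^ 3 * exp (1 + norm y)))"
        using mult_left_mono[OF tilt_remainder_small[OF True, of y], of "norm y"] by (simp add: mult_ac)
    qed
    also have "\<dots> = C1 * norm w ^ 3" by (simp add: C1_def)
    also have "\<dots> \<le> (C1 + C2) * norm w ^ 3" using C2 by (intro mult_right_mono) auto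
    finally show ?thesis .
  next
    case False
    then have w: "norm w \<ge> 1" by simp
    have p: "1 \<le> norm w ^ 3" "norm w \<le> norm w ^ 3" "(norm w)\<^sup>2 \<le> norm w ^ 3"
      using w power_increasing[of 0 3 "norm w"] power_increasing[of 1 3 "norm w"] power_increasing[of 2 3 "norm w"] by auto
    have "(\<integral>y. norm y * \<bar>tilt y w - tilt2 y w\<bar> \<partial>?G) \<le> (\<integral>y. norm y * tilt y w +
        (norm y ^ 1 + norm w * norm y ^ 2 + ((norm w)\<^sup>2 / 2) * norm y ^ 3 + ((norm w)\<^sup>2 / 2) * norm y ^ 1) \<partial>?G)"
    proof (intro integral_mono int Bochner_Integration.integrable_add integrable_gauss_norm_tilt integrable_mult_right integrable_gauss_power)
      fix y :: "real^'d"
      have "tilt y w \<ge> 0" by (simp add: tilt_def)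
      then have "\<bar>tilt y w - tilt2 y w\<bar> \<le> tilt y w + (1 + norm y * norm w + ((norm y * norm w)\<^sup>2 + (norm w)\<^sup>2) / 2)"
        using tilt2_abs_le[of y w] by linarith
      then have "norm y * \<bar>tilt y w - tilt2 y w\<bar> \<le> norm y * (tilt y w + (1 + norm y * norm w + ((norm y * norm w)\<^sup>2 + (norm w)\<^sup>2) / 2))"
        by (intro mult_left_mono) auto
      then show "norm y * \<bar>tilt y w - tilt2 y w\<bar> \<le> norm y * tilt y w +
        (norm y ^ 1 + norm w * norm y ^ 2 + ((norm w)\<^sup>2 / 2) * norm y ^ 3 + ((norm w)\<^sup>2 / 2) * norm y ^ 1)"
        by (simp add: power2_eq_square power3_eq_cube algebra_simps add_divide_distrib)
    qed
    also have "\<dots> = (\<integral>y. norm y * tilt y w \<partial>?G) + (m 1 + norm w * m 2 + (norm w)\<^sup>2 / 2 * m 3 + (norm w)\<^sup>2 / 2 * m 1)"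
      by (simp add: m_def integrable_gauss_norm_tilt integrable_gauss_power)
    also have "\<dots> \<le> (m 1 * norm w ^ 3 + norm w ^ 3) + (m 1 * norm w ^ 3 + norm w ^ 3 * m 2 + norm w ^ 3 * m 3 + norm w ^ 3 * m 1)"
    proof (intro add_mono)
      have "(\<integral>y. norm y * tilt y w \<partial>?G) \<le> m 1 + norm w" using integrable_gauss_norm_tilt(2)[of w] by (simp add: m_def)
      also have "\<dots> \<le> m 1 * norm w ^ 3 + norm w ^ 3" using p m0[of 1] mult_left_mono[OF p(1) m0[of 1]] by simp
      finally show "(\<integral>y. norm y * tilt y w \<partial>?G) \<le> m 1 * norm w ^ 3 + norm w ^ 3" .
      show "m 1 \<le> m 1 * norm w ^ 3" using mult_left_mono[OF p(1) m0[of 1]] by simp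
      show "norm w * m 2 \<le> norm w ^ 3 * m 2" using p m0 by (intro mult_right_mono) auto
      have "(norm w)\<^sup>2 / 2 \<le> norm w ^ 3" using p by simp
      note * = mult_right_mono[OF this m0]
      show "(norm w)\<^sup>2 / 2 * m 3 \<le> norm w ^ 3 * m 3" by (rule *)
      show "(norm w)\<^sup>2 / 2 * m 1 \<le> norm w ^ 3 * m 1" by (rule *)
    qed
    also have "\<dots> = C2 * norm w ^ 3" by (simp add: C2_def algebra_simps)
    also have "\<dots> \<le> (C1 + C2) * norm w ^ 3" using C1 by (intro mult_right_mono) auto
    finally show ?thesis .
  qed
  show ?thesis by (rule that[of "C1 + C2"]) (use C1 C2 int bound in auto)
qed

text \<open>Twice the total variation distance of two Gaussian laws whose means differ by
  \<open>w\<close>: linear for small \<open>w\<close>, and never above \<open>2\<close>.\<close>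

lemma gauss_tilt_L1:
  obtains C where "C \<ge> 0" "\<And>w. (\<integral>y. \<bar>tilt y w - 1\<bar> \<partial>(std_gaussian :: (real^'d) measure)) \<le> C * norm w"
proof -
  let ?G = "std_gaussian :: (real^'d) measure"
  interpret prob_space ?G by (rule prob_space_std_gaussian)
  define C1 where "C1 = (\<integral>y. norm y ^ 0 * ((1 + norm y) ^ 1 * exp (1 + norm y)) \<partial>?G)"
  have C1: "C1 \<ge> 0" by (simp add: C1_def)
  have int: "integrable ?G (\<lambda>y. \<bar>tilt y w - 1\<bar>)" for w
    using integrable_gauss_tilt by (intro integrable_abs Bochner_Integration.integrable_diff) auto
  have "(\<integral>y. \<bar>tilt y w - 1\<bar> \<partial>?G) \<le> (C1 + 2) * norm w" for w
  proof (cases "norm w \<le> 1")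
    case True
    have "(\<integral>y. \<bar>tilt y w - 1\<bar> \<partial>?G) \<le> (\<integral>y. norm w * (norm y ^ 0 * ((1 + norm y) ^ 1 * exp (1 + norm y))) \<partial>?G)"
    proof (intro integral_mono int integrable_mult_right integrable_gauss_poly_exp)
      fix y :: "real^'d"
      have "\<bar>tilt y w - 1\<bar> \<le> exp \<bar>y \<bullet> w - (w \<bullet> w) / 2\<bar> * \<bar>y \<bullet> w - (w \<bullet> w) / 2\<bar>"
        unfolding tilt_def by (rule exp_taylor0_remainder)
      also have "\<dots> \<le> exp (1 + norm y) * (norm w * (1 + norm y))"
        using tilt_exponent_bound[OF True, of y] by (intro mult_mono) auto
      finally show "\<bar>tilt y w - 1\<bar> \<le> norm w * (norm y ^ 0 * ((1 + norm y) ^ 1 * exp (1 + norm y)))"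
        by (simp add: mult_ac)
    qed
    also have "\<dots> = C1 * norm w" by (simp add: C1_def)
    also have "\<dots> \<le> (C1 + 2) * norm w" by (intro mult_right_mono) auto
    finally show ?thesis .
  next
    case False
    have "(\<integral>y. \<bar>tilt y w - 1\<bar> \<partial>?G) \<le> (\<integral>y. tilt y w + 1 \<partial>?G)"
    proof (intro integral_mono int Bochner_Integration.integrable_add integrable_gauss_tilt)
      fix y :: "real^'d"
      have "tilt y w \<ge> 0" by (simp add: tilt_def)
      then show "\<bar>tilt y w - 1\<bar> \<le> tilt y w + 1" by linarith
    qed simp
    also have "\<dots> = 2" by (simp add: integrable_gauss_tilt prob_space)
    also have "\<dots> \<le> 2 * norm w" using False by simp
    also have "\<dots> \<le> (C1 + 2) * norm w" using C1 by (intro mult_right_mono) auto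
    finally show ?thesis .
  qed
  then show ?thesis using that[of "C1 + 2"] C1 by auto
qed

section \<open>Convolution operators and the central limit theorem\<close>

definition finite_mean_law :: "'a::{real_normed_vector, second_countable_topology} measure \<Rightarrow> bool" where
  "finite_mean_law \<mu> \<longleftrightarrow> prob_space \<mu> \<and> sets \<mu> = sets borel \<and> integrable \<mu> norm"

text \<open>The transition operator of the random walk with increment law \<open>\<mu>\<close>: the
  \<open>n\<close>-th iterate at \<open>x\<close> averages \<open>f\<close> over \<open>x\<close>
  plus a sum of \<open>n\<close> independent increments.\<close>

definition smooth_by :: "'a::real_normed_vector measure \<Rightarrow> ('a \<Rightarrow> real) \<Rightarrow> 'a \<Rightarrow> real" where
  "smooth_by \<mu> f x = (\<integral>y. f (x + y) \<partial>\<mu>)"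

lemma finite_mean_law_lipschitz_integrable:
  assumes "finite_mean_law \<mu>" "L-lipschitz_on UNIV f"
  shows "integrable \<mu> (f :: _ \<Rightarrow> real)"
  using assms lipschitz_integrable unfolding finite_mean_law_def by blast

lemma lipschitz_shift:
  fixes f :: "'a::real_normed_vector \<Rightarrow> real"
  assumes "L-lipschitz_on UNIV f"
  shows "L-lipschitz_on UNIV (\<lambda>y. f (x + y))"
  using assms unfolding lipschitz_on_def by (metis UNIV_I dist_add_cancel)

lemma lipschitz_onI_abs:
  fixes f :: "'a::metric_space \<Rightarrow> real"
  assumes "L \<ge> 0" "\<And>x y. f x - f y \<le> L * dist x y"
  shows "L-lipschitz_on UNIV f"
proof (rule lipschitz_onI)
  fix x y
  show "dist (f x) (f y) \<le> L * dist x y"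
    using assms(2)[of x y] assms(2)[of y x] by (simp add: dist_real_def dist_commute abs_le_iff)
qed fact

lemma smooth_by_integrable:
  assumes "finite_mean_law \<mu>" "L-lipschitz_on UNIV f"
  shows "integrable \<mu> (\<lambda>y. f (x + y) :: real)"
  using finite_mean_law_lipschitz_integrable[OF assms(1) lipschitz_shift[OF assms(2)]] .

lemma smooth_by_lipschitz:
  assumes "finite_mean_law \<mu>" "L-lipschitz_on UNIV f"
  shows "L-lipschitz_on UNIV (smooth_by \<mu> f)"
proof (rule lipschitz_onI_abs)
  interpret prob_space \<mu> using assms(1) by (simp add: finite_mean_law_def)
  fix x y :: 'a
  have i: "integrable \<mu> (\<lambda>z. f (x + z))" for x by (rule smooth_by_integrable[OF assms])
  have "smooth_by \<mu> f x - smooth_by \<mu> f y = (\<integral>z. f (x + z) - f (y + z) \<partial>\<mu>)"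
    unfolding smooth_by_def by (simp add: i)
  also have "\<dots> \<le> (\<integral>z. L * dist x y \<partial>\<mu>)"
  proof (intro integral_mono Bochner_Integration.integrable_diff i)
    show "f (x + z) - f (y + z) \<le> L * dist x y" for z
      using lipschitz_abs_le[OF assms(2), of "x + z" "y + z"] by simp
  qed simp
  finally show "smooth_by \<mu> f x - smooth_by \<mu> f y \<le> L * dist x y" by (simp add: prob_space)
qed (use lipschitz_on_nonneg[OF assms(2)] in auto)

lemma smooth_by_diff:
  assumes "finite_mean_law \<mu>" "L-lipschitz_on UNIV f" "L'-lipschitz_on UNIV g"
  shows "smooth_by \<mu> (\<lambda>x. f x - g x) x = smooth_by \<mu> f x - smooth_by \<mu> g x"
  unfolding smooth_by_def by (subst Bochner_Integration.integral_diff) (auto intro: smooth_by_integrable assms)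

lemma lipschitz_diff:
  fixes f g :: "'a::metric_space \<Rightarrow> real"
  assumes "L-lipschitz_on UNIV f" "L'-lipschitz_on UNIV g"
  shows "(L + L')-lipschitz_on UNIV (\<lambda>x. f x - g x)"
proof (rule lipschitz_onI_abs)
  fix x y
  show "f x - g x - (f y - g y) \<le> (L + L') * dist x y"
    using lipschitz_abs_le[OF assms(1), of x y] lipschitz_abs_le[OF assms(2), of x y] by (simp add: algebra_simps)
qed (use lipschitz_on_nonneg assms in \<open>auto intro: add_nonneg_nonneg\<close>)

lemma integrable_pair_fst:
  fixes f :: "'a \<Rightarrow> real"
  assumes "sigma_finite_measure M1" "prob_space M2" and f: "integrable M1 f"
  shows "integrable (M1 \<Otimes>\<^sub>M M2) (\<lambda>p. f (fst p))"
proof (rule integrableI_bounded)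
  interpret M2: prob_space M2 by fact
  have [measurable]: "f \<in> borel_measurable M1" using f by simp
  show "(\<lambda>p. f (fst p)) \<in> borel_measurable (M1 \<Otimes>\<^sub>M M2)" by measurable
  have "(\<integral>\<^sup>+p. ennreal (norm (f (fst p))) \<partial>(M1 \<Otimes>\<^sub>M M2)) = (\<integral>\<^sup>+x. ennreal (norm (f x)) \<partial>M1)"
    by (subst M2.nn_integral_fst[symmetric]) (simp_all add: M2.emeasure_space_1)
  then show "(\<integral>\<^sup>+p. ennreal (norm (f (fst p))) \<partial>(M1 \<Otimes>\<^sub>M M2)) < \<infinity>"
    using f by (simp add: integrable_iff_bounded)
qed

lemma integrable_pair_snd:
  fixes f :: "'a \<Rightarrow> real"
  assumes "prob_space M1" "sigma_finite_measure M2" and f: "integrable M2 f"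
  shows "integrable (M1 \<Otimes>\<^sub>M M2) (\<lambda>p. f (snd p))"
proof (rule integrableI_bounded)
  interpret M1: prob_space M1 by fact
  interpret M2: sigma_finite_measure M2 by fact
  have [measurable]: "f \<in> borel_measurable M2" using f by simp
  show "(\<lambda>p. f (snd p)) \<in> borel_measurable (M1 \<Otimes>\<^sub>M M2)" by measurable
  have "(\<integral>\<^sup>+p. ennreal (norm (f (snd p))) \<partial>(M1 \<Otimes>\<^sub>M M2)) = (\<integral>\<^sup>+x. ennreal (norm (f x)) \<partial>M2)"
    by (subst M2.nn_integral_fst[symmetric]) (simp_all add: M1.emeasure_space_1)
  then show "(\<integral>\<^sup>+p. ennreal (norm (f (snd p))) \<partial>(M1 \<Otimes>\<^sub>M M2)) < \<infinity>"
    using f by (simp add: integrable_iff_bounded)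
qed

lemma emeasure_distr_eq_nn_integral:
  assumes "g \<in> measurable M N" "A \<in> sets N"
  shows "emeasure (distr M N g) A = (\<integral>\<^sup>+x. indicator A (g x) \<partial>M)"
proof -
  have "(\<integral>\<^sup>+x. indicator A (g x) \<partial>M) = (\<integral>\<^sup>+y. indicator A y \<partial>distr M N g)"
    using assms by (subst nn_integral_distr) auto
  then show ?thesis using assms by simp
qed

lemma smooth_by_pair:
  fixes f :: "'a::{real_normed_vector, second_countable_topology} \<Rightarrow> real"
  assumes \<mu>: "finite_mean_law \<mu>" and \<nu>: "finite_mean_law \<nu>" and f: "L-lipschitz_on UNIV f"
  shows "integrable (\<mu> \<Otimes>\<^sub>M \<nu>) (\<lambda>(y, z). f (x + y + z))"
    and "smooth_by \<mu> (smooth_by \<nu> f) x = (\<integral>p. f (x + fst p + snd p) \<partial>(\<mu> \<Otimes>\<^sub>M \<nu>))"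
proof -
  interpret m: prob_space \<mu> using \<mu> by (simp add: finite_mean_law_def)
  interpret n: prob_space \<nu> using \<nu> by (simp add: finite_mean_law_def)
  interpret pair_prob_space \<mu> \<nu> ..
  have [measurable_cong]: "sets \<mu> = sets borel" "sets \<nu> = sets borel" using \<mu> \<nu> by (simp_all add: finite_mean_law_def)
  have [measurable]: "f \<in> borel_measurable borel" by (rule lipschitz_borel_measurable[OF f])
  have i1: "integrable (\<mu> \<Otimes>\<^sub>M \<nu>) (\<lambda>p. norm (fst p))"
    using \<mu> by (intro integrable_pair_fst) (unfold_locales, simp add: finite_mean_law_def)
  have i2: "integrable (\<mu> \<Otimes>\<^sub>M \<nu>) (\<lambda>p. norm (snd p))"
    using \<nu> by (intro integrable_pair_snd) (unfold_locales, simp add: finite_mean_law_def)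
  show i: "integrable (\<mu> \<Otimes>\<^sub>M \<nu>) (\<lambda>(y, z). f (x + y + z))"
  proof (rule Bochner_Integration.integrable_bound[of _ "\<lambda>p. norm (f x) + L * norm (fst p) + L * norm (snd p)"])
    show "AE p in \<mu> \<Otimes>\<^sub>M \<nu>. norm (case p of (y, z) \<Rightarrow> f (x + y + z)) \<le> norm (norm (f x) + L * norm (fst p) + L * norm (snd p))"
    proof (rule AE_I2)
      fix p :: "'a \<times> 'a"
      have L: "L \<ge> 0" by (rule lipschitz_on_nonneg[OF f])
      have "\<bar>f (x + fst p + snd p) - f x\<bar> \<le> L * norm (fst p + snd p)"
        using lipschitz_abs_le[OF f, of "x + fst p + snd p" x] by (simp add: dist_norm)
      also have "\<dots> \<le> L * (norm (fst p) + norm (snd p))" using L by (intro mult_left_mono norm_triangle_ineq)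
      finally show "norm (case p of (y, z) \<Rightarrow> f (x + y + z)) \<le> norm (norm (f x) + L * norm (fst p) + L * norm (snd p))"
        by (simp add: case_prod_beta algebra_simps)
    qed
  qed (use i1 i2 in auto)
  show "smooth_by \<mu> (smooth_by \<nu> f) x = (\<integral>p. f (x + fst p + snd p) \<partial>(\<mu> \<Otimes>\<^sub>M \<nu>))"
    using integral_fst'[OF i] by (simp add: smooth_by_def case_prod_beta')
qed

text \<open>Fubini's theorem and commutativity of addition. It allows heat time on either side of an
  exchange to be collected into one smoothing.\<close>

lemma smooth_by_commute:
  fixes f :: "'a::{real_normed_vector, second_countable_topology} \<Rightarrow> real"
  assumes \<mu>: "finite_mean_law \<mu>" and \<nu>: "finite_mean_law \<nu>" and f: "L-lipschitz_on UNIV f"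
  shows "smooth_by \<mu> (smooth_by \<nu> f) = smooth_by \<nu> (smooth_by \<mu> f)"
proof
  interpret m: prob_space \<mu> using \<mu> by (simp add: finite_mean_law_def)
  interpret n: prob_space \<nu> using \<nu> by (simp add: finite_mean_law_def)
  interpret pair_prob_space \<mu> \<nu> ..
  fix x
  show "smooth_by \<mu> (smooth_by \<nu> f) x = smooth_by \<nu> (smooth_by \<mu> f) x"
    using Fubini_integral[OF smooth_by_pair(1)[OF assms, of x]] unfolding smooth_by_def by (simp add: add_ac)
qed

section \<open>The heat semigroup\<close>

definition heat_law :: "real \<Rightarrow> (real ^ 'd) measure" where
  "heat_law t = distr std_gaussian borel (\<lambda>y. sqrt t *\<^sub>R y)"

lemma heat_law_finite_mean: "finite_mean_law (heat_law t :: (real^'d) measure)"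
proof -
  interpret prob_space "std_gaussian :: (real^'d) measure" by (rule prob_space_std_gaussian)
  show ?thesis
    by (auto simp: finite_mean_law_def heat_law_def integrable_distr_eq intro!: prob_space_distr)
qed

lemma smooth_by_heat:
  assumes "f \<in> borel_measurable borel"
  shows "smooth_by (heat_law t) f x = (\<integral>y. f (x + sqrt t *\<^sub>R y) \<partial>(std_gaussian :: (real^'d) measure))"
  using assms by (simp add: smooth_by_def heat_law_def integral_distr)

lemma heat_law_add:
  assumes "s \<ge> 0" "t \<ge> 0"
  shows "distr (heat_law s \<Otimes>\<^sub>M heat_law t) borel (\<lambda>p. fst p + snd p) = (heat_law (s + t) :: (real^'d) measure)"
proof -
  let ?G = "std_gaussian :: (real^'d) measure"
  interpret G: prob_space ?G by (rule prob_space_std_gaussian)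
  interpret s: prob_space "heat_law s :: (real^'d) measure" using heat_law_finite_mean by (auto simp: finite_mean_law_def)
  interpret t: prob_space "heat_law t :: (real^'d) measure" using heat_law_finite_mean by (auto simp: finite_mean_law_def)
  have [measurable_cong]: "sets (heat_law t) = sets (borel :: (real^'d) measure)" for t
    using heat_law_finite_mean by (auto simp: finite_mean_law_def)
  have key: "(\<integral>\<^sup>+y. \<integral>\<^sup>+x. f (sqrt s *\<^sub>R y + sqrt t *\<^sub>R x) \<partial>?G \<partial>?G) = (\<integral>\<^sup>+z. f (sqrt (s + t) *\<^sub>R z) \<partial>?G)"
    if [measurable]: "f \<in> borel_measurable borel" for f :: "real^'d \<Rightarrow> ennreal"
  \<comment> \<open>\<open>nn_integral_gauss_add\<close> divides by its first scale, which is
    \<open>sqrt t\<close> here, so time zero is treated by hand.\<close>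
  proof (cases "t = 0")
    case True
    then show ?thesis by (simp add: G.emeasure_space_1[simplified])
  next
    case False
    then show ?thesis using assms nn_integral_gauss_add[of f "sqrt t" "sqrt s" "sqrt (t + s)"] by (simp add: add.commute)
  qed
  show ?thesis
  proof (rule measure_eqI)
    fix A assume "A \<in> sets (distr (heat_law s \<Otimes>\<^sub>M heat_law t) borel (\<lambda>p. fst p + snd p :: real^'d))"
    then have [measurable]: "A \<in> sets borel" by simp
    have "emeasure (distr (heat_law s \<Otimes>\<^sub>M heat_law t) borel (\<lambda>p. fst p + snd p :: real^'d)) A
        = (\<integral>\<^sup>+p. indicator A (fst p + snd p) \<partial>(heat_law s \<Otimes>\<^sub>M heat_law t))"
      by (rule emeasure_distr_eq_nn_integral) simp_all
    also have "\<dots> = (\<integral>\<^sup>+y. \<integral>\<^sup>+x. indicator A (y + x) \<partial>heat_law t \<partial>heat_law s)"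
      by (subst t.nn_integral_fst[symmetric]) simp_all
    also have "\<dots> = (\<integral>\<^sup>+y. \<integral>\<^sup>+x. indicator A (sqrt s *\<^sub>R y + sqrt t *\<^sub>R x) \<partial>?G \<partial>?G)"
      unfolding heat_law_def by (subst nn_integral_distr; (subst nn_integral_distr)?) simp_all
    also have "\<dots> = (\<integral>\<^sup>+z. indicator A (sqrt (s + t) *\<^sub>R z) \<partial>?G)" by (rule key) simp
    also have "\<dots> = emeasure (heat_law (s + t)) A"
      unfolding heat_law_def by (rule emeasure_distr_eq_nn_integral[symmetric]) simp_all
    finally show "emeasure (distr (heat_law s \<Otimes>\<^sub>M heat_law t) borel (\<lambda>p. fst p + snd p)) A = emeasure (heat_law (s + t)) A" .
  qed (simp add: heat_law_def)
qed

lemma smooth_by_heat_add: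
  fixes f :: "real^'d \<Rightarrow> real"
  assumes "s \<ge> 0" "t \<ge> 0" and f: "L-lipschitz_on UNIV f"
  shows "smooth_by (heat_law s) (smooth_by (heat_law t) f) = smooth_by (heat_law (s + t)) f"
proof
  fix x
  have [measurable]: "f \<in> borel_measurable borel" by (rule lipschitz_borel_measurable[OF f])
  have [measurable_cong]: "sets (heat_law t) = sets (borel :: (real^'d) measure)" for t
    using heat_law_finite_mean by (auto simp: finite_mean_law_def)
  have "smooth_by (heat_law (s + t)) f x = (\<integral>y. f (x + y) \<partial>distr (heat_law s \<Otimes>\<^sub>M heat_law t) borel (\<lambda>p. fst p + snd p))"
    unfolding smooth_by_def heat_law_add[OF assms(1,2)] ..
  also have "\<dots> = (\<integral>p. f (x + fst p + snd p) \<partial>(heat_law s \<Otimes>\<^sub>M heat_law t))"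
    by (subst integral_distr) (simp_all add: add.assoc)
  finally show "smooth_by (heat_law s) (smooth_by (heat_law t) f) x = smooth_by (heat_law (s + t)) f x"
    using smooth_by_pair(2)[OF heat_law_finite_mean heat_law_finite_mean f] by simp
qed

lemma smooth_by_heat_close:
  fixes f :: "real^'d \<Rightarrow> real"
  assumes "t \<ge> 0" and f: "L-lipschitz_on UNIV f"
  shows "\<bar>smooth_by (heat_law t) f x - f x\<bar> \<le> L * sqrt t * (\<integral>y. norm y \<partial>(std_gaussian :: (real^'d) measure))"
proof -
  let ?G = "std_gaussian :: (real^'d) measure"
  interpret G: prob_space ?G by (rule prob_space_std_gaussian)
  have [measurable]: "f \<in> borel_measurable borel" by (rule lipschitz_borel_measurable[OF f])
  have i: "integrable ?G (\<lambda>y. f (x + sqrt t *\<^sub>R y))"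
    using smooth_by_integrable[OF heat_law_finite_mean f, of t x] unfolding heat_law_def by (subst (asm) integrable_distr_eq) simp_all
  have "smooth_by (heat_law t) f x - f x = (\<integral>y. f (x + sqrt t *\<^sub>R y) - f x \<partial>?G)"
    using i by (simp add: smooth_by_heat)
  also have "\<bar>\<dots>\<bar> \<le> (\<integral>y. \<bar>f (x + sqrt t *\<^sub>R y) - f x\<bar> \<partial>?G)" by (rule integral_abs_bound)
  also have "\<dots> \<le> (\<integral>y. L * sqrt t * norm y \<partial>?G)"
  proof (intro integral_mono integrable_abs Bochner_Integration.integrable_diff i integrable_mult_right integrable_gauss_norm)
    show "\<bar>f (x + sqrt t *\<^sub>R y) - f x\<bar> \<le> L * sqrt t * norm y" for y
      using lipschitz_abs_le[OF f, of "x + sqrt t *\<^sub>R y" x] assms(1) by (simp add: dist_norm mult.assoc)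
  qed simp
  finally show ?thesis by simp
qed

section \<open>Exchanging one summand\<close>

lemma power_le_one_plus:
  fixes x :: real
  assumes "0 \<le> x" "j \<le> k"
  shows "x ^ j \<le> 1 + x ^ k"
proof (cases "x \<le> 1")
  case True
  then have "x ^ j \<le> 1" using assms by (simp add: power_le_one)
  then show ?thesis using assms by (simp add: add_increasing2)
next
  case False
  then have "x ^ j \<le> x ^ k" using assms by (intro power_increasing) auto
  then show ?thesis by simp
qed

definition isotropic_law :: "(real ^ 'd) measure \<Rightarrow> bool" where
  "isotropic_law \<mu> \<longleftrightarrow> prob_space \<mu> \<and> sets \<mu> = sets borel \<and> integrable \<mu> (\<lambda>v. norm v ^ 3) \<and>
     (\<forall>i. (\<integral>v. v $ i \<partial>\<mu>) = 0) \<and> (\<forall>i j. (\<integral>v. v $ i * v $ j \<partial>\<mu>) = (if i = j then 1 else 0))"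

lemma isotropic_std_gaussian: "isotropic_law std_gaussian"
  by (simp add: isotropic_law_def prob_space_std_gaussian std_gaussian_moments integrable_gauss_power)

lemma isotropic_integrable:
  assumes "isotropic_law \<mu>"
  shows "integrable \<mu> norm" "integrable \<mu> (\<lambda>v. v $ i)" "integrable \<mu> (\<lambda>v. v $ i * v $ j)" "finite_mean_law \<mu>"
proof -
  interpret prob_space \<mu> using assms by (simp add: isotropic_law_def)
  have [measurable_cong]: "sets \<mu> = sets borel" and i3: "integrable \<mu> (\<lambda>v. norm v ^ 3)" using assms by (auto simp: isotropic_law_def)
  have i: "integrable \<mu> (\<lambda>v. 1 + norm v ^ 3)" using i3 by simp
  show 1: "integrable \<mu> norm"
    by (rule Bochner_Integration.integrable_bound[OF i]) (use power_le_one_plus[of _ 1 3] in auto)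
  show "integrable \<mu> (\<lambda>v. v $ i)"
    by (rule Bochner_Integration.integrable_bound[OF 1]) (auto simp: component_le_norm_cart)
  show "integrable \<mu> (\<lambda>v. v $ i * v $ j)"
  proof (rule Bochner_Integration.integrable_bound[OF i])
    show "AE v in \<mu>. norm (v $ i * v $ j) \<le> norm (1 + norm v ^ 3)"
    proof (rule AE_I2)
      fix v
      have "\<bar>v $ i\<bar> * \<bar>v $ j\<bar> \<le> norm v * norm v" by (intro mult_mono component_le_norm_cart) auto
      also have "\<dots> \<le> 1 + norm v ^ 3" using power_le_one_plus[of "norm v" 2 3] by (simp add: power2_eq_square)
      finally show "norm (v $ i * v $ j) \<le> norm (1 + norm v ^ 3)" by (simp add: abs_mult)
    qed
  qed simp
  show "finite_mean_law \<mu>" using 1 assms by (simp add: finite_mean_law_def isotropic_law_def)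
qed

text \<open>Only the centred, isotropic second-order expansion survives integration over \<open>\<mu>\<close>, and its
  value does not depend on \<open>\<mu>\<close>.\<close>

lemma isotropic_tilt2_integral:
  fixes \<mu> :: "(real^'d) measure" and g :: "real^'d \<Rightarrow> real"
  assumes \<mu>: "isotropic_law \<mu>" and g[measurable]: "g \<in> borel_measurable borel"
    and gb: "\<And>y. \<bar>g y\<bar> \<le> K * norm y"
  shows "(\<integral>v. (\<integral>y. g y * tilt2 y (c *\<^sub>R v) \<partial>std_gaussian) \<partial>\<mu>)
    = (\<integral>y. g y \<partial>std_gaussian) + c\<^sup>2 / 2 * ((\<Sum>i\<in>UNIV. \<integral>y. g y * (y $ i * y $ i) \<partial>std_gaussian) - CARD('d) * (\<integral>y. g y \<partial>std_gaussian))"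
    "integrable \<mu> (\<lambda>v. \<integral>y. g y * tilt2 y (c *\<^sub>R v) \<partial>std_gaussian)"
proof -
  let ?G = "std_gaussian :: (real^'d) measure"
  interpret prob_space \<mu> using \<mu> by (simp add: isotropic_law_def)
  note iso = isotropic_integrable[OF \<mu>]
  \<comment> \<open>Any unit vector in \<open>gb\<close> shows that \<open>K\<close> is
    nonnegative.\<close>
  have K: "K \<ge> 0" using gb[of "axis undefined 1"] by (simp add: norm_axis_1 abs_le_iff)
  have i0: "integrable ?G g"
    by (rule integrable_gauss_dominated[of _ K 1 0]) (use gb in auto)
  have i1: "integrable ?G (\<lambda>y. g y * y $ i)" for i
  proof (rule integrable_gauss_dominated[of _ K 2 0])
    fix y
    have "\<bar>g y\<bar> * \<bar>y $ i\<bar> \<le> (K * norm y) * norm y" using gb K by (intro mult_mono component_le_norm_cart) auto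
    then show "\<bar>g y * y $ i\<bar> \<le> K * (norm y ^ 2 * exp (0 * norm y))" by (simp add: abs_mult power2_eq_square mult_ac)
  qed measurable
  have i2: "integrable ?G (\<lambda>y. g y * (y $ i * y $ j))" for i j
  proof (rule integrable_gauss_dominated[of _ K 3 0])
    fix y
    have "\<bar>g y\<bar> * (\<bar>y $ i\<bar> * \<bar>y $ j\<bar>) \<le> (K * norm y) * (norm y * norm y)"
      using gb K by (intro mult_mono component_le_norm_cart) auto
    then show "\<bar>g y * (y $ i * y $ j)\<bar> \<le> K * (norm y ^ 3 * exp (0 * norm y))" by (simp add: abs_mult power3_eq_cube mult_ac)
  qed measurable
  define c0 where "c0 = (\<integral>y. g y \<partial>?G)"
  define l where "l i = (\<integral>y. g y * y $ i \<partial>?G)" for i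
  define H where "H i j = (\<integral>y. g y * (y $ i * y $ j) \<partial>?G)" for i j
  have inner: "(\<integral>y. g y * tilt2 y (c *\<^sub>R v) \<partial>?G)
    = c0 + c * (\<Sum>i\<in>UNIV. v $ i * l i) + c\<^sup>2 / 2 * ((\<Sum>i\<in>UNIV. \<Sum>j\<in>UNIV. v $ i * v $ j * H i j) - (\<Sum>i\<in>UNIV. v $ i * v $ i) * c0)" for v
  proof -
    have "g y * tilt2 y (c *\<^sub>R v) = g y + c * (\<Sum>i\<in>UNIV. v $ i * (g y * y $ i))
       + c\<^sup>2 / 2 * ((\<Sum>i\<in>UNIV. \<Sum>j\<in>UNIV. v $ i * v $ j * (g y * (y $ i * y $ j))) - (\<Sum>i\<in>UNIV. v $ i * v $ i) * g y)" for y
    proof -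
      have 1: "(\<Sum>i\<in>UNIV. v $ i * (g y * y $ i)) = g y * (y \<bullet> v)"
        by (simp add: inner_vec_def sum_distrib_left mult_ac)
      have 2: "(\<Sum>i\<in>UNIV. \<Sum>j\<in>UNIV. v $ i * v $ j * (g y * (y $ i * y $ j))) = g y * (y \<bullet> v)\<^sup>2"
        by (simp add: inner_vec_def power2_eq_square sum_product sum_distrib_left mult_ac)
      have 3: "(\<Sum>i\<in>UNIV. v $ i * v $ i) = v \<bullet> v" by (simp add: inner_vec_def)
      show ?thesis unfolding 1 2 3 by (simp add: tilt2_def power2_eq_square algebra_simps add_divide_distrib diff_divide_distrib)
    qed
    then show ?thesis by (simp add: i0 i1 i2 c0_def l_def H_def)
  qed
  have m1: "expectation (\<lambda>v. v $ i) = 0" and m2: "expectation (\<lambda>v. v $ i * v $ j) = (if i = j then 1 else 0)" for i j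
    using \<mu> by (auto simp: isotropic_law_def)
  show "integrable \<mu> (\<lambda>v. \<integral>y. g y * tilt2 y (c *\<^sub>R v) \<partial>?G)"
    unfolding inner by (intro Bochner_Integration.integrable_add Bochner_Integration.integrable_diff integrable_mult_right
        integrable_mult_left Bochner_Integration.integrable_sum iso integrable_const)
  have "(\<integral>v. (\<integral>y. g y * tilt2 y (c *\<^sub>R v) \<partial>?G) \<partial>\<mu>) = c0 + c\<^sup>2 / 2 * ((\<Sum>i\<in>UNIV. \<Sum>j\<in>UNIV. (if i = j then 1 else 0) * H i j) - CARD('d) * c0)"
    unfolding inner by (simp add: iso m1 m2 prob_space)
  also have "(\<Sum>i\<in>UNIV. \<Sum>j\<in>UNIV. (if i = j then 1 else 0) * H i j) = (\<Sum>i\<in>UNIV. H i i)"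
    by (simp add: if_distrib[of "\<lambda>t. t * _"] cong: if_cong)
  finally show "(\<integral>v. (\<integral>y. g y * tilt2 y (c *\<^sub>R v) \<partial>std_gaussian) \<partial>\<mu>)
    = (\<integral>y. g y \<partial>std_gaussian) + c\<^sup>2 / 2 * ((\<Sum>i\<in>UNIV. \<integral>y. g y * (y $ i * y $ i) \<partial>std_gaussian) - CARD('d) * (\<integral>y. g y \<partial>std_gaussian))"
    by (simp add: c0_def H_def)
qed

text \<open>The expansion is carried out in the Gaussian density, so that \<open>f\<close> need not be differentiable;
  its Lipschitz constant enters through \<open>\<bar>g y\<bar> \<le> L sqrt t \<bar>y\<bar>\<close> only.\<close>

lemma smooth_by_heat_third_order:
  fixes \<mu> :: "(real^'d) measure" and f :: "real^'d \<Rightarrow> real" and x :: "real^'d"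
  assumes \<mu>: "isotropic_law \<mu>" and f: "L-lipschitz_on UNIV f" and t: "t > 0"
    and Ci: "\<And>w. integrable std_gaussian (\<lambda>y::real^'d. norm y * \<bar>tilt y w - tilt2 y w\<bar>)"
    and C: "\<And>w. (\<integral>y. norm y * \<bar>tilt y w - tilt2 y w\<bar> \<partial>(std_gaussian :: (real^'d) measure)) \<le> C * norm w ^ 3"
  defines "g \<equiv> \<lambda>y. f (x + sqrt t *\<^sub>R y) - f x"
  shows "\<bar>smooth_by \<mu> (smooth_by (heat_law t) f) x
    - (f x + (\<integral>y. g y \<partial>std_gaussian) + (1 / sqrt t)\<^sup>2 / 2 * ((\<Sum>i\<in>UNIV. \<integral>y. g y * (y $ i * y $ i) \<partial>std_gaussian) - CARD('d) * (\<integral>y. g y \<partial>std_gaussian)))\<bar>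
    \<le> L * C * (\<integral>v. norm v ^ 3 \<partial>\<mu>) / t"
proof -
  let ?G = "std_gaussian :: (real^'d) measure"
  interpret prob_space \<mu> using \<mu> by (simp add: isotropic_law_def)
  interpret G: prob_space ?G by (rule prob_space_std_gaussian)
  note iso = isotropic_integrable[OF \<mu>]
  have [measurable_cong]: "sets \<mu> = sets borel" and i3: "integrable \<mu> (\<lambda>v. norm v ^ 3)" using \<mu> by (auto simp: isotropic_law_def)
  have fm[measurable]: "f \<in> borel_measurable borel" by (rule lipschitz_borel_measurable[OF f])
  have L: "L \<ge> 0" by (rule lipschitz_on_nonneg[OF f])
  have gm[measurable]: "g \<in> borel_measurable borel" unfolding g_def by measurable
  have gb: "\<bar>g y\<bar> \<le> L * sqrt t * norm y" for y
    using lipschitz_abs_le[OF f, of "x + sqrt t *\<^sub>R y" x] t by (simp add: g_def dist_norm mult.assoc)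
  \<comment> \<open>Moving \<open>x\<close> by \<open>v\<close> is moving the Gaussian variable by
    \<open>c *\<^sub>R v\<close>. The factor \<open>sqrt t\<close> of the Lipschitz bound and the
    factor \<open>c ^ 3\<close> of the remainder combine to \<open>1 / t\<close>.\<close>
  define c where "c = 1 / sqrt t"
  have c: "c > 0" using t by (simp add: c_def)
  have it2: "integrable ?G (\<lambda>y. g y * tilt2 y w)" for w
    by (rule Bochner_Integration.integrable_bound[OF integrable_mult_right[OF integrable_gauss_norm_tilt2[of w], of "L * sqrt t"]])
      (use gb L t in \<open>auto simp: abs_mult mult.assoc[symmetric] intro!: mult_right_mono\<close>)
  have it: "integrable ?G (\<lambda>y. g y * tilt y w)" for w
    by (rule Bochner_Integration.integrable_bound[OF integrable_mult_right[OF integrable_gauss_norm_tilt(1)[of w], of "L * sqrt t"]])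
      (use gb L t in \<open>auto simp: abs_mult mult.assoc[symmetric] tilt_def intro!: mult_right_mono\<close>)
  define R where "R v = (\<integral>y. g y * (tilt y (c *\<^sub>R v) - tilt2 y (c *\<^sub>R v)) \<partial>?G)" for v
  define T where "T v = (\<integral>y. g y * tilt2 y (c *\<^sub>R v) \<partial>?G)" for v
  have split: "smooth_by (heat_law t) f (x + v) - f x = T v + R v" for v
  proof -
    have ish: "integrable ?G (\<lambda>y. f (x + v + sqrt t *\<^sub>R y))"
      using smooth_by_integrable[OF heat_law_finite_mean f, of t "x + v"] unfolding heat_law_def by (subst (asm) integrable_distr_eq) simp_all
    have "smooth_by (heat_law t) f (x + v) - f x = (\<integral>y. f (x + v + sqrt t *\<^sub>R y) - f x \<partial>?G)"
      using ish by (simp add: smooth_by_heat)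
    also have "\<dots> = (\<integral>y. g (y + c *\<^sub>R v) \<partial>?G)"
      using t by (simp add: g_def c_def scaleR_add_right add_ac)
    also have "\<dots> = (\<integral>y. g y * tilt y (c *\<^sub>R v) \<partial>?G)" by (rule integral_gauss_shift) measurable
    also have "\<dots> = T v + R v" using it it2 by (simp add: T_def R_def right_diff_distrib)
    finally show ?thesis .
  qed
  have Rb: "\<bar>R v\<bar> \<le> L * C / t * norm v ^ 3" for v
  proof -
    have "\<bar>R v\<bar> \<le> (\<integral>y. \<bar>g y * (tilt y (c *\<^sub>R v) - tilt2 y (c *\<^sub>R v))\<bar> \<partial>?G)" unfolding R_def by (rule integral_abs_bound)
    also have "\<dots> \<le> (\<integral>y. L * sqrt t * (norm y * \<bar>tilt y (c *\<^sub>R v) - tilt2 y (c *\<^sub>R v)\<bar>) \<partial>?G)"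
    proof (intro integral_mono integrable_mult_right Ci integrable_abs)
      show "integrable ?G (\<lambda>y. g y * (tilt y (c *\<^sub>R v) - tilt2 y (c *\<^sub>R v)))" unfolding right_diff_distrib using it it2 by simp
      show "\<bar>g y * (tilt y (c *\<^sub>R v) - tilt2 y (c *\<^sub>R v))\<bar> \<le> L * sqrt t * (norm y * \<bar>tilt y (c *\<^sub>R v) - tilt2 y (c *\<^sub>R v)\<bar>)" for y
        using gb[of y] by (auto simp: abs_mult mult.assoc[symmetric] intro!: mult_right_mono)
    qed
    also have "\<dots> = L * sqrt t * (\<integral>y. norm y * \<bar>tilt y (c *\<^sub>R v) - tilt2 y (c *\<^sub>R v)\<bar> \<partial>?G)" by simp
    also have "\<dots> \<le> L * sqrt t * (C * norm (c *\<^sub>R v) ^ 3)" using L t by (intro mult_left_mono C) auto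
    also have "\<dots> = L * C / t * norm v ^ 3"
    proof -
      have "sqrt t * c ^ 3 = 1 / t" using t by (simp add: c_def power3_eq_cube field_simps)
      then have "L * C * norm v ^ 3 * (sqrt t * c ^ 3) = L * C * norm v ^ 3 * (1 / t)" by simp
      then show ?thesis using c by (simp add: power_mult_distrib mult_ac)
    qed
    finally show ?thesis .
  qed
  have Ti: "integrable \<mu> T" and Tv: "(\<integral>v. T v \<partial>\<mu>) = (\<integral>y. g y \<partial>?G) + c\<^sup>2 / 2 * ((\<Sum>i\<in>UNIV. \<integral>y. g y * (y $ i * y $ i) \<partial>?G) - CARD('d) * (\<integral>y. g y \<partial>?G))"
    unfolding T_def using isotropic_tilt2_integral[OF \<mu> gm gb, of c] by blast+
  have si: "integrable \<mu> (\<lambda>v. smooth_by (heat_law t) f (x + v))"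
    by (rule smooth_by_integrable[OF iso(4) smooth_by_lipschitz[OF heat_law_finite_mean f]])
  have Req: "R = (\<lambda>v. smooth_by (heat_law t) f (x + v) - f x - T v)" using split by (simp add: fun_eq_iff algebra_simps)
  have Ri: "integrable \<mu> R" unfolding Req using si Ti by simp
  have "smooth_by \<mu> (smooth_by (heat_law t) f) x - f x - (\<integral>v. T v \<partial>\<mu>) = (\<integral>v. R v \<partial>\<mu>)"
    unfolding smooth_by_def[of \<mu>] Req using si Ti by (simp add: prob_space)
  moreover have "\<bar>\<integral>v. R v \<partial>\<mu>\<bar> \<le> (\<integral>v. L * C / t * norm v ^ 3 \<partial>\<mu>)"
    by (rule order.trans[OF integral_abs_bound]) (intro integral_mono integrable_abs Ri integrable_mult_right i3 Rb)
  ultimately show ?thesis unfolding Tv c_def by (simp add: algebra_simps)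
qed

lemma heat_law_1: "heat_law 1 = (std_gaussian :: (real^'d) measure)"
proof -
  have "(\<lambda>y. sqrt 1 *\<^sub>R y) = (\<lambda>y :: real^'d. y)" by simp
  then show ?thesis unfolding heat_law_def by (simp only: distr_id2[OF sets_std_gaussian[symmetric]])
qed

text \<open>The function \<open>\<phi>\<^sub>k\<close> of the overview: the effect of one exchange
  when everything else has been smoothed for time \<open>t\<close>.\<close>

abbreviation swap_one :: "(real^'d) measure \<Rightarrow> real \<Rightarrow> (real^'d \<Rightarrow> real) \<Rightarrow> real^'d \<Rightarrow> real" where
  "swap_one \<mu> t f x \<equiv> smooth_by \<mu> (smooth_by (heat_law t) f) x - smooth_by (heat_law 1) (smooth_by (heat_law t) f) x"

text \<open>A crude bound without decay in \<open>t\<close>, from which only measurability is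
  drawn.\<close>

lemma swap_one_lipschitz0:
  assumes \<mu>: "isotropic_law \<mu>" and f: "L-lipschitz_on UNIV f"
  shows "(L + L)-lipschitz_on UNIV (swap_one \<mu> t f)"
  by (intro lipschitz_diff smooth_by_lipschitz isotropic_integrable[OF \<mu>] heat_law_finite_mean f)

text \<open>The second-order expansions under \<open>\<mu>\<close> and under the standard Gaussian
  law agree, so only the two remainders are left. \<open>C\<close> is a Gaussian constant times the
  sum of the two third absolute moments.\<close>

lemma swap_one_bound:
  fixes \<mu> :: "(real^'d) measure"
  assumes \<mu>: "isotropic_law \<mu>"
  obtains C where "C \<ge> 0" "\<And>f L t x. L-lipschitz_on UNIV f \<Longrightarrow> t > 0 \<Longrightarrow> \<bar>swap_one \<mu> t f x\<bar> \<le> L * C / t"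
proof -
  obtain C where C: "C \<ge> 0" "\<And>w. integrable std_gaussian (\<lambda>y::real^'d. norm y * \<bar>tilt y w - tilt2 y w\<bar>)"
    "\<And>w. (\<integral>y. norm y * \<bar>tilt y w - tilt2 y w\<bar> \<partial>(std_gaussian :: (real^'d) measure)) \<le> C * norm w ^ 3"
    using gauss_tilt_remainder by blast
  define b where "b = C * (\<integral>v. norm v ^ 3 \<partial>\<mu>) + C * (\<integral>v. norm v ^ 3 \<partial>(std_gaussian :: (real^'d) measure))"
  have "\<bar>swap_one \<mu> t f x\<bar> \<le> L * b / t" if f: "L-lipschitz_on UNIV f" and t: "t > 0" for f L t x
  proof -
    have "\<bar>a - b\<bar> \<le> p + q" if "\<bar>a - v\<bar> \<le> p" "\<bar>b - v\<bar> \<le> q" for a b v p q :: real using that by arith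
    from this[OF smooth_by_heat_third_order[OF \<mu> f t C(2,3), of x] smooth_by_heat_third_order[OF isotropic_std_gaussian f t C(2,3), of x]]
    show ?thesis unfolding heat_law_1 b_def by (simp add: algebra_simps add_divide_distrib)
  qed
  moreover have "b \<ge> 0" using C(1) by (simp add: b_def)
  ultimately show ?thesis using that by blast
qed

text \<open>The gradient estimate of the heat semigroup. A displacement of the argument by
  \<open>sqrt t *\<^sub>R w\<close> is absorbed into \<open>tilt y w\<close>, whose distance to
  \<open>1\<close> in mean is linear in \<open>norm w\<close>.\<close>

lemma smooth_by_heat_bounded_lipschitz:
  obtains C where "C \<ge> 0"
    "\<And>(f :: real^'d \<Rightarrow> real) B t. f \<in> borel_measurable borel \<Longrightarrow> (\<And>x. \<bar>f x\<bar> \<le> B) \<Longrightarrow> t > 0 \<Longrightarrow>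
      (B * C / sqrt t)-lipschitz_on UNIV (smooth_by (heat_law t) f)"
proof -
  let ?G = "std_gaussian :: (real^'d) measure"
  interpret G: prob_space ?G by (rule prob_space_std_gaussian)
  obtain C where C: "C \<ge> 0" "\<And>w. (\<integral>y. \<bar>tilt y w - 1\<bar> \<partial>?G) \<le> C * norm w" using gauss_tilt_L1 by blast
  have "(B * C / sqrt t)-lipschitz_on UNIV (smooth_by (heat_law t) f)"
    if fm[measurable]: "f \<in> borel_measurable borel" and fb: "\<And>x. \<bar>f x\<bar> \<le> B" and t: "t > 0" for f :: "real^'d \<Rightarrow> real" and B t
  proof (rule lipschitz_onI_abs)
    have B: "B \<ge> 0" using fb[of 0] by simp
    show "B * C / sqrt t \<ge> 0" using B C t by simp
    fix x' x :: "real^'d"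
    define w where "w = (1 / sqrt t) *\<^sub>R (x' - x)"
    have ib: "integrable ?G (\<lambda>y. f (z + sqrt t *\<^sub>R y))" for z
      by (rule G.integrable_const_bound[of _ B]) (use fb in auto)
    have ift: "integrable ?G (\<lambda>y. f (x + sqrt t *\<^sub>R y) * tilt y w)"
      by (rule Bochner_Integration.integrable_bound[OF integrable_mult_right[OF integrable_gauss_tilt(1)[of w], of B]])
        (use fb B in \<open>auto simp: abs_mult tilt_def intro!: mult_right_mono\<close>)
    have "smooth_by (heat_law t) f x' = (\<integral>y. f (x' + sqrt t *\<^sub>R y) \<partial>?G)" by (simp add: smooth_by_heat)
    also have "\<dots> = (\<integral>y. f (x + sqrt t *\<^sub>R (y + w)) \<partial>?G)" using t by (simp add: w_def scaleR_add_right algebra_simps)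
    also have "\<dots> = (\<integral>y. f (x + sqrt t *\<^sub>R y) * tilt y w \<partial>?G)"
      using integral_gauss_shift(1)[of "\<lambda>y. f (x + sqrt t *\<^sub>R y)" w] by simp
    finally have "smooth_by (heat_law t) f x' - smooth_by (heat_law t) f x = (\<integral>y. f (x + sqrt t *\<^sub>R y) * (tilt y w - 1) \<partial>?G)"
      using ift ib by (simp add: smooth_by_heat right_diff_distrib)
    also have "\<dots> \<le> (\<integral>y. B * \<bar>tilt y w - 1\<bar> \<partial>?G)"
    proof (intro integral_mono integrable_mult_right integrable_abs Bochner_Integration.integrable_diff integrable_gauss_tilt)
      show "integrable ?G (\<lambda>y. f (x + sqrt t *\<^sub>R y) * (tilt y w - 1))" unfolding right_diff_distrib using ift ib by simp
      show "f (x + sqrt t *\<^sub>R y) * (tilt y w - 1) \<le> B * \<bar>tilt y w - 1\<bar>" for y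
      proof -
        have "f (x + sqrt t *\<^sub>R y) * (tilt y w - 1) \<le> \<bar>f (x + sqrt t *\<^sub>R y)\<bar> * \<bar>tilt y w - 1\<bar>" by (metis abs_ge_self abs_mult)
        also have "\<dots> \<le> B * \<bar>tilt y w - 1\<bar>" using fb by (intro mult_right_mono) auto
        finally show ?thesis .
      qed
    qed simp
    also have "\<dots> = B * (\<integral>y. \<bar>tilt y w - 1\<bar> \<partial>?G)" by simp
    also have "\<dots> \<le> B * (C * norm w)" using B by (intro mult_left_mono C) auto
    also have "\<dots> = B * C / sqrt t * dist x' x" using t by (simp add: w_def dist_norm)
    finally show "smooth_by (heat_law t) f x' - smooth_by (heat_law t) f x \<le> B * C / sqrt t * dist x' x" .
  qed
  then show ?thesis using that C(1) by blast
qed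

text \<open>One half of the heat flow makes the difference bounded, the other half turns the bound into a
  Lipschitz constant.\<close>

lemma swap_one_lipschitz:
  fixes \<mu> :: "(real^'d) measure"
  assumes \<mu>: "isotropic_law \<mu>"
  obtains C where "C \<ge> 0" "\<And>f L t. L-lipschitz_on UNIV f \<Longrightarrow> t > 0 \<Longrightarrow> (L * C / (t * sqrt t))-lipschitz_on UNIV (swap_one \<mu> t f)"
proof -
  obtain C1 where C1: "C1 \<ge> 0" "\<And>f L t x. L-lipschitz_on UNIV f \<Longrightarrow> t > 0 \<Longrightarrow> \<bar>swap_one \<mu> t f x\<bar> \<le> L * C1 / t"
    using swap_one_bound[OF \<mu>] by blast
  obtain C2 where C2: "C2 \<ge> 0" "\<And>(f :: real^'d \<Rightarrow> real) B t. f \<in> borel_measurable borel \<Longrightarrow> (\<And>x. \<bar>f x\<bar> \<le> B) \<Longrightarrow> t > 0 \<Longrightarrow>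
      (B * C2 / sqrt t)-lipschitz_on UNIV (smooth_by (heat_law t) f)"
    using smooth_by_heat_bounded_lipschitz by blast
  note fm = isotropic_integrable(4)[OF \<mu>] heat_law_finite_mean
  \<comment> \<open>The factor \<open>2 * sqrt 2\<close> arises because both bounds are used at time
    \<open>t / 2\<close>, and their product scales with the power \<open>-3/2\<close>.\<close>
  have "(L * (2 * sqrt 2 * C1 * C2) / (t * sqrt t))-lipschitz_on UNIV (swap_one \<mu> t f)"
    if f: "L-lipschitz_on UNIV f" and t: "t > 0" for f L t
  proof -
    define s where "s = t / 2"
    have s: "s > 0" "s + s = t" using t by (simp_all add: s_def)
    let ?H = "smooth_by (heat_law s :: (real^'d) measure)"
    have lf: "L-lipschitz_on UNIV (?H f)" by (rule smooth_by_lipschitz[OF fm(2) f])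
    have tt: "smooth_by (heat_law t) f = ?H (?H f)" using smooth_by_heat_add[OF _ _ f, of s s] s by simp
    \<comment> \<open>The heat operator commutes with both sides of the exchange, so half of the
      smoothing can be pulled out in front.\<close>
    have eq: "swap_one \<mu> t f x = ?H (swap_one \<mu> s f) x" for x
    proof -
      have "?H (swap_one \<mu> s f) x = ?H (smooth_by \<mu> (?H f)) x - ?H (smooth_by (heat_law 1) (?H f)) x"
        by (rule smooth_by_diff[OF fm(2) smooth_by_lipschitz[OF fm(1) lf] smooth_by_lipschitz[OF fm(2) lf]])
      then show ?thesis unfolding tt smooth_by_commute[OF fm(1) fm(2) lf] smooth_by_commute[OF fm(2) fm(2) lf, of 1] by simp
    qed
    have "(L * C1 / s * C2 / sqrt s)-lipschitz_on UNIV (?H (swap_one \<mu> s f))"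
      by (intro C2 C1 f s lipschitz_borel_measurable[OF swap_one_lipschitz0[OF \<mu> f]])
    moreover have "L * C1 / s * C2 / sqrt s = L * (2 * sqrt 2 * C1 * C2) / (t * sqrt t)"
      using t by (simp add: s_def real_sqrt_divide)
    ultimately show ?thesis using eq by (simp add: fun_eq_iff[symmetric])
  qed
  moreover have "2 * sqrt 2 * C1 * C2 \<ge> 0" using C1 C2 by simp
  ultimately show ?thesis using that by blast
qed

section \<open>The bound for sums by induction on their length\<close>

lemma sum_inverse_three_halves:
  fixes e :: real
  assumes e: "e \<ge> 1"
  shows "(\<Sum>j<n. 1 / ((real j + e) * sqrt (real j + e))) \<le> 6 / sqrt e"
proof -
  \<comment> \<open>Telescoping against \<open>6 / sqrt s\<close>. The constant is generous:
    \<open>sqrt (s + 1) \<le> 2 * sqrt s\<close> is used twice and contributes the factors 3 and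
    2.\<close>
  have step: "1 / (s * sqrt s) \<le> 6 / sqrt s - 6 / sqrt (s + 1)" if s: "s \<ge> 1" for s :: real
  proof -
    define a where "a = sqrt s"
    define b where "b = sqrt (s + 1)"
    have a: "a \<ge> 1" "a * a = s" and b: "b * b = s + 1" "b > 0" using s by (auto simp: a_def b_def)
    have ab: "b \<le> 2 * a"
    proof (rule power2_le_imp_le)
      show "b\<^sup>2 \<le> (2 * a)\<^sup>2" using a b s by (simp add: power2_eq_square)
    qed (use a in auto)
    have "(b - a) * (b + a) = 1" using a b by (simp add: algebra_simps)
    moreover have "b + a \<le> 3 * a" using ab by simp
    have "b - a \<ge> 0" using s by (simp add: a_def b_def)
    moreover have "(b - a) * (b + a) \<le> (b - a) * (3 * a)" using \<open>b - a \<ge> 0\<close> \<open>b + a \<le> 3 * a\<close> by (intro mult_left_mono) auto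
    ultimately have 1: "1 \<le> (b - a) * (3 * a)" by simp
    have "b * 1 \<le> b * ((b - a) * (3 * a))" using 1 b by (intro mult_left_mono) auto
    also have "\<dots> \<le> (2 * a) * ((b - a) * (3 * a))" using ab \<open>b - a \<ge> 0\<close> a by (intro mult_right_mono) auto
    finally have "b \<le> 6 * a * a * (b - a)" by (simp add: mult_ac)
    then have "1 / (a * a * a) \<le> 6 * (b - a) / (a * b)" using a(1) b(2) by (simp add: field_simps)
    also have "\<dots> = 6 / a - 6 / b" using a b by (simp add: field_simps)
    finally show ?thesis using a by (simp add: a_def b_def)
  qed
  have "(\<Sum>j<n. 1 / ((real j + e) * sqrt (real j + e))) \<le> (\<Sum>j<n. 6 / sqrt (real j + e) - 6 / sqrt (real (Suc j) + e))"
    using step[of "real _ + e"] e by (intro sum_mono) (simp add: add_ac)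
  also have "\<dots> = 6 / sqrt e - 6 / sqrt (real n + e)"
    by (subst sum_lessThan_telescope') simp
  also have "\<dots> \<le> 6 / sqrt e" using e by simp
  finally show ?thesis .
qed

lemma smooth_by_iterate_lipschitz:
  assumes "finite_mean_law \<mu>" "L-lipschitz_on UNIV f"
  shows "L-lipschitz_on UNIV ((smooth_by \<mu> ^^ n) f)"
  by (induction n) (auto intro: assms smooth_by_lipschitz)

lemma smooth_by_iterate_diff:
  assumes "finite_mean_law \<mu>" "L-lipschitz_on UNIV f" "L'-lipschitz_on UNIV g"
  shows "(smooth_by \<mu> ^^ n) (\<lambda>x. f x - g x) = (\<lambda>x. (smooth_by \<mu> ^^ n) f x - (smooth_by \<mu> ^^ n) g x)"
proof (induction n)
  case (Suc n)
  show ?case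
    unfolding funpow.simps o_def Suc
    by (rule ext) (rule smooth_by_diff[OF assms(1) smooth_by_iterate_lipschitz smooth_by_iterate_lipschitz]; fact)
qed simp

text \<open>In the telescoping sum, \<open>\<mu>\<^sup>*\<^sup>k\<close> is replaced by its Gaussian counterpart at a cost controlled by the
  induction hypothesis; the choice of \<open>e\<close> makes the total of these costs at most half the claimed bound.\<close>

theorem multivariate_berry_esseen_lipschitz:
  fixes \<mu> :: "(real^'d) measure"
  assumes \<mu>: "isotropic_law \<mu>"
  obtains A where "A \<ge> 0"
    "\<And>n f L x. L-lipschitz_on UNIV f \<Longrightarrow> \<bar>(smooth_by \<mu> ^^ n) f x - smooth_by (heat_law (real n)) f x\<bar> \<le> L * A"
proof -
  obtain C1 where C1: "C1 \<ge> 0" "\<And>f L t x. L-lipschitz_on UNIV f \<Longrightarrow> t > 0 \<Longrightarrow> \<bar>swap_one \<mu> t f x\<bar> \<le> L * C1 / t"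
    using swap_one_bound[OF \<mu>] by blast
  obtain C3 where C3: "C3 \<ge> 0" "\<And>f L t. L-lipschitz_on UNIV f \<Longrightarrow> t > 0 \<Longrightarrow> (L * C3 / (t * sqrt t))-lipschitz_on UNIV (swap_one \<mu> t f)"
    using swap_one_lipschitz[OF \<mu>] by blast
  define m where "m = (\<integral>y. norm y \<partial>(std_gaussian :: (real^'d) measure))"
  have m: "m \<ge> 0" by (simp add: m_def)
  \<comment> \<open>The sum of the Lipschitz constants is at most
    \<open>L * C3 * 6 / sqrt e\<close>, and \<open>12 * C3 \<le> sqrt e\<close> brings this down to
    \<open>L / 2\<close>. The maximum with 1 serves \<open>sum_inverse_three_halves\<close> and
    keeps the total heat time at least \<open>n\<close>.\<close>
  define e where "e = max 1 ((12 * C3)\<^sup>2)"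
  have e: "e \<ge> 1" "e > 0" by (simp_all add: e_def)
  have eC: "C3 * 6 / sqrt e \<le> 1 / 2"
  proof -
    have "12 * C3 \<le> sqrt e" using C3 by (intro real_le_rsqrt) (simp add: e_def)
    then show ?thesis using e by (simp add: field_simps)
  qed
  \<comment> \<open>The solution of \<open>A = 2 * sqrt e * m + C1 + A / 2\<close>: two smoothing
    errors, the exchanges seen by Gaussian sums, and the part returned by the induction
    hypothesis.\<close>
  define A where "A = 4 * sqrt e * m + 2 * C1"
  have A: "A \<ge> 0" using m e C1 by (simp add: A_def)
  note fm = isotropic_integrable(4)[OF \<mu>] heat_law_finite_mean
  let ?P = "smooth_by \<mu>"
  let ?Q = "\<lambda>t. smooth_by (heat_law t :: (real^'d) measure)"
  have "\<bar>(?P ^^ n) f x - ?Q (real n) f x\<bar> \<le> L * A" if f: "L-lipschitz_on UNIV f" for n f L x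
    using f
  \<comment> \<open>Strong induction with \<open>f\<close> and \<open>L\<close> free, because the
    hypothesis for \<open>k < n\<close> is applied to \<open>swap_one\<close>, with its own much
    smaller Lipschitz constant.\<close>
  proof (induction n arbitrary: f L x rule: less_induct)
    case (less n)
    note f = \<open>L-lipschitz_on UNIV f\<close>
    have L: "L \<ge> 0" by (rule lipschitz_on_nonneg[OF f])
    have close: "\<bar>?Q e f y - f y\<bar> \<le> L * sqrt e * m" for y
      using smooth_by_heat_close[OF _ f, of e] e by (simp add: m_def)
    have Qlip: "L-lipschitz_on UNIV (?Q t f)" for t by (rule smooth_by_lipschitz[OF fm(2) f])
    \<comment> \<open>Lindeberg's hybrids: \<open>k\<close> increments from \<open>\<mu>\<close>,
      the other \<open>n - k\<close> Gaussian and merged into the heat time, plus the extra time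
      \<open>e\<close>.\<close>
    define F where "F k = (?P ^^ k) (?Q (real (n - k) + e) f) x" for k
    have step: "\<bar>F (Suc k) - F k\<bar> \<le> L * C1 / n + L * C3 * A * (1 / ((real (n - Suc k) + e) * sqrt (real (n - Suc k) + e)))"
      if k: "k < n" for k
    proof -
      define t where "t = real (n - Suc k) + e"
      have t: "t > 0" using e by (simp add: t_def add_nonneg_pos)
      have nk: "real (n - k) + e = 1 + t" using k by (simp add: t_def of_nat_diff)
      have q1: "?Q (1 + t) f = ?Q 1 (?Q t f)" using smooth_by_heat_add[OF _ _ f, of 1 t] t by simp
      have "F (Suc k) - F k = (?P ^^ k) (?P (?Q t f)) x - (?P ^^ k) (?Q 1 (?Q t f)) x"
        unfolding F_def nk q1 t_def[symmetric] by (simp add: funpow_swap1)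
      also have "\<dots> = (?P ^^ k) (swap_one \<mu> t f) x"
        using fun_cong[OF smooth_by_iterate_diff[OF fm(1) smooth_by_lipschitz[OF fm(1) Qlip[of t]] smooth_by_lipschitz[OF fm(2) Qlip[of t]], of k 1], of x] by simp
      finally have eq: "F (Suc k) - F k = (?P ^^ k) (swap_one \<mu> t f) x" .
      have "\<bar>(?P ^^ k) (swap_one \<mu> t f) x - ?Q (real k) (swap_one \<mu> t f) x\<bar> \<le> L * C3 / (t * sqrt t) * A"
        by (rule less.IH[OF k C3(2)[OF f t]])
      \<comment> \<open>The times add up to \<open>k + t = n - 1 + e\<close>, which is at least
        \<open>n\<close>; over all \<open>k\<close> these terms therefore total
        \<open>L * C1\<close>.\<close>
      moreover have "\<bar>?Q (real k) (swap_one \<mu> t f) x\<bar> \<le> L * C1 / n"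
      proof -
        have "?Q (real k) (swap_one \<mu> t f) x = ?Q (real k) (?P (?Q t f)) x - ?Q (real k) (?Q 1 (?Q t f)) x"
          by (rule smooth_by_diff[OF fm(2) smooth_by_lipschitz[OF fm(1) Qlip] smooth_by_lipschitz[OF fm(2) Qlip]])
        also have "\<dots> = swap_one \<mu> (real k + t) f x"
          unfolding smooth_by_commute[OF fm(2) fm(1) Qlip] smooth_by_commute[OF fm(2) fm(2) Qlip, of _ 1]
          using smooth_by_heat_add[OF _ _ f, of "real k" t] t by simp
        also have "\<bar>\<dots>\<bar> \<le> L * C1 / (real k + t)" using t by (intro C1 f) simp
        also have "\<dots> \<le> L * C1 / n"
          using L C1 k e by (intro divide_left_mono mult_pos_pos) (auto simp: t_def of_nat_diff)
        finally show ?thesis .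
      qed
      ultimately have "\<bar>F (Suc k) - F k\<bar> \<le> L * C3 / (t * sqrt t) * A + L * C1 / n" unfolding eq by arith
      then show ?thesis by (simp add: t_def mult_ac)
    qed
    have "\<bar>F n - F 0\<bar> = \<bar>\<Sum>k<n. F (Suc k) - F k\<bar>" by (simp add: sum_lessThan_telescope)
    also have "\<dots> \<le> (\<Sum>k<n. \<bar>F (Suc k) - F k\<bar>)" by (rule sum_abs)
    also have "\<dots> \<le> (\<Sum>k<n. L * C1 / n + L * C3 * A * (1 / ((real (n - Suc k) + e) * sqrt (real (n - Suc k) + e))))"
      by (intro sum_mono step) simp
    also have "\<dots> = (\<Sum>k<n. L * C1 / n) + L * C3 * A * (\<Sum>k<n. 1 / ((real (n - Suc k) + e) * sqrt (real (n - Suc k) + e)))"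
      by (simp only: sum.distrib sum_distrib_left)
    also have "(\<Sum>k<n. 1 / ((real (n - Suc k) + e) * sqrt (real (n - Suc k) + e))) = (\<Sum>j<n. 1 / ((real j + e) * sqrt (real j + e)))"
      by (rule sum.nat_diff_reindex)
    also have "(\<Sum>k<n. L * C1 / n) + L * C3 * A * \<dots> \<le> L * C1 + L * C3 * A * (6 / sqrt e)"
      using L C1 C3 A by (intro add_mono mult_left_mono sum_inverse_three_halves e) auto
    also have "L * C3 * A * (6 / sqrt e) = L * A * (C3 * 6 / sqrt e)" by (simp add: mult_ac)
    also have "L * C1 + L * A * (C3 * 6 / sqrt e) \<le> L * C1 + L * A * (1 / 2)"
      using L A eC by (intro add_left_mono mult_left_mono) auto
    finally have main: "\<bar>F n - F 0\<bar> \<le> L * C1 + L * A / 2" by simp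
    have F0: "F 0 = ?Q e (?Q (real n) f) x"
      unfolding F_def using smooth_by_heat_add[OF _ _ f, of e "real n"] e by (simp add: add.commute)
    have Fn: "F n = (?P ^^ n) (?Q e f) x" unfolding F_def by simp
    have c0: "\<bar>F 0 - ?Q (real n) f x\<bar> \<le> L * sqrt e * m"
      unfolding F0 using smooth_by_heat_close[OF _ Qlip, of e] e by (simp add: m_def)
    \<comment> \<open>The smoothing error is uniform in the point, and averaging over
      \<open>\<mu>\<close> does not enlarge a uniform bound, however often it is repeated.\<close>
    have cn: "\<bar>(?P ^^ n) f x - F n\<bar> \<le> L * sqrt e * m"
    proof -
      have "\<bar>(?P ^^ k) (?Q e f) y - (?P ^^ k) f y\<bar> \<le> L * sqrt e * m" for k y
      proof (induction k arbitrary: y)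
        case (Suc k)
        interpret prob_space \<mu> using fm(1) by (simp add: finite_mean_law_def)
        have i: "integrable \<mu> (\<lambda>z. (?P ^^ k) (?Q e f) (y + z))" "integrable \<mu> (\<lambda>z. (?P ^^ k) f (y + z))"
          by (rule smooth_by_integrable[OF fm(1)], rule smooth_by_iterate_lipschitz[OF fm(1)], rule Qlip f)+
        have "\<bar>(?P ^^ Suc k) (?Q e f) y - (?P ^^ Suc k) f y\<bar> = \<bar>\<integral>z. (?P ^^ k) (?Q e f) (y + z) - (?P ^^ k) f (y + z) \<partial>\<mu>\<bar>"
          using i by (simp add: smooth_by_def[of _ _ y])
        also have "\<dots> \<le> (\<integral>z. \<bar>(?P ^^ k) (?Q e f) (y + z) - (?P ^^ k) f (y + z)\<bar> \<partial>\<mu>)" by (rule integral_abs_bound)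
        also have "\<dots> \<le> (\<integral>z. L * sqrt e * m \<partial>\<mu>)"
          by (intro integral_mono integrable_abs Bochner_Integration.integrable_diff i Suc) simp
        finally show ?case by (simp add: prob_space)
      qed (simp add: close)
      then show ?thesis unfolding Fn by (metis abs_minus_commute)
    qed
    have "\<bar>(?P ^^ n) f x - ?Q (real n) f x\<bar> \<le> L * sqrt e * m + (L * C1 + L * A / 2) + L * sqrt e * m"
      using c0 cn main by arith
    also have "\<dots> = L * A" by (simp add: A_def algebra_simps)
    finally show ?case .
  qed
  then show ?thesis using that A by blast
qed

section \<open>Degenerate kernels and the Hajek projection\<close>

text \<open>Resampling the coordinates in \<open>A\<close> from an independent copy preserves the
  product law. Integrating out just these coordinates thus becomes an inner integral over a full
  tuple.\<close>

lemma distr_PiM_mix: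
  assumes N: "prob_space N" and I: "finite I"
  shows "distr (Pi\<^sub>M I (\<lambda>_. N) \<Otimes>\<^sub>M Pi\<^sub>M I (\<lambda>_. N)) (Pi\<^sub>M I (\<lambda>_. N))
    (\<lambda>p. \<lambda>l\<in>I. if l \<in> A then snd p l else fst p l) = Pi\<^sub>M I (\<lambda>_. N)"
proof -
  interpret N: prob_space N by fact
  interpret product_sigma_finite "\<lambda>_. N" ..
  interpret P: prob_space "Pi\<^sub>M I (\<lambda>_. N)" by (intro prob_space_PiM N)
  let ?P = "Pi\<^sub>M I (\<lambda>_. N)"
  let ?m = "\<lambda>p. \<lambda>l\<in>I. if l \<in> A then snd p l else fst p l"
  have [measurable]: "?m \<in> measurable (?P \<Otimes>\<^sub>M ?P) ?P"
    by (intro measurable_restrict) (auto intro: measurable_compose[OF measurable_snd] measurable_compose[OF measurable_fst])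
  show ?thesis
  proof (rule PiM_eqI)
    fix E assume E: "\<And>i. i \<in> I \<Longrightarrow> E i \<in> sets N"
    let ?E1 = "\<lambda>l. if l \<in> A then space N else E l"
    let ?E2 = "\<lambda>l. if l \<in> A then E l else space N"
    have sp: "x \<in> space N" if "x \<in> E i" "i \<in> I" for x i using E[OF that(2)] sets.sets_into_space that by blast
    have "?m -` Pi\<^sub>E I E \<inter> space (?P \<Otimes>\<^sub>M ?P) = Pi\<^sub>E I ?E1 \<times> Pi\<^sub>E I ?E2"
      by (auto simp: space_pair_measure space_PiM PiE_iff split: if_splits intro: sp) (metis sp)+
    then have "emeasure (distr (?P \<Otimes>\<^sub>M ?P) ?P ?m) (Pi\<^sub>E I E) = emeasure (?P \<Otimes>\<^sub>M ?P) (Pi\<^sub>E I ?E1 \<times> Pi\<^sub>E I ?E2)"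
      using E I by (subst emeasure_distr) (auto intro!: sets_PiM_I_finite)
    also have "\<dots> = (\<Prod>i\<in>I. emeasure N (?E1 i)) * (\<Prod>i\<in>I. emeasure N (?E2 i))"
      using E I by (subst P.emeasure_pair_measure_Times) (auto intro!: sets_PiM_I_finite simp: emeasure_PiM)
    also have "\<dots> = (\<Prod>i\<in>I. emeasure N (E i))"
      unfolding prod.distrib[symmetric] by (intro prod.cong) (auto simp: N.emeasure_space_1)
    finally show "emeasure (distr (?P \<Otimes>\<^sub>M ?P) ?P ?m) (Pi\<^sub>E I E) = (\<Prod>i\<in>I. emeasure N (E i))" .
  qed (use I in auto)
qed

lemma measurable_PiM_upd [measurable]:
  assumes "s \<in> I"
  shows "(\<lambda>p. (snd p)(s := fst p)) \<in> measurable (N \<Otimes>\<^sub>M Pi\<^sub>M I (\<lambda>_. N)) (Pi\<^sub>M I (\<lambda>_. N))"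
proof (rule measurable_PiM_single')
  fix i assume "i \<in> I"
  then show "(\<lambda>p. ((snd p)(s := fst p)) i) \<in> measurable (N \<Otimes>\<^sub>M Pi\<^sub>M I (\<lambda>_. N)) N"
    by (cases "i = s") (auto intro: measurable_compose[OF measurable_snd])
qed (use assms in \<open>auto simp: space_pair_measure space_PiM PiE_iff extensional_def\<close>)

text \<open>Conditioning on one coordinate is expressed by overwriting it with an independent draw,
  so that all integrals run over the same index set.\<close>

lemma distr_PiM_upd:
  assumes N: "prob_space N" and I: "finite I" "s \<in> I"
  shows "distr (N \<Otimes>\<^sub>M Pi\<^sub>M I (\<lambda>_. N)) (Pi\<^sub>M I (\<lambda>_. N)) (\<lambda>p. (snd p)(s := fst p)) = Pi\<^sub>M I (\<lambda>_. N)"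
proof -
  interpret N: prob_space N by fact
  interpret product_sigma_finite "\<lambda>_. N" ..
  let ?P = "Pi\<^sub>M I (\<lambda>_. N)"
  interpret P: prob_space ?P by (intro prob_space_PiM N)
  let ?m = "\<lambda>p. (snd p)(s := fst p)"
  note [measurable] = I(2)
  show ?thesis
  proof (rule PiM_eqI)
    fix E assume E: "\<And>i. i \<in> I \<Longrightarrow> E i \<in> sets N"
    let ?E = "E(s := space N)"
    have sp: "x \<in> space N" if "x \<in> E i" "i \<in> I" for x i using E[OF that(2)] sets.sets_into_space that by blast
    have "?m -` Pi\<^sub>E I E \<inter> space (N \<Otimes>\<^sub>M ?P) = E s \<times> Pi\<^sub>E I ?E"
      using I(2) by (auto simp: space_pair_measure space_PiM PiE_iff extensional_def split: if_splits intro: sp) (metis sp)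
    then have "emeasure (distr (N \<Otimes>\<^sub>M ?P) ?P ?m) (Pi\<^sub>E I E) = emeasure (N \<Otimes>\<^sub>M ?P) (E s \<times> Pi\<^sub>E I ?E)"
      using E I by (subst emeasure_distr) (auto intro!: sets_PiM_I_finite measurable_PiM_upd)
    also have "\<dots> = emeasure N (E s) * (\<Prod>i\<in>I. emeasure N (?E i))"
      using E I by (subst P.emeasure_pair_measure_Times) (auto intro!: sets_PiM_I_finite simp: emeasure_PiM)
    also have "\<dots> = emeasure N (E s) * (\<Prod>i\<in>I - {s}. emeasure N (E i))"
      using I by (subst prod.remove[of I s]) (auto simp: N.emeasure_space_1 intro!: arg_cong2[where f="(*)"] prod.cong)
    also have "\<dots> = (\<Prod>i\<in>I. emeasure N (E i))"
      using I by (subst prod.remove[of I s]) auto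
    finally show "emeasure (distr (N \<Otimes>\<^sub>M ?P) ?P ?m) (Pi\<^sub>E I E) = (\<Prod>i\<in>I. emeasure N (E i))" .
  qed (use I in auto)
qed

lemma distr_PiM_reindex_const:
  assumes "prob_space N" "inj_on f I" "f \<in> I \<rightarrow> K"
  shows "distr (Pi\<^sub>M K (\<lambda>_. N)) (Pi\<^sub>M I (\<lambda>_. N)) (\<lambda>\<omega>. \<lambda>n\<in>I. \<omega> (f n)) = Pi\<^sub>M I (\<lambda>_. N)"
  using distr_PiM_reindex[of K "\<lambda>_. N" f I] assms by simp

lemma measurable_PiM_reindex:
  assumes "f \<in> I \<rightarrow> K"
  shows "(\<lambda>\<omega>. \<lambda>n\<in>I. \<omega> (f n)) \<in> measurable (Pi\<^sub>M K (\<lambda>_. N)) (Pi\<^sub>M I (\<lambda>_. N))"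
  using assms by (intro measurable_restrict measurable_component_singleton) auto

lemma integral_PiM_reindex:
  fixes F :: "('i \<Rightarrow> 'z) \<Rightarrow> real"
  assumes "prob_space N" "inj_on f I" "f \<in> I \<rightarrow> K" and F: "F \<in> borel_measurable (Pi\<^sub>M I (\<lambda>_. N))"
  shows "(\<integral>\<omega>. F (\<lambda>n\<in>I. \<omega> (f n)) \<partial>Pi\<^sub>M K (\<lambda>_. N)) = (\<integral>\<omega>. F \<omega> \<partial>Pi\<^sub>M I (\<lambda>_. N))"
    "integrable (Pi\<^sub>M K (\<lambda>_. N)) (\<lambda>\<omega>. F (\<lambda>n\<in>I. \<omega> (f n))) \<longleftrightarrow> integrable (Pi\<^sub>M I (\<lambda>_. N)) F"
  using integral_distr[OF measurable_PiM_reindex[OF assms(3)] F] integrable_distr_eq[OF measurable_PiM_reindex[OF assms(3)] F]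
  unfolding distr_PiM_reindex_const[OF assms(1-3)] by simp_all

lemma integrable_PiM_component:
  fixes F :: "'z \<Rightarrow> real"
  assumes N: "prob_space N" "l \<in> I" and F: "integrable N F"
  shows "integrable (Pi\<^sub>M I (\<lambda>_. N)) (\<lambda>z. F (z l))" "(\<integral>z. F (z l) \<partial>Pi\<^sub>M I (\<lambda>_. N)) = (\<integral>x. F x \<partial>N)"
proof -
  have d: "distr (Pi\<^sub>M I (\<lambda>_. N)) N (\<lambda>z. z l) = N" using N by (intro distr_PiM_component) auto
  have [measurable]: "F \<in> borel_measurable N" using F by simp
  have m: "(\<lambda>z. z l) \<in> measurable (Pi\<^sub>M I (\<lambda>_. N)) N" using N by measurable
  show "integrable (Pi\<^sub>M I (\<lambda>_. N)) (\<lambda>z. F (z l))"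
    using integrable_distr_eq[OF m, of F] F unfolding d by simp
  show "(\<integral>z. F (z l) \<partial>Pi\<^sub>M I (\<lambda>_. N)) = (\<integral>x. F x \<partial>N)"
    using integral_distr[OF m, of F] unfolding d by simp
qed

lemma integrable_mult_of_squares:
  fixes F G :: "'a \<Rightarrow> real"
  assumes "F \<in> borel_measurable M" "G \<in> borel_measurable M" "integrable M (\<lambda>x. (F x)\<^sup>2)" "integrable M (\<lambda>x. (G x)\<^sup>2)"
  shows "integrable M (\<lambda>x. F x * G x)"
    "\<bar>\<integral>x. F x * G x \<partial>M\<bar> \<le> ((\<integral>x. (F x)\<^sup>2 \<partial>M) + (\<integral>x. (G x)\<^sup>2 \<partial>M)) / 2"
proof -
  have b: "\<bar>a * b\<bar> \<le> (a\<^sup>2 + b\<^sup>2) / 2" for a b :: real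
    using zero_le_power2[of "\<bar>a\<bar> - \<bar>b\<bar>"] by (simp add: power2_eq_square algebra_simps abs_mult)
  have i: "integrable M (\<lambda>x. ((F x)\<^sup>2 + (G x)\<^sup>2) / 2)" using assms by simp
  show fg: "integrable M (\<lambda>x. F x * G x)"
    by (rule Bochner_Integration.integrable_bound[OF i]) (use assms b in auto)
  have "\<bar>\<integral>x. F x * G x \<partial>M\<bar> \<le> (\<integral>x. \<bar>F x * G x\<bar> \<partial>M)" by (rule integral_abs_bound)
  also have "\<dots> \<le> (\<integral>x. ((F x)\<^sup>2 + (G x)\<^sup>2) / 2 \<partial>M)" by (intro integral_mono integrable_abs fg i b)
  finally show "\<bar>\<integral>x. F x * G x \<partial>M\<bar> \<le> ((\<integral>x. (F x)\<^sup>2 \<partial>M) + (\<integral>x. (G x)\<^sup>2 \<partial>M)) / 2" using assms by simp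
qed

text \<open>All sections may be included: the integral of a non-integrable one is \<open>0\<close> by convention.\<close>

definition degenerate_kernel :: "nat \<Rightarrow> 'z measure \<Rightarrow> ((nat \<Rightarrow> 'z) \<Rightarrow> real) \<Rightarrow> bool" where
  "degenerate_kernel r N F \<longleftrightarrow> (\<forall>s<r. \<forall>z\<in>space N. (\<integral>y. F (y(s := z)) \<partial>tuples r N) = 0)"

text \<open>Choose \<open>s\<close> so that \<open>i s\<close> is the only index that the two images
  can share. Resampling the other indices of \<open>i\<close> does not touch the second factor, and
  the first one then integrates to zero over its section at \<open>s\<close>.\<close>

lemma degenerate_orthogonal:
  fixes F :: "(nat \<Rightarrow> 'z) \<Rightarrow> real"
  assumes N: "prob_space N" and r: "r \<ge> 1"
    and F[measurable]: "F \<in> borel_measurable (tuples r N)" and F2: "integrable (tuples r N) (\<lambda>y. (F y)\<^sup>2)"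
    and deg: "degenerate_kernel r N F"
    and i: "inj_on i {..<r}" "i \<in> {..<r} \<rightarrow> {..<n}" and j: "inj_on j {..<r}" "j \<in> {..<r} \<rightarrow> {..<n}"
    and one: "card (i ` {..<r} \<inter> j ` {..<r}) \<le> 1"
  shows "(\<integral>z. F (\<lambda>k\<in>{..<r}. z (i k)) * F (\<lambda>k\<in>{..<r}. z (j k)) \<partial>tuples n N) = 0"
proof -
  interpret N: prob_space N by fact
  let ?P = "tuples n N"
  interpret P: prob_space ?P by (intro prob_space_PiM N)
  interpret PP: pair_prob_space ?P ?P ..
  obtain s where s: "s < r" "i ` {..<r} \<inter> j ` {..<r} \<subseteq> {i s}"
  proof (cases "i ` {..<r} \<inter> j ` {..<r} = {}")
    case True
    then show ?thesis using that[of 0] r by auto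
  next
    case False
    then have "card (i ` {..<r} \<inter> j ` {..<r}) = 1" using one by (simp add: le_Suc_eq)
    then obtain k where k: "i ` {..<r} \<inter> j ` {..<r} = {k}" by (auto simp: card_1_singleton_iff)
    then have "k \<in> i ` {..<r}" by blast
    then obtain s where "s < r" "k = i s" by auto
    then show ?thesis using that k by auto
  qed
  define A where "A = i ` {..<r} - {i s}"
  let ?mix = "\<lambda>p. \<lambda>l\<in>{..<n}. if l \<in> A then snd p l else fst p l"
  have mm[measurable]: "?mix \<in> measurable (?P \<Otimes>\<^sub>M ?P) ?P"
    by (intro measurable_restrict) (auto intro: measurable_compose[OF measurable_snd] measurable_compose[OF measurable_fst])
  note [measurable] = measurable_PiM_reindex[OF i(2), of N] measurable_PiM_reindex[OF j(2), of N]
  let ?G = "\<lambda>z. F (\<lambda>k\<in>{..<r}. z (i k)) * F (\<lambda>k\<in>{..<r}. z (j k))"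
  have Gm[measurable]: "?G \<in> borel_measurable ?P" by measurable
  have "integrable ?P ?G"
    using integral_PiM_reindex(2)[OF N i, of "\<lambda>y. (F y)\<^sup>2"] integral_PiM_reindex(2)[OF N j, of "\<lambda>y. (F y)\<^sup>2"] F2
    by (intro integrable_mult_of_squares) (auto intro!: measurable_compose[OF measurable_PiM_reindex F] i j)
  then have Gi: "integrable (?P \<Otimes>\<^sub>M ?P) (\<lambda>p. ?G (?mix p))"
    using integrable_distr_eq[OF mm Gm] unfolding distr_PiM_mix[OF N finite_lessThan] by simp
  have mi: "(\<lambda>k\<in>{..<r}. ?mix p (i k)) = (\<lambda>k\<in>{..<r}. snd p (i k))(s := fst p (i s))" for p :: "(nat \<Rightarrow> 'z) \<times> (nat \<Rightarrow> 'z)"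
  proof
    fix k
    have "i k \<noteq> i s" if "k < r" "k \<noteq> s" using inj_onD[OF i(1)] that s by auto
    then show "(\<lambda>k\<in>{..<r}. ?mix p (i k)) k = ((\<lambda>k\<in>{..<r}. snd p (i k))(s := fst p (i s))) k"
      using i s by (cases "k = s") (auto simp: A_def restrict_def)
  qed
  have mj: "(\<lambda>k\<in>{..<r}. ?mix p (j k)) = (\<lambda>k\<in>{..<r}. fst p (j k))" for p :: "(nat \<Rightarrow> 'z) \<times> (nat \<Rightarrow> 'z)"
    using j s by (auto simp: A_def restrict_def fun_eq_iff)
  have "(\<integral>z. ?G z \<partial>?P) = (\<integral>p. ?G (?mix p) \<partial>(?P \<Otimes>\<^sub>M ?P))"
    using integral_distr[OF mm Gm] unfolding distr_PiM_mix[OF N finite_lessThan] .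
  also have "\<dots> = (\<integral>z. \<integral>y. F ((\<lambda>k\<in>{..<r}. y (i k))(s := z (i s))) * F (\<lambda>k\<in>{..<r}. z (j k)) \<partial>?P \<partial>?P)"
    using PP.integral_fst'[OF Gi, symmetric] unfolding mi mj by simp
  also have "\<dots> = (\<integral>z. 0 \<partial>?P)"
  proof (rule Bochner_Integration.integral_cong[OF refl])
    fix z assume z: "z \<in> space ?P"
    have zs: "z (i s) \<in> space N" using z i s by (auto simp: space_PiM PiE_iff)
    have "(\<lambda>y. F (y(s := z (i s)))) \<in> borel_measurable (tuples r N)"
      using measurable_compose[OF measurable_compose[OF measurable_Pair1'[OF zs] measurable_PiM_upd] F] s by simp
    then have "(\<integral>y. F ((\<lambda>k\<in>{..<r}. y (i k))(s := z (i s))) \<partial>?P) = (\<integral>y. F (y(s := z (i s))) \<partial>tuples r N)"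
      by (rule integral_PiM_reindex(1)[OF N i, of "\<lambda>y. F (y(s := z (i s)))"])
    also have "\<dots> = 0" using deg s zs by (simp add: degenerate_kernel_def)
    finally show "(\<integral>y. F ((\<lambda>k\<in>{..<r}. y (i k))(s := z (i s))) * F (\<lambda>k\<in>{..<r}. z (j k)) \<partial>?P) = 0" by simp
  qed
  finally show ?thesis by simp
qed

section \<open>Increasing index maps and the counting of overlaps\<close>

definition inc_maps :: "nat \<Rightarrow> nat \<Rightarrow> (nat \<Rightarrow> nat) set" where
  "inc_maps r n = {i \<in> {..<r} \<rightarrow>\<^sub>E {..<n}. strict_mono_on {..<r} i}"

lemma inc_mapsD:
  assumes "i \<in> inc_maps r n"
  shows "inj_on i {..<r}" "i \<in> {..<r} \<rightarrow> {..<n}" "card (i ` {..<r}) = r"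
proof -
  show 1: "inj_on i {..<r}" using assms by (auto simp: inc_maps_def intro: strict_mono_on_imp_inj_on)
  show "i \<in> {..<r} \<rightarrow> {..<n}" using assms by (auto simp: inc_maps_def PiE_iff)
  show "card (i ` {..<r}) = r" using card_image[OF 1] by simp
qed

lemma finite_inc_maps [simp]: "finite (inc_maps r n)"
  unfolding inc_maps_def by (rule finite_subset[of _ "{..<r} \<rightarrow>\<^sub>E {..<n}"]) (auto intro: finite_PiE)

text \<open>The position \<open>k\<close> can be read off the image: it is the number of elements
  below \<open>i k\<close>.\<close>

lemma strict_mono_on_image_unique:
  fixes i j :: "nat \<Rightarrow> nat"
  assumes "strict_mono_on {..<r} i" "strict_mono_on {..<r} j" "i ` {..<r} = j ` {..<r}" "k < r"
  shows "i k = j k"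
proof -
  have count: "card {x \<in> i ` {..<r}. x < i k} = k" if "strict_mono_on {..<r} i" "k < r" for i :: "nat \<Rightarrow> nat" and k
  proof -
    have "{x \<in> i ` {..<r}. x < i k} = i ` {..<k}"
      using that by (auto simp: strict_mono_on_less)
    moreover have "inj_on i {..<k}"
      using strict_mono_on_imp_inj_on[OF that(1)] by (rule inj_on_subset) (use that in auto)
    ultimately show ?thesis by (simp add: card_image)
  qed
  have "i k \<in> j ` {..<r}" using assms(3,4) by blast
  then obtain l where l: "l < r" "i k = j l" by auto
  have "k = card {x \<in> i ` {..<r}. x < i k}" using count[OF assms(1,4)] by simp
  also have "\<dots> = card {x \<in> j ` {..<r}. x < j l}" using assms(3) l by simp
  also have "\<dots> = l" using count[OF assms(2) l(1)] .
  finally show ?thesis using l by simp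
qed

lemma inc_maps_bij: "bij_betw (\<lambda>i. i ` {..<r}) (inc_maps r n) {B. B \<subseteq> {..<n} \<and> card B = r}"
  unfolding bij_betw_def
proof
  show "inj_on (\<lambda>i. i ` {..<r}) (inc_maps r n)"
  proof (rule inj_onI)
    fix i j assume ij: "i \<in> inc_maps r n" "j \<in> inc_maps r n" "i ` {..<r} = j ` {..<r}"
    show "i = j"
    proof (rule PiE_ext[of _ "{..<r}" "\<lambda>_. {..<n}"])
      show "i \<in> {..<r} \<rightarrow>\<^sub>E {..<n}" "j \<in> {..<r} \<rightarrow>\<^sub>E {..<n}" using ij by (auto simp: inc_maps_def)
      show "i k = j k" if "k \<in> {..<r}" for k
        using strict_mono_on_image_unique[of r i j k] ij that by (auto simp: inc_maps_def)
    qed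
  qed
  show "(\<lambda>i. i ` {..<r}) ` inc_maps r n = {B. B \<subseteq> {..<n} \<and> card B = r}"
  proof (intro equalityI subsetI)
    fix B assume "B \<in> (\<lambda>i. i ` {..<r}) ` inc_maps r n"
    then obtain i where i: "i \<in> inc_maps r n" "B = i ` {..<r}" by auto
    then show "B \<in> {B. B \<subseteq> {..<n} \<and> card B = r}" using inc_mapsD(2,3)[OF i(1)] by auto
  next
    fix B assume B: "B \<in> {B. B \<subseteq> {..<n} \<and> card B = r}"
    then have "finite B" using finite_subset by auto
    then obtain h where h: "bij_betw h {..<card B} B" "strict_mono_on {..<card B} h"
      using ex_bij_betw_strict_mono_card by blast
    have "restrict h {..<r} \<in> inc_maps r n"
      using h B unfolding inc_maps_def by (auto simp: bij_betw_def monotone_on_def)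
    moreover have "restrict h {..<r} ` {..<r} = B" using h B by (auto simp: bij_betw_def)
    ultimately show "B \<in> (\<lambda>i. i ` {..<r}) ` inc_maps r n" by blast
  qed
qed

lemma card_inc_maps: "card (inc_maps r n) = n choose r"
  using bij_betw_same_card[OF inc_maps_bij[of r n]] n_subsets[of "{..<n}" r] by simp

lemma card_subsets_containing:
  assumes "finite A" "C \<subseteq> A" "card C \<le> k"
  shows "card {B. B \<subseteq> A \<and> card B = k \<and> C \<subseteq> B} = (card A - card C) choose (k - card C)"
proof -
  have fC: "finite C" using assms finite_subset by blast
  have "bij_betw (\<lambda>B. B - C) {B. B \<subseteq> A \<and> card B = k \<and> C \<subseteq> B} {B. B \<subseteq> A - C \<and> card B = k - card C}"
  proof (rule bij_betwI[of _ _ _ "\<lambda>B. B \<union> C"])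
    show "(\<lambda>B. B - C) \<in> {B. B \<subseteq> A \<and> card B = k \<and> C \<subseteq> B} \<rightarrow> {B. B \<subseteq> A - C \<and> card B = k - card C}"
      using fC by (auto simp: card_Diff_subset)
    show "(\<lambda>B. B \<union> C) \<in> {B. B \<subseteq> A - C \<and> card B = k - card C} \<rightarrow> {B. B \<subseteq> A \<and> card B = k \<and> C \<subseteq> B}"
    proof
      fix B assume B: "B \<in> {B. B \<subseteq> A - C \<and> card B = k - card C}"
      then have "finite B" using assms finite_subset by blast
      moreover have "B \<inter> C = {}" using B by auto
      ultimately have "card (B \<union> C) = card B + card C" using fC by (simp add: card_Un_disjoint)
      then show "B \<union> C \<in> {B. B \<subseteq> A \<and> card B = k \<and> C \<subseteq> B}" using B assms by auto
    qed
  qed auto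
  from bij_betw_same_card[OF this] show ?thesis
    using n_subsets[of "A - C" "k - card C"] assms fC by (simp add: card_Diff_subset)
qed

lemma sum_inc_maps_image:
  "(\<Sum>i\<in>inc_maps r n. F (i ` {..<r})) = (\<Sum>B | B \<subseteq> {..<n} \<and> card B = r. F B)"
  using sum.reindex_bij_betw[OF inc_maps_bij] .

text \<open>Double counting: each index lies in \<open>(n - 1) choose (r - 1)\<close> of the subsets
  of size \<open>r\<close>.\<close>

lemma sum_inc_maps_additive:
  fixes g :: "nat \<Rightarrow> real"
  assumes "r \<ge> 1"
  shows "(\<Sum>i\<in>inc_maps r n. \<Sum>s<r. g (i s)) = real ((n - 1) choose (r - 1)) * (\<Sum>l<n. g l)"
proof -
  let ?S = "{B. B \<subseteq> {..<n} \<and> card B = r}"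
  have fS: "finite ?S" by (rule finite_subset[of _ "Pow {..<n}"]) auto
  have "(\<Sum>i\<in>inc_maps r n. \<Sum>s<r. g (i s)) = (\<Sum>i\<in>inc_maps r n. \<Sum>l\<in>i ` {..<r}. g l)"
  proof (rule sum.cong[OF refl])
    fix i assume "i \<in> inc_maps r n"
    then show "(\<Sum>s<r. g (i s)) = (\<Sum>l\<in>i ` {..<r}. g l)" using sum.reindex[OF inc_mapsD(1), of i r n g] by simp
  qed
  also have "\<dots> = (\<Sum>B\<in>?S. \<Sum>l\<in>B. g l)" using sum_inc_maps_image[of "\<lambda>B. \<Sum>l\<in>B. g l"] .
  also have "\<dots> = (\<Sum>B\<in>?S. \<Sum>l | l \<in> {..<n} \<and> l \<in> B. g l)"
    by (intro sum.cong refl) auto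
  also have "\<dots> = (\<Sum>l<n. \<Sum>B | B \<in> ?S \<and> l \<in> B. g l)"
    using fS by (intro sum.swap_restrict) auto
  also have "\<dots> = (\<Sum>l<n. real ((n - 1) choose (r - 1)) * g l)"
  proof (intro sum.cong refl)
    fix l assume l: "l \<in> {..<n}"
    have "{B. B \<in> ?S \<and> l \<in> B} = {B. B \<subseteq> {..<n} \<and> card B = r \<and> {l} \<subseteq> B}" by auto
    then have "card {B. B \<in> ?S \<and> l \<in> B} = (n - 1) choose (r - 1)"
      using card_subsets_containing[of "{..<n}" "{l}" r] l assms by simp
    then show "(\<Sum>B | B \<in> ?S \<and> l \<in> B. g l) = real ((n - 1) choose (r - 1)) * g l" by simp
  qed
  finally show ?thesis by (simp add: sum_distrib_left)
qed

text \<open>A union bound over ordered pairs of distinct indices in the image of \<open>i\<close>: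
  at most \<open>r\<^sup>2\<close> pairs, each contained in \<open>(n - 2) choose (r - 2)\<close>
  subsets. Relative to \<open>n choose r\<close> the latter is
  \<open>r (r - 1) / (n (n - 1))\<close>, at most \<open>2 r\<^sup>2 / n\<^sup>2\<close>. For
  \<open>r = 1\<close> two common indices are impossible.\<close>

lemma card_overlapping_inc_maps:
  assumes i: "i \<in> inc_maps r n" and n: "n \<ge> r" "r \<ge> 1"
  shows "real (card {j \<in> inc_maps r n. card (i ` {..<r} \<inter> j ` {..<r}) \<ge> 2}) * real n ^ 2 \<le> 2 * real r ^ 4 * real (n choose r)"
proof (cases "r \<ge> 2")
  case False
  have "card (i ` {..<r} \<inter> j ` {..<r}) \<le> card (i ` {..<r})" for j by (intro card_mono) auto
  then have "\<not> 2 \<le> card (i ` {..<r} \<inter> j ` {..<r})" for j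
    using inc_mapsD(3)[OF i] False order.trans by fastforce
  then have "{j \<in> inc_maps r n. card (i ` {..<r} \<inter> j ` {..<r}) \<ge> 2} = {}"
    by simp
  then show ?thesis by (simp only: card.empty) simp
next
  case True
  let ?J = "{j \<in> inc_maps r n. card (i ` {..<r} \<inter> j ` {..<r}) \<ge> 2}"
  let ?A = "i ` {..<r}"
  let ?T = "\<lambda>p. {B. B \<subseteq> {..<n} \<and> card B = r \<and> {fst p, snd p} \<subseteq> B}"
  let ?Q = "{p \<in> ?A \<times> ?A. fst p \<noteq> snd p}"
  have fT: "finite (?T p)" for p by (rule finite_subset[of _ "Pow {..<n}"]) auto
  have fQ: "finite ?Q" by (rule finite_subset[of _ "?A \<times> ?A"]) simp_all
  have sub: "(\<lambda>j. j ` {..<r}) ` ?J \<subseteq> (\<Union>p\<in>?Q. ?T p)"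
  proof
    fix B assume "B \<in> (\<lambda>j. j ` {..<r}) ` ?J"
    then obtain j where j: "j \<in> inc_maps r n" "B = j ` {..<r}" "2 \<le> card (?A \<inter> B)" by blast
    obtain D where D: "D \<subseteq> ?A \<inter> B" "card D = 2" by (rule obtain_subset_with_card_n[OF j(3)])
    obtain a b where ab: "D = {a, b}" "a \<noteq> b" using D(2) by (meson card_2_iff)
    then have "a \<in> ?A" "b \<in> ?A" "{a, b} \<subseteq> B" using D(1) by blast+
    moreover have "B \<subseteq> {..<n}" unfolding j(2) image_subset_iff_funcset by (rule inc_mapsD(2)[OF j(1)])
    moreover have "card B = r" using inc_mapsD(3)[OF j(1)] j(2) by simp
    ultimately show "B \<in> (\<Union>p\<in>?Q. ?T p)" using ab(2) by (intro UN_I[of "(a, b)"]) simp_all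
  qed
  have "inj_on (\<lambda>j. j ` {..<r}) ?J"
    using bij_betw_imp_inj_on[OF inc_maps_bij[of r n]] by (rule inj_on_subset) blast
  then have "card ?J = card ((\<lambda>j. j ` {..<r}) ` ?J)" by (rule card_image[symmetric])
  also have "\<dots> \<le> card (\<Union>p\<in>?Q. ?T p)" by (rule card_mono[OF finite_UN_I[OF fQ fT] sub])
  also have "\<dots> \<le> (\<Sum>p\<in>?Q. card (?T p))" by (rule card_UN_le[OF fQ])
  also have "\<dots> = (\<Sum>p\<in>?Q. (n - 2) choose (r - 2))"
  proof (rule sum.cong[OF refl])
    fix p assume p: "p \<in> ?Q"
    have A: "?A \<subseteq> {..<n}" unfolding image_subset_iff_funcset by (rule inc_mapsD(2)[OF i])
    have "fst p \<in> ?A" "snd p \<in> ?A" "fst p \<noteq> snd p" using p unfolding mem_Collect_eq mem_Times_iff by blast+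
    then have "{fst p, snd p} \<subseteq> {..<n}" "card {fst p, snd p} = 2" using A by (blast, simp)
    then show "card (?T p) = (n - 2) choose (r - 2)"
      using card_subsets_containing[of "{..<n}" "{fst p, snd p}" r] True by simp
  qed
  also have "\<dots> = card ?Q * ((n - 2) choose (r - 2))" by simp
  also have "\<dots> \<le> r\<^sup>2 * ((n - 2) choose (r - 2))"
  proof -
    have "card ?Q \<le> card (?A \<times> ?A)" by (rule card_mono) simp_all
    also have "\<dots> = r\<^sup>2" using inc_mapsD(3)[OF i] by (simp add: card_cartesian_product power2_eq_square)
    finally show ?thesis by simp
  qed
  finally have J: "real (card ?J) \<le> real (r\<^sup>2 * ((n - 2) choose (r - 2)))" by (rule of_nat_mono)
  have "r * (n choose r) = n * ((n - 1) choose (r - 1))" using n times_binomial_minus1_eq[of r n] by simp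
  then have e1: "real r * real (n choose r) = real n * real ((n - 1) choose (r - 1))"
    by (simp only: of_nat_mult[symmetric])
  have "(r - 1) * ((n - 1) choose (r - 1)) = (n - 1) * ((n - 2) choose (r - 2))"
    using True times_binomial_minus1_eq[of "r - 1" "n - 1"] by (simp add: numeral_2_eq_2)
  then have "real (r - 1) * real ((n - 1) choose (r - 1)) = real (n - 1) * real ((n - 2) choose (r - 2))"
    by (simp only: of_nat_mult[symmetric])
  then have e2: "(real r - 1) * real ((n - 1) choose (r - 1)) = (real n - 1) * real ((n - 2) choose (r - 2))"
    using n True by (simp add: of_nat_diff)
  have id: "real n * (real n - 1) * real ((n - 2) choose (r - 2)) = (real r - 1) * (real r * real (n choose r))"
    unfolding e1 using e2 by (simp add: mult.assoc mult.left_commute)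
  have "real n * 2 \<le> real n * real n" using n True by (intro mult_left_mono) auto
  then have "real n ^ 2 \<le> 2 * (real n * (real n - 1))" by (simp add: power2_eq_square right_diff_distrib)
  then have "real n ^ 2 * real ((n - 2) choose (r - 2)) \<le> 2 * (real n * (real n - 1)) * real ((n - 2) choose (r - 2))"
    by (intro mult_right_mono) auto
  also have "\<dots> = 2 * ((real r - 1) * (real r * real (n choose r)))" using id by (simp add: mult.assoc)
  also have "\<dots> \<le> 2 * (real r * (real r * real (n choose r)))" by (intro mult_left_mono mult_right_mono) auto
  finally have 2: "real n ^ 2 * real ((n - 2) choose (r - 2)) \<le> 2 * real r ^ 2 * real (n choose r)" by (simp add: power2_eq_square mult.assoc)
  have "real (card ?J) * real n ^ 2 \<le> real (r\<^sup>2 * ((n - 2) choose (r - 2))) * real n ^ 2" using J by (intro mult_right_mono) auto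
  also have "\<dots> = real r ^ 2 * (real n ^ 2 * real ((n - 2) choose (r - 2)))" by simp
  also have "\<dots> \<le> real r ^ 2 * (2 * real r ^ 2 * real (n choose r))" by (intro mult_left_mono 2) auto
  also have "\<dots> = 2 * real r ^ 4 * real (n choose r)" by (simp add: power2_eq_square eval_nat_numeral)
  finally show ?thesis .
qed

text \<open>Only the pairs counted by \<open>card_overlapping_inc_maps\<close> survive in the
  expanded square, and \<open>2 a b \<le> a\<^sup>2 + b\<^sup>2\<close> bounds each of them by the
  second moment of \<open>F\<close>.\<close>

lemma degenerate_sum_second_moment:
  fixes F :: "(nat \<Rightarrow> 'z) \<Rightarrow> real"
  assumes N: "prob_space N" and r: "r \<ge> 1" "n \<ge> r"
    and F[measurable]: "F \<in> borel_measurable (tuples r N)" and F2: "integrable (tuples r N) (\<lambda>y. (F y)\<^sup>2)"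
    and deg: "degenerate_kernel r N F"
  shows "integrable (tuples n N) (\<lambda>z. (\<Sum>i\<in>inc_maps r n. F (\<lambda>k\<in>{..<r}. z (i k)))\<^sup>2)"
    "(\<integral>z. (\<Sum>i\<in>inc_maps r n. F (\<lambda>k\<in>{..<r}. z (i k)))\<^sup>2 \<partial>tuples n N) * real n ^ 2
      \<le> 2 * real r ^ 4 * real (n choose r) ^ 2 * (\<integral>y. (F y)\<^sup>2 \<partial>tuples r N)"
proof -
  let ?P = "tuples n N"
  let ?V = "\<integral>y. (F y)\<^sup>2 \<partial>tuples r N"
  let ?F = "\<lambda>i z. F (\<lambda>k\<in>{..<r}. z (i k))"
  have sq: "(\<Sum>i\<in>inc_maps r n. ?F i z)\<^sup>2 = (\<Sum>i\<in>inc_maps r n. \<Sum>j\<in>inc_maps r n. ?F i z * ?F j z)" for z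
    by (simp add: power2_eq_square sum_product)
  have m: "?F i \<in> borel_measurable ?P" if "i \<in> inc_maps r n" for i
    using inc_mapsD(2)[OF that] by (intro measurable_compose[OF measurable_PiM_reindex F])
  have s: "integrable ?P (\<lambda>z. (?F i z)\<^sup>2)" "(\<integral>z. (?F i z)\<^sup>2 \<partial>?P) = ?V" if "i \<in> inc_maps r n" for i
    using integral_PiM_reindex[OF N inc_mapsD(1,2)[OF that], of "\<lambda>y. (F y)\<^sup>2"] F2 by auto
  have ij: "integrable ?P (\<lambda>z. ?F i z * ?F j z)" "(\<integral>z. ?F i z * ?F j z \<partial>?P) \<le> ?V" if "i \<in> inc_maps r n" "j \<in> inc_maps r n" for i j
    using integrable_mult_of_squares[OF m[OF that(1)] m[OF that(2)] s(1)[OF that(1)] s(1)[OF that(2)]] s(2) that by auto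
  show "integrable ?P (\<lambda>z. (\<Sum>i\<in>inc_maps r n. ?F i z)\<^sup>2)"
    unfolding sq by (intro Bochner_Integration.integrable_sum ij)
  have V: "?V \<ge> 0" by simp
  have row: "(\<Sum>j\<in>inc_maps r n. \<integral>z. ?F i z * ?F j z \<partial>?P) * real n ^ 2 \<le> 2 * real r ^ 4 * real (n choose r) * ?V"
    if i: "i \<in> inc_maps r n" for i
  proof -
    let ?J = "{j \<in> inc_maps r n. card (i ` {..<r} \<inter> j ` {..<r}) \<ge> 2}"
    have "(\<Sum>j\<in>inc_maps r n. \<integral>z. ?F i z * ?F j z \<partial>?P) = (\<Sum>j\<in>?J. \<integral>z. ?F i z * ?F j z \<partial>?P)"
    proof (intro sum.mono_neutral_right ballI)
      fix j assume "j \<in> inc_maps r n - ?J"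
      then have j: "j \<in> inc_maps r n" and one: "card (i ` {..<r} \<inter> j ` {..<r}) \<le> 1" by auto
      show "(\<integral>z. ?F i z * ?F j z \<partial>?P) = 0"
        by (rule degenerate_orthogonal[OF N r(1) F F2 deg inc_mapsD(1,2)[OF i] inc_mapsD(1,2)[OF j] one])
    qed auto
    also have "\<dots> \<le> (\<Sum>j\<in>?J. ?V)" using i by (intro sum_mono ij) auto
    finally have "(\<Sum>j\<in>inc_maps r n. \<integral>z. ?F i z * ?F j z \<partial>?P) * real n ^ 2 \<le> (real (card ?J) * ?V) * real n ^ 2"
      by (intro mult_right_mono) auto
    also have "\<dots> = (real (card ?J) * real n ^ 2) * ?V" by simp
    also have "\<dots> \<le> (2 * real r ^ 4 * real (n choose r)) * ?V"
      by (intro mult_right_mono card_overlapping_inc_maps i r V)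
    finally show ?thesis .
  qed
  have "(\<integral>z. (\<Sum>i\<in>inc_maps r n. ?F i z)\<^sup>2 \<partial>?P) * real n ^ 2 = (\<Sum>i\<in>inc_maps r n. (\<Sum>j\<in>inc_maps r n. \<integral>z. ?F i z * ?F j z \<partial>?P) * real n ^ 2)"
    unfolding sq by (simp add: ij sum_distrib_right)
  also have "\<dots> \<le> (\<Sum>i\<in>inc_maps r n. 2 * real r ^ 4 * real (n choose r) * ?V)" by (intro sum_mono row)
  also have "\<dots> = 2 * real r ^ 4 * real (n choose r) ^ 2 * ?V" by (simp add: card_inc_maps power2_eq_square)
  finally show "(\<integral>z. (\<Sum>i\<in>inc_maps r n. ?F i z)\<^sup>2 \<partial>?P) * real n ^ 2 \<le> 2 * real r ^ 4 * real (n choose r) ^ 2 * ?V" .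
qed

section \<open>Moments of sections and the Hajek projection\<close>

lemma (in prob_space) integrable_lower_power:
  fixes X :: "'a \<Rightarrow> real"
  assumes [measurable]: "X \<in> borel_measurable M" and "integrable M (\<lambda>x. \<bar>X x\<bar> ^ k)" "j \<le> k"
  shows "integrable M (\<lambda>x. \<bar>X x\<bar> ^ j)"
proof (rule Bochner_Integration.integrable_bound[of _ "\<lambda>x. 1 + \<bar>X x\<bar> ^ k"])
  show "AE x in M. norm (\<bar>X x\<bar> ^ j) \<le> norm (1 + \<bar>X x\<bar> ^ k)"
    using power_le_one_plus[OF abs_ge_zero assms(3)] by (auto simp: power_abs abs_of_nonneg)
qed (use assms in auto)

text \<open>A convex power lies above its tangent at \<open>m\<close>: the difference is
  \<open>(x - m)\<^sup>2\<close>, multiplied by \<open>x + 2 * m\<close> when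
  \<open>k = 3\<close>.\<close>

lemma power_tangent_le:
  fixes x m :: real
  assumes "x \<ge> 0" "m \<ge> 0" "k \<in> {2, 3}"
  shows "m ^ k + of_nat k * m ^ (k - 1) * (x - m) \<le> x ^ k"
proof -
  have "0 \<le> (x - m)\<^sup>2" "0 \<le> (x - m)\<^sup>2 * (x + 2 * m)" using assms by simp_all
  then show ?thesis using assms(3) by (auto simp: power2_eq_square power3_eq_cube algebra_simps)
qed

text \<open>Jensen's inequality: integrate the tangent at the mean, where the linear term
  vanishes.\<close>

lemma (in prob_space) power_expectation_le:
  fixes X :: "'a \<Rightarrow> real"
  assumes [measurable]: "X \<in> borel_measurable M" and i: "integrable M (\<lambda>x. \<bar>X x\<bar> ^ k)" and k: "k \<in> {2, 3}"
  shows "\<bar>expectation X\<bar> ^ k \<le> expectation (\<lambda>x. \<bar>X x\<bar> ^ k)"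
proof -
  have ia: "integrable M (\<lambda>x. \<bar>X x\<bar>)" using integrable_lower_power[OF assms(1) i, of 1] k by auto
  define m where "m = expectation (\<lambda>x. \<bar>X x\<bar>)"
  have m: "m \<ge> 0" by (simp add: m_def)
  have "\<bar>expectation X\<bar> ^ k \<le> m ^ k" unfolding m_def by (intro power_mono integral_abs_bound) auto
  also have "\<dots> = expectation (\<lambda>x. m ^ k + of_nat k * m ^ (k - 1) * (\<bar>X x\<bar> - m))"
    using ia by (simp add: prob_space m_def)
  also have "\<dots> \<le> expectation (\<lambda>x. \<bar>X x\<bar> ^ k)"
    using ia m k by (intro integral_mono i power_tangent_le Bochner_Integration.integrable_add integrable_mult_right Bochner_Integration.integrable_diff) auto
  finally show ?thesis .
qed

lemma integral_PiM_section:
  fixes H :: "('i \<Rightarrow> 'z) \<Rightarrow> real"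
  assumes N: "prob_space N" and I: "finite I" "s \<in> I" and H: "integrable (Pi\<^sub>M I (\<lambda>_. N)) H"
  shows "integrable N (\<lambda>z. \<integral>y. H (y(s := z)) \<partial>Pi\<^sub>M I (\<lambda>_. N))"
    "(\<integral>z. (\<integral>y. H (y(s := z)) \<partial>Pi\<^sub>M I (\<lambda>_. N)) \<partial>N) = (\<integral>y. H y \<partial>Pi\<^sub>M I (\<lambda>_. N))"
    "AE z in N. integrable (Pi\<^sub>M I (\<lambda>_. N)) (\<lambda>y. H (y(s := z)))"
proof -
  let ?P = "Pi\<^sub>M I (\<lambda>_. N)"
  interpret N: prob_space N by fact
  interpret P: prob_space ?P by (intro prob_space_PiM N)
  interpret PP: pair_prob_space N ?P ..
  have m: "(\<lambda>p. (snd p)(s := fst p)) \<in> measurable (N \<Otimes>\<^sub>M ?P) ?P" by (rule measurable_PiM_upd[OF I(2)])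
  have Hm: "H \<in> borel_measurable ?P" using H by simp
  have i: "integrable (N \<Otimes>\<^sub>M ?P) (\<lambda>p. H ((snd p)(s := fst p)))"
    using integrable_distr_eq[OF m Hm] H unfolding distr_PiM_upd[OF N I] by simp
  show "integrable N (\<lambda>z. \<integral>y. H (y(s := z)) \<partial>?P)" using PP.integrable_fst'[OF i] by simp
  show "(\<integral>z. (\<integral>y. H (y(s := z)) \<partial>?P) \<partial>N) = (\<integral>y. H y \<partial>?P)"
    using PP.integral_fst'[OF i] integral_distr[OF m Hm] unfolding distr_PiM_upd[OF N I] by simp
  show "AE z in N. integrable ?P (\<lambda>y. H (y(s := z)))" using PP.AE_integrable_fst'[OF i] by simp
qed

lemma measurable_PiM_section:
  assumes "s \<in> I" "H \<in> borel_measurable (Pi\<^sub>M I (\<lambda>_. N))" "z \<in> space N"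
  shows "(\<lambda>y. H (y(s := z))) \<in> borel_measurable (Pi\<^sub>M I (\<lambda>_. N))"
  using measurable_compose[OF measurable_compose[OF measurable_Pair1'[OF assms(3)] measurable_PiM_upd[OF assms(1)]] assms(2)] by simp

text \<open>The conditional mean of the kernel given its first argument, as a function defined at
  every \<open>z\<close>; where the section is not integrable its value is \<open>0\<close>.\<close>

definition hajek_kernel :: "nat \<Rightarrow> 'z measure \<Rightarrow> ((nat \<Rightarrow> 'z) \<Rightarrow> real) \<Rightarrow> 'z \<Rightarrow> real" where
  "hajek_kernel r N F z = (\<integral>y. F (y(0 := z)) \<partial>tuples r N)"

lemma hajek_kernel_measurable:
  assumes N: "prob_space N" and r: "r \<ge> 1" and F: "F \<in> borel_measurable (tuples r N)"
  shows "hajek_kernel r N F \<in> borel_measurable N"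
proof -
  interpret N: prob_space N by fact
  interpret P: prob_space "tuples r N" by (intro prob_space_PiM N)
  have "(\<lambda>p. F ((snd p)(0 := fst p))) \<in> borel_measurable (N \<Otimes>\<^sub>M tuples r N)"
    using r by (intro measurable_compose[OF measurable_PiM_upd F]) auto
  then show ?thesis
    unfolding hajek_kernel_def[abs_def] by (intro P.borel_measurable_lebesgue_integral) (simp add: case_prod_beta')
qed

lemma hajek_kernel_power:
  assumes N: "prob_space N" and r: "r \<ge> 1" and F: "F \<in> borel_measurable (tuples r N)"
    and i: "integrable (tuples r N) (\<lambda>y. \<bar>F y\<bar> ^ k)" and k: "k \<in> {2, 3}"
  shows "integrable N (\<lambda>z. \<bar>hajek_kernel r N F z\<bar> ^ k)"
proof (rule Bochner_Integration.integrable_bound)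
  interpret P: prob_space "tuples r N" by (intro prob_space_PiM N)
  have 0: "0 \<in> {..<r}" using r by auto
  note sec = integral_PiM_section[OF N finite_lessThan 0 i]
  show "integrable N (\<lambda>z. \<integral>y. \<bar>F (y(0 := z))\<bar> ^ k \<partial>tuples r N)" by (rule sec(1))
  show "(\<lambda>z. \<bar>hajek_kernel r N F z\<bar> ^ k) \<in> borel_measurable N"
    using hajek_kernel_measurable[OF N r F] by measurable
  show "AE z in N. norm (\<bar>hajek_kernel r N F z\<bar> ^ k) \<le> norm (\<integral>y. \<bar>F (y(0 := z))\<bar> ^ k \<partial>tuples r N)"
    using sec(3) AE_space
  proof eventually_elim
    case (elim z)
    have "\<bar>hajek_kernel r N F z\<bar> ^ k \<le> (\<integral>y. \<bar>F (y(0 := z))\<bar> ^ k \<partial>tuples r N)"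
      unfolding hajek_kernel_def by (rule P.power_expectation_le[OF measurable_PiM_section[OF 0 F elim(2)] elim(1) k])
    then show ?case by (simp add: abs_of_nonneg)
  qed
qed

lemma hajek_kernel_integral:
  assumes N: "prob_space N" and r: "r \<ge> 1" and F: "integrable (tuples r N) F"
  shows "integrable N (hajek_kernel r N F)" "(\<integral>z. hajek_kernel r N F z \<partial>N) = (\<integral>y. F y \<partial>tuples r N)"
  unfolding hajek_kernel_def[abs_def] using r by (intro integral_PiM_section[OF N finite_lessThan _ F]; simp)+

text \<open>Transposing \<open>0\<close> and \<open>s\<close> turns one section into the other, and
  the product law is invariant under permutations.\<close>

lemma symmetric_section:
  fixes F :: "(nat \<Rightarrow> 'z) \<Rightarrow> real"
  assumes N: "prob_space N" and s: "s < r" and F: "F \<in> borel_measurable (tuples r N)"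
    and sym: "symmetric_kernel r N F" and z: "z \<in> space N"
  shows "(\<integral>y. F (y(s := z)) \<partial>tuples r N) = hajek_kernel r N F z"
    "integrable (tuples r N) (\<lambda>y. F (y(s := z))) \<longleftrightarrow> integrable (tuples r N) (\<lambda>y. F (y(0 := z)))"
proof -
  define \<pi> where "\<pi> = Transposition.transpose 0 s"
  have p: "\<pi> permutes {..<r}" unfolding \<pi>_def using s by (intro permutes_swap_id) auto
  have inj: "inj_on \<pi> {..<r}" using permutes_inj[OF p] by (rule inj_on_subset) auto
  have pr: "\<pi> \<in> {..<r} \<rightarrow> {..<r}" using permutes_in_image[OF p] by auto
  have 0: "0 \<in> {..<r}" using s by auto
  have Fm: "(\<lambda>y. F (y(0 := z))) \<in> borel_measurable (tuples r N)" by (rule measurable_PiM_section[OF 0 F z])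
  have eq: "F (y(s := z)) = F ((\<lambda>k\<in>{..<r}. y (\<pi> k))(0 := z))" if y: "y \<in> space (tuples r N)" for y
  proof -
    have ys: "y(s := z) \<in> space (tuples r N)" using y z s by (auto simp: space_PiM PiE_iff extensional_def)
    have "(y(s := z)) \<circ> \<pi> = (\<lambda>k\<in>{..<r}. y (\<pi> k))(0 := z)"
    proof
      fix k
      show "((y(s := z)) \<circ> \<pi>) k = ((\<lambda>k\<in>{..<r}. y (\<pi> k))(0 := z)) k"
        using y s by (cases "k = 0"; cases "k = s") (auto simp: \<pi>_def Transposition.transpose_def space_PiM PiE_iff extensional_def)
    qed
    then show ?thesis using sym p ys unfolding symmetric_kernel_def by metis
  qed
  have "(\<integral>y. F (y(s := z)) \<partial>tuples r N) = (\<integral>y. F ((\<lambda>k\<in>{..<r}. y (\<pi> k))(0 := z)) \<partial>tuples r N)"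
    using eq by (rule Bochner_Integration.integral_cong[OF refl])
  also have "\<dots> = hajek_kernel r N F z" unfolding hajek_kernel_def by (rule integral_PiM_reindex(1)[OF N inj pr Fm])
  finally show "(\<integral>y. F (y(s := z)) \<partial>tuples r N) = hajek_kernel r N F z" .
  have "integrable (tuples r N) (\<lambda>y. F (y(s := z))) \<longleftrightarrow> integrable (tuples r N) (\<lambda>y. F ((\<lambda>k\<in>{..<r}. y (\<pi> k))(0 := z)))"
    using eq by (rule Bochner_Integration.integrable_cong[OF refl])
  also have "\<dots> \<longleftrightarrow> integrable (tuples r N) (\<lambda>y. F (y(0 := z)))" by (rule integral_PiM_reindex(2)[OF N inj pr Fm])
  finally show "integrable (tuples r N) (\<lambda>y. F (y(s := z))) \<longleftrightarrow> integrable (tuples r N) (\<lambda>y. F (y(0 := z)))" .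
qed

text \<open>With coordinate \<open>s\<close> fixed at \<open>z\<close>, both \<open>F\<close> and
  the summand \<open>k = s\<close> integrate to the Hajek kernel at \<open>z\<close>, while the
  remaining summands are centred.\<close>

lemma hoeffding_degenerate:
  fixes F :: "(nat \<Rightarrow> 'z) \<Rightarrow> real"
  assumes N: "prob_space N" and r: "r \<ge> 1" and F: "integrable (tuples r N) F"
    and sym: "symmetric_kernel r N F" and mean: "(\<integral>y. F y \<partial>tuples r N) = 0"
  shows "degenerate_kernel r N (\<lambda>y. F y - (\<Sum>k<r. hajek_kernel r N F (y k)))"
  unfolding degenerate_kernel_def
proof (intro allI impI ballI)
  fix s z assume s: "s < r" and z: "z \<in> space N"
  let ?P = "tuples r N"
  let ?g = "hajek_kernel r N F"
  interpret P: prob_space ?P by (intro prob_space_PiM N)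
  note g = hajek_kernel_integral[OF N r F]
  have gi: "integrable ?P (\<lambda>y. ?g (y k))" "(\<integral>y. ?g (y k) \<partial>?P) = 0" if "k < r" for k
    using integrable_PiM_component[OF N _ g(1), of k "{..<r}"] that g(2) mean by auto
  have split: "(\<Sum>k<r. ?g ((y(s := z)) k)) = ?g z + (\<Sum>k\<in>{..<r} - {s}. ?g (y k))" for y
    using s by (subst sum.remove[of "{..<r}" s]) auto
  have i2: "integrable ?P (\<lambda>y. \<Sum>k<r. ?g ((y(s := z)) k))"
    unfolding split by (intro Bochner_Integration.integrable_add Bochner_Integration.integrable_sum gi) auto
  have v2: "(\<integral>y. (\<Sum>k<r. ?g ((y(s := z)) k)) \<partial>?P) = ?g z"
    unfolding split by (subst Bochner_Integration.integral_add) (auto simp: gi P.prob_space intro!: Bochner_Integration.integrable_sum gi)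
  show "(\<integral>y. F (y(s := z)) - (\<Sum>k<r. ?g ((y(s := z)) k)) \<partial>?P) = 0"
  proof (cases "integrable ?P (\<lambda>y. F (y(s := z)))")
    case True
    then show ?thesis using i2 v2 symmetric_section(1)[OF N s _ sym z] F by simp
  next
    \<comment> \<open>The sum is integrable, so the difference inherits non-integrability from
      \<open>F\<close>, and its integral is \<open>0\<close> by default.\<close>
    case False
    have "\<not> integrable ?P (\<lambda>y. F (y(s := z)) - (\<Sum>k<r. ?g ((y(s := z)) k)))"
    proof
      assume "integrable ?P (\<lambda>y. F (y(s := z)) - (\<Sum>k<r. ?g ((y(s := z)) k)))"
      from Bochner_Integration.integrable_add[OF this i2] False show False by simp
    qed
    then show ?thesis by (rule not_integrable_integral_eq)
  qed
qed

text \<open>The difference is exactly \<open>sqrt n / (r * (n choose r))\<close> times the sum over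
  the degenerate kernel \<open>D\<close>. Its second moment is thus of order
  \<open>n / n\<^sup>2\<close>, and Jensen's inequality passes to the mean absolute value.\<close>

lemma hajek_projection_error:
  fixes F :: "(nat \<Rightarrow> 'z) \<Rightarrow> real"
  assumes N: "prob_space N" and r: "r \<ge> 1" and F[measurable]: "F \<in> borel_measurable (tuples r N)"
    and F2: "integrable (tuples r N) (\<lambda>y. \<bar>F y\<bar> ^ 2)"
    and sym: "symmetric_kernel r N F" and mean: "(\<integral>y. F y \<partial>tuples r N) = 0"
  obtains K where "K \<ge> 0" "\<And>n. n \<ge> r \<Longrightarrow>
      integrable (tuples n N) (\<lambda>z. sqrt n / r * (1 / (n choose r) * (\<Sum>i\<in>inc_maps r n. F (\<lambda>k\<in>{..<r}. z (i k)))) - 1 / sqrt n * (\<Sum>l<n. hajek_kernel r N F (z l)))"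
    "\<And>n. n \<ge> r \<Longrightarrow>
      (\<integral>z. \<bar>sqrt n / r * (1 / (n choose r) * (\<Sum>i\<in>inc_maps r n. F (\<lambda>k\<in>{..<r}. z (i k)))) - 1 / sqrt n * (\<Sum>l<n. hajek_kernel r N F (z l))\<bar> \<partial>tuples n N) \<le> K / sqrt n"
proof -
  let ?g = "hajek_kernel r N F"
  interpret P: prob_space "tuples r N" by (intro prob_space_PiM N)
  have Fi: "integrable (tuples r N) F"
    using P.integrable_lower_power[OF F F2, of 1] by (intro integrable_abs_cancel[OF _ F]) simp
  have gm[measurable]: "?g \<in> borel_measurable N" by (rule hajek_kernel_measurable[OF N r F])
  have g2: "integrable N (\<lambda>z. (?g z)\<^sup>2)" using hajek_kernel_power[OF N r F F2] by simp
  define D where "D y = F y - (\<Sum>k<r. ?g (y k))" for y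
  have Dm[measurable]: "D \<in> borel_measurable (tuples r N)" unfolding D_def by measurable
  have D2: "integrable (tuples r N) (\<lambda>y. (D y)\<^sup>2)"
  proof (rule Bochner_Integration.integrable_bound)
    show "integrable (tuples r N) (\<lambda>y. 2 * (\<bar>F y\<bar> ^ 2) + 2 * (real r * (\<Sum>k<r. (?g (y k))\<^sup>2)))"
      using integrable_PiM_component(1)[OF N _ g2, of _ "{..<r}"] F2
      by (intro Bochner_Integration.integrable_add integrable_mult_right Bochner_Integration.integrable_sum) auto
    show "AE y in tuples r N. norm ((D y)\<^sup>2) \<le> norm (2 * (\<bar>F y\<bar> ^ 2) + 2 * (real r * (\<Sum>k<r. (?g (y k))\<^sup>2)))"
    proof (rule AE_I2)
      fix y
      have "(\<Sum>k<r. ?g (y k))\<^sup>2 \<le> real r * (\<Sum>k<r. (?g (y k))\<^sup>2)"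
        using Cauchy_Schwarz_ineq_sum[of "\<lambda>_. 1" "\<lambda>k. ?g (y k)" "{..<r}"] by simp
      moreover have "(a - b)\<^sup>2 \<le> 2 * a\<^sup>2 + 2 * b\<^sup>2" for a b :: real
        using zero_le_power2[of "a + b"] by (simp add: power2_eq_square algebra_simps)
      then have "(D y)\<^sup>2 \<le> 2 * (F y)\<^sup>2 + 2 * (\<Sum>k<r. ?g (y k))\<^sup>2" unfolding D_def .
      ultimately have "(D y)\<^sup>2 \<le> 2 * (F y)\<^sup>2 + 2 * (real r * (\<Sum>k<r. (?g (y k))\<^sup>2))" by linarith
      then show "norm ((D y)\<^sup>2) \<le> norm (2 * (\<bar>F y\<bar> ^ 2) + 2 * (real r * (\<Sum>k<r. (?g (y k))\<^sup>2)))"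
        by (simp add: abs_of_nonneg sum_nonneg)
    qed
  qed measurable
  have deg: "degenerate_kernel r N D" unfolding D_def by (rule hoeffding_degenerate[OF N r Fi sym mean])
  define V where "V = (\<integral>y. (D y)\<^sup>2 \<partial>tuples r N)"
  have V: "V \<ge> 0" by (simp add: V_def)
  \<comment> \<open>From \<open>n / (r * b)\<^sup>2 * (2 * r ^ 4 * b\<^sup>2 * V / n\<^sup>2) = 2 *
    r\<^sup>2 * V / n\<close>, where \<open>b = n choose r\<close>.\<close>
  define K where "K = sqrt (2 * real r ^ 2 * V)"
  let ?R = "\<lambda>n z. sqrt n / r * (1 / (n choose r) * (\<Sum>i\<in>inc_maps r n. F (\<lambda>k\<in>{..<r}. z (i k)))) - 1 / sqrt n * (\<Sum>l<n. ?g (z l))"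
  have main: "integrable (tuples n N) (?R n) \<and> (\<integral>z. \<bar>?R n z\<bar> \<partial>tuples n N) \<le> K / sqrt n" if n: "n \<ge> r" for n
  proof -
    interpret Pn: prob_space "tuples n N" by (intro prob_space_PiM N)
    define b where "b = real (n choose r)"
    have b: "b > 0" using n by (simp add: b_def zero_less_binomial)
    have n0: "real n > 0" "real r > 0" using n r by auto
    define S where "S z = (\<Sum>i\<in>inc_maps r n. D (\<lambda>k\<in>{..<r}. z (i k)))" for z
    note S2 = degenerate_sum_second_moment[OF N r n Dm D2 deg, folded S_def V_def]
    \<comment> \<open>This identity makes the weight of each projection in the normalised statistic
      exactly \<open>1 / sqrt n\<close>.\<close>
    have "n * ((n - 1) choose (r - 1)) = r * (n choose r)" using r n times_binomial_minus1_eq[of r n] by simp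
    then have nb: "real n * real ((n - 1) choose (r - 1)) = real r * b" unfolding b_def by (simp only: of_nat_mult[symmetric])
    define T where "T z = (\<Sum>i\<in>inc_maps r n. F (\<lambda>k\<in>{..<r}. z (i k)))" for z
    define G where "G z = (\<Sum>l<n. ?g (z l))" for z
    have Rz: "?R n z = sqrt n / (r * b) * S z" for z
    proof -
      have "S z = (\<Sum>i\<in>inc_maps r n. F (\<lambda>k\<in>{..<r}. z (i k)) - (\<Sum>s<r. ?g (z (i s))))"
        unfolding S_def D_def by (intro sum.cong refl arg_cong2[where f="(-)"]) simp_all
      also have "\<dots> = T z - (\<Sum>i\<in>inc_maps r n. \<Sum>s<r. ?g (z (i s)))"
        unfolding T_def by (rule sum_subtractf)
      also have "(\<Sum>i\<in>inc_maps r n. \<Sum>s<r. ?g (z (i s))) = real ((n - 1) choose (r - 1)) * G z"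
        unfolding G_def by (rule sum_inc_maps_additive[OF r])
      also have "real ((n - 1) choose (r - 1)) = real r * b / real n" using nb n0 by (simp add: field_simps)
      finally have "sqrt n / (r * b) * S z = sqrt n / r * (1 / b * T z) - sqrt n / (r * b) * (real r * b / real n) * G z"
        by (simp add: right_diff_distrib)
      also have "sqrt n / (r * b) * (real r * b / real n) = sqrt n / n" using n0 b by simp
      also have "\<dots> = 1 / sqrt n" using n0 real_div_sqrt[of n] by (metis inverse_divide inverse_eq_divide less_imp_le)
      finally show ?thesis by (simp only: b_def T_def G_def)
    qed
    have Sm[measurable]: "S \<in> borel_measurable (tuples n N)"
      unfolding S_def using inc_mapsD(2) by (intro borel_measurable_sum measurable_compose[OF measurable_PiM_reindex Dm]) auto
    have Rm: "?R n \<in> borel_measurable (tuples n N)" unfolding Rz by measurable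
    have R2: "integrable (tuples n N) (\<lambda>z. \<bar>?R n z\<bar> ^ 2)" unfolding Rz power2_abs power_mult_distrib using S2(1) by simp
    have R1: "integrable (tuples n N) (?R n)"
      using Pn.integrable_lower_power[OF Rm R2, of 1] by (intro integrable_abs_cancel[OF _ Rm]) simp
    have "(\<integral>z. \<bar>?R n z\<bar> \<partial>tuples n N)\<^sup>2 \<le> (\<integral>z. \<bar>?R n z\<bar> ^ 2 \<partial>tuples n N)"
      using Pn.power_expectation_le[of "\<lambda>z. \<bar>?R n z\<bar>" 2] Rm R2 by simp
    also have "\<dots> = n / (r * b)\<^sup>2 * (\<integral>z. (S z)\<^sup>2 \<partial>tuples n N)"
      unfolding Rz using n0 by (simp add: power_mult_distrib power_divide)
    also have "\<dots> = ((\<integral>z. (S z)\<^sup>2 \<partial>tuples n N) * (real n)\<^sup>2) / ((r * b)\<^sup>2 * n)"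
      using n0 by (simp add: power2_eq_square mult_ac)
    also have "\<dots> \<le> (2 * real r ^ 4 * b\<^sup>2 * V) / ((r * b)\<^sup>2 * n)"
      using S2(2) n0 unfolding b_def by (intro divide_right_mono) auto
    also have "\<dots> = (K / sqrt n)\<^sup>2"
    proof -
      have r4: "real r ^ 4 = (real r)\<^sup>2 * (real r)\<^sup>2" by (simp add: power2_eq_square eval_nat_numeral)
      have "2 * real r ^ 4 * b\<^sup>2 * V / ((r * b)\<^sup>2 * n) = 2 * (real r)\<^sup>2 * V / n"
        unfolding r4 power_mult_distrib power2_eq_square using n0 b by simp
      also have "\<dots> = (K / sqrt n)\<^sup>2" using V n0 by (simp add: K_def power_divide)
      finally show ?thesis .
    qed
    finally have "(\<integral>z. \<bar>?R n z\<bar> \<partial>tuples n N) \<le> K / sqrt n"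
      by (rule power2_le_imp_le) (simp add: K_def V)
    then show ?thesis using R1 by blast
  qed
  show ?thesis by (rule that[of K]) (use main V in \<open>auto simp: K_def\<close>)
qed

section \<open>Roots of positive definite matrices\<close>

lemma inner_symmetric_matrix:
  fixes S :: "real^'d^'d"
  assumes "transpose S = S"
  shows "(S *v x) \<bullet> y = x \<bullet> (S *v y)"
  by (metis assms dot_lmul_matrix transpose_matrix_vector)

text \<open>Eigenvectors of distinct eigenvalues are orthogonal and hence independent. Finiteness is
  what gives \<open>Min\<close> in \<open>smallest_eigenvalue\<close> its meaning.\<close>

lemma finite_eigenvalues_symmetric:
  fixes S :: "real^'d^'d"
  assumes sym: "transpose S = S"
  shows "finite (eigenvalues S)"
proof -
  define v where "v c = (SOME v. v \<noteq> 0 \<and> S *v v = c *\<^sub>R v)" for c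
  have v: "v c \<noteq> 0" "S *v v c = c *\<^sub>R v c" if "c \<in> eigenvalues S" for c
    using someI_ex[of "\<lambda>v. v \<noteq> 0 \<and> S *v v = c *\<^sub>R v"] that unfolding v_def eigenvalues_def by blast+
  have orth: "v c \<bullet> v d = 0" if "c \<in> eigenvalues S" "d \<in> eigenvalues S" "c \<noteq> d" for c d
  proof -
    have "c * (v c \<bullet> v d) = d * (v c \<bullet> v d)"
      using inner_symmetric_matrix[OF sym, of "v c" "v d"] v[OF that(1)] v[OF that(2)] by simp
    then show ?thesis using that(3) by simp
  qed
  have inj: "inj_on v (eigenvalues S)"
  proof (rule inj_onI, rule ccontr)
    fix c d assume cd: "c \<in> eigenvalues S" "d \<in> eigenvalues S" "v c = v d" "c \<noteq> d"
    then have "v c \<bullet> v c = 0" using orth[of c d] by simp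
    then show False using v(1)[OF cd(1)] by simp
  qed
  have "pairwise orthogonal (v ` eigenvalues S)"
  proof (rule pairwiseI)
    fix x y assume "x \<in> v ` eigenvalues S" "y \<in> v ` eigenvalues S" "x \<noteq> y"
    then obtain c d where "c \<in> eigenvalues S" "d \<in> eigenvalues S" "x = v c" "y = v d" "c \<noteq> d" by blast
    then show "orthogonal x y" using orth[of c d] by (simp add: orthogonal_def)
  qed
  moreover have "0 \<notin> v ` eigenvalues S" using v(1) by (metis imageE)
  ultimately have "independent (v ` eigenvalues S)" by (rule pairwise_orthogonal_independent)
  then have "finite (v ` eigenvalues S)" by (rule independent_imp_finite)
  then show ?thesis using inj by (rule finite_imageD)
qed

text \<open>A minimiser of the Rayleigh quotient is an eigenvector.\<close>

lemma rayleigh_min_eigenvalue: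
  fixes S :: "real^'d^'d"
  assumes sym: "transpose S = S"
  obtains c where "c \<in> eigenvalues S" "\<And>x. x \<bullet> (S *v x) \<ge> c * (x \<bullet> x)"
proof -
  let ?q = "\<lambda>x. x \<bullet> (S *v x)"
  have "continuous_on (sphere 0 1) ?q" by (intro continuous_intros linear_continuous_on matrix_vector_mul_bounded_linear)
  moreover have "sphere 0 1 \<noteq> ({} :: (real^'d) set)" by (metis norm_axis_1 empty_iff mem_sphere_0)
  ultimately obtain u where u: "norm u = 1" and umin: "\<And>x. norm x = 1 \<Longrightarrow> ?q u \<le> ?q x"
    using continuous_attains_inf[OF compact_sphere, of 0 1 ?q] by (auto simp: dist_norm)
  define c where "c = ?q u"
  have low: "?q x \<ge> c * (x \<bullet> x)" for x
  proof (cases "x = 0")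
    case False
    have "c \<le> ?q ((1 / norm x) *\<^sub>R x)" unfolding c_def using False by (intro umin) simp
    also have "\<dots> = ?q x / (norm x)\<^sup>2" by (simp add: matrix_vector_mult_scaleR power2_eq_square)
    finally show ?thesis using False by (simp add: field_simps power2_norm_eq_inner[symmetric])
  qed simp
  have "S *v u = c *\<^sub>R u"
  proof (rule ccontr)
    define w where "w = S *v u - c *\<^sub>R u"
    assume "S *v u \<noteq> c *\<^sub>R u"
    then have w0: "w \<bullet> w > 0" by (simp add: w_def)
    have uu: "u \<bullet> u = 1" using u by (simp add: norm_eq_1)
    define b where "b = ?q w - c * (w \<bullet> w)"
    have b0: "b \<ge> 0" using low[of w] by (simp add: b_def)
    have cross: "u \<bullet> (S *v w) = w \<bullet> (S *v u)" using inner_symmetric_matrix[OF sym, of u w] by (simp add: inner_commute)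
    have ex: "?q (u - t *\<^sub>R w) - c * ((u - t *\<^sub>R w) \<bullet> (u - t *\<^sub>R w)) = - 2 * t * (w \<bullet> w) + t\<^sup>2 * b" for t
    proof -
      have ww: "w \<bullet> w = w \<bullet> (S *v u) - c * (w \<bullet> u)" by (subst (2) w_def) (simp add: inner_diff_right)
      show ?thesis
        unfolding b_def
        by (simp add: ww matrix_vector_mult_diff_distrib matrix_vector_mult_scaleR inner_diff_left inner_diff_right cross power2_eq_square uu c_def[symmetric])
          (simp add: algebra_simps inner_commute ww)
    qed
    \<comment> \<open>A positive \<open>t\<close> with \<open>t * b < 2 * (w \<bullet> w)\<close>
      makes the form in \<open>ex\<close> negative against \<open>low\<close>; the
      \<open>+ 1\<close> covers \<open>b = 0\<close>.\<close>
    define t where "t = (w \<bullet> w) / (b + 1)"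
    have t: "t > 0" using w0 b0 by (simp add: t_def)
    have "0 \<le> - 2 * t * (w \<bullet> w) + t\<^sup>2 * b" using low[of "u - t *\<^sub>R w"] unfolding ex[symmetric] by simp
    then have "2 * (w \<bullet> w) \<le> t * b" using t by (simp add: power2_eq_square)
    also have "t * b = (w \<bullet> w) * (b / (b + 1))" by (simp add: t_def)
    also have "\<dots> \<le> (w \<bullet> w) * 1" using w0 b0 by (intro mult_left_mono) auto
    finally show False using w0 by simp
  qed
  moreover have "u \<noteq> 0" using u by auto
  ultimately have "c \<in> eigenvalues S" by (auto simp: eigenvalues_def)
  then show ?thesis using that low by blast
qed

lemma smallest_eigenvalue_pos_imp_pos_def:
  fixes S :: "real^'d^'d"
  assumes sym: "transpose S = S" and pos: "smallest_eigenvalue S > 0" and x: "x \<noteq> 0"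
  shows "x \<bullet> (S *v x) > 0"
proof -
  obtain c where c: "c \<in> eigenvalues S" "\<And>x. x \<bullet> (S *v x) \<ge> c * (x \<bullet> x)" using rayleigh_min_eigenvalue[OF sym] by blast
  have "smallest_eigenvalue S \<le> c"
    unfolding smallest_eigenvalue_def using finite_eigenvalues_symmetric[OF sym] c(1) by (rule Min_le)
  then have "c * (x \<bullet> x) > 0" using pos x by simp
  then show ?thesis using c(2)[of x] by linarith
qed

text \<open>Gram-Schmidt with respect to the inner product given by \<open>S\<close>.\<close>

lemma pos_def_orthonormal_family:
  fixes S :: "real^'d^'d"
  assumes sym: "transpose S = S" and pd: "\<And>x. x \<noteq> 0 \<Longrightarrow> x \<bullet> (S *v x) > 0" and "finite I"
  shows "\<exists>b :: 'd \<Rightarrow> real^'d. \<forall>i\<in>I. \<forall>j\<in>I. b i \<bullet> (S *v b j) = (if i = j then 1 else 0)"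
  using \<open>finite I\<close>
proof (induction I)
  case (insert k I)
  then obtain b :: "'d \<Rightarrow> real^'d" where b: "\<And>i j. i \<in> I \<Longrightarrow> j \<in> I \<Longrightarrow> b i \<bullet> (S *v b j) = (if i = j then 1 else 0)" by blast
  have "dim (b ` I) \<le> card (b ` I)" by (rule dim_le_card') (simp add: insert)
  also have "\<dots> \<le> card I" by (rule card_image_le) (fact insert)
  also have "\<dots> < CARD('d)" using insert by (intro psubset_card_mono) auto
  finally have "span (b ` I) \<noteq> UNIV" using dim_UNIV by (metis dim_span less_irrefl DIM_cart DIM_real mult.right_neutral)
  then obtain x where x: "x \<notin> span (b ` I)" by auto
  define y where "y = x - (\<Sum>i\<in>I. (b i \<bullet> (S *v x)) *\<^sub>R b i)"
  have y0: "y \<noteq> 0"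
  proof
    assume "y = 0"
    then have "x = (\<Sum>i\<in>I. (b i \<bullet> (S *v x)) *\<^sub>R b i)" by (simp add: y_def)
    also have "\<dots> \<in> span (b ` I)" by (intro span_sum span_scale span_base) auto
    finally show False using x by simp
  qed
  have yo: "b i \<bullet> (S *v y) = 0" if i: "i \<in> I" for i
  proof -
    have "b i \<bullet> (S *v y) = b i \<bullet> (S *v x) - (\<Sum>j\<in>I. (b j \<bullet> (S *v x)) * (b i \<bullet> (S *v b j)))"
      by (simp add: y_def matrix_vector_mult_diff_distrib inner_diff_right linear_sum[OF matrix_vector_mul_linear]
          matrix_vector_mult_scaleR inner_sum_right)
    also have "(\<Sum>j\<in>I. (b j \<bullet> (S *v x)) * (b i \<bullet> (S *v b j))) = (\<Sum>j\<in>I. if i = j then b j \<bullet> (S *v x) else 0)"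
      using b i by (intro sum.cong) auto
    finally show ?thesis using i insert by simp
  qed
  define e where "e = y \<bullet> (S *v y)"
  have e: "e > 0" unfolding e_def by (rule pd[OF y0])
  define b' where "b' = b(k := (1 / sqrt e) *\<^sub>R y)"
  have "b' i \<bullet> (S *v b' j) = (if i = j then 1 else 0)" if ij: "i \<in> insert k I" "j \<in> insert k I" for i j
  proof -
    have yi: "y \<bullet> (S *v b i) = 0" if "i \<in> I" for i using yo[OF that] inner_symmetric_matrix[OF sym, of y "b i"] by (simp add: inner_commute)
    consider "i = k" "j = k" | "i = k" "j \<in> I" | "i \<in> I" "j = k" | "i \<in> I" "j \<in> I" using ij by blast
    then show ?thesis
    proof cases
      case 1
      then show ?thesis using e by (simp add: b'_def matrix_vector_mult_scaleR e_def[symmetric])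
    next
      case 2
      then show ?thesis using insert yi by (auto simp: b'_def matrix_vector_mult_scaleR)
    next
      case 3
      then show ?thesis using insert yo by (auto simp: b'_def matrix_vector_mult_scaleR)
    next
      case 4
      then show ?thesis using insert b by (auto simp: b'_def)
    qed
  qed
  then show ?case by blast
qed simp

text \<open>The rows of \<open>B\<close> are orthonormal for the form of \<open>S\<close>, so
  \<open>S ** transpose B\<close> inverts \<open>B\<close>. With \<open>A\<close> this inverse,
  \<open>A ** transpose A = (A ** B) ** S = S\<close>.\<close>

lemma pos_def_root:
  fixes S :: "real^'d^'d"
  assumes sym: "transpose S = S" and pd: "\<And>x. x \<noteq> 0 \<Longrightarrow> x \<bullet> (S *v x) > 0"
  shows "\<exists>A :: real^'d^'d. A ** transpose A = S"
proof -
  obtain b :: "'d \<Rightarrow> real^'d" where b: "\<And>i j. b i \<bullet> (S *v b j) = (if i = j then 1 else 0)"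
    using pos_def_orthonormal_family[OF sym pd finite[of UNIV]] by auto
  define B where "B = (\<chi> i. b i)"
  have "(B ** S ** transpose B) $ i $ j = b i \<bullet> (S *v b j)" for i j
    unfolding B_def by (simp add: matrix_matrix_mult_def matrix_vector_mult_def transpose_def inner_vec_def sum_distrib_left sum_distrib_right mult_ac)
      (subst sum.swap, simp)
  then have BSB: "B ** S ** transpose B = mat 1" by (simp add: b vec_eq_iff mat_def)
  then have "B ** (S ** transpose B) = mat 1" by (simp add: matrix_mul_assoc)
  then have inv: "S ** transpose B ** B = mat 1" using matrix_left_right_inverse by blast
  define A where "A = S ** transpose B"
  have AB: "A ** B = mat 1" using inv by (simp add: A_def)
  then have BA: "B ** A = mat 1" using matrix_left_right_inverse by blast
  have "A ** transpose A = A ** (B ** transpose S)" by (simp add: A_def matrix_transpose_mul)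
  also have "\<dots> = S" by (simp add: sym matrix_mul_assoc AB)
  finally show ?thesis by blast
qed

text \<open>For an arbitrary root \<open>A\<close>, because \<open>centered_gaussian\<close> chooses
  one about which nothing else is known. A right inverse of \<open>A\<close> is read off the inverse
  \<open>C\<close> of \<open>A ** transpose A\<close>.\<close>

lemma pos_def_root_inverse:
  fixes S A :: "real^'d^'d"
  assumes A: "A ** transpose A = S" and pd: "\<And>x. x \<noteq> 0 \<Longrightarrow> x \<bullet> (S *v x) > 0"
  obtains B where "A ** B = mat 1" "B ** A = mat 1" "B ** S ** transpose B = mat 1"
proof -
  have "inj ((*v) S)"
  proof (rule injI, rule ccontr)
    fix x y assume "S *v x = S *v y" "x \<noteq> y"
    then have "(x - y) \<bullet> (S *v (x - y)) = 0" by (simp add: matrix_vector_mult_diff_distrib)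
    then show False using pd[of "x - y"] \<open>x \<noteq> y\<close> by simp
  qed
  then obtain C where "C ** S = mat 1" using matrix_left_invertible_injective[of S] by blast
  then have "S ** C = mat 1" using matrix_left_right_inverse by blast
  then have 1: "A ** (transpose A ** C) = mat 1" unfolding A[symmetric] by (simp add: matrix_mul_assoc)
  define B where "B = transpose A ** C"
  have AB: "A ** B = mat 1" using 1 by (simp add: B_def)
  then have BA: "B ** A = mat 1" using matrix_left_right_inverse by blast
  have "B ** S ** transpose B = (B ** A) ** transpose (B ** A)"
    unfolding A[symmetric] by (simp add: matrix_transpose_mul matrix_mul_assoc)
  then have "B ** S ** transpose B = mat 1" by (simp add: BA transpose_mat)
  then show ?thesis using that AB BA by blast
qed

section \<open>The Wasserstein bound\<close>

text \<open>Integrating out the last coordinate is one application of the operator to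
  \<open>F\<close>; hence the induction with \<open>F\<close> free.\<close>

lemma sum_law_smooth_by:
  fixes \<xi> :: "'z \<Rightarrow> real^'d" and F :: "real^'d \<Rightarrow> real"
  assumes N: "prob_space N" and \<xi>[measurable]: "\<xi> \<in> borel_measurable N" and i\<xi>: "integrable N (\<lambda>z. norm (\<xi> z))"
    and F: "L-lipschitz_on UNIV F"
  shows "integrable (tuples n N) (\<lambda>z. F (x + (\<Sum>l<n. \<xi> (z l))))"
    "(\<integral>z. F (x + (\<Sum>l<n. \<xi> (z l))) \<partial>tuples n N) = (smooth_by (distr N borel \<xi>) ^^ n) F x"
proof -
  interpret N: prob_space N by fact
  interpret product_sigma_finite "\<lambda>_::nat. N" ..
  let ?\<mu> = "distr N borel \<xi>"
  have \<mu>: "finite_mean_law ?\<mu>"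
    using i\<xi> by (auto simp: finite_mean_law_def integrable_distr_eq intro!: N.prob_space_distr)
  have int: "integrable (tuples n N) (\<lambda>z. F (x + (\<Sum>l<n. \<xi> (z l))))" if F: "L-lipschitz_on UNIV F" for n x and F :: "real^'d \<Rightarrow> real"
  proof -
    have [measurable]: "F \<in> borel_measurable borel" by (rule lipschitz_borel_measurable[OF F])
    have L: "L \<ge> 0" by (rule lipschitz_on_nonneg[OF F])
    interpret P: prob_space "tuples n N" by (intro prob_space_PiM N)
    show ?thesis
    proof (rule Bochner_Integration.integrable_bound[of _ "\<lambda>z. \<bar>F x\<bar> + L * (\<Sum>l<n. norm (\<xi> (z l)))"])
      show "integrable (tuples n N) (\<lambda>z. \<bar>F x\<bar> + L * (\<Sum>l<n. norm (\<xi> (z l))))"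
        using integrable_PiM_component(1)[OF N _ i\<xi>, of _ "{..<n}"]
        by (intro Bochner_Integration.integrable_add integrable_mult_right Bochner_Integration.integrable_sum) auto
      show "AE z in tuples n N. norm (F (x + (\<Sum>l<n. \<xi> (z l)))) \<le> norm (\<bar>F x\<bar> + L * (\<Sum>l<n. norm (\<xi> (z l))))"
      proof (rule AE_I2)
        fix z
        have "\<bar>F (x + (\<Sum>l<n. \<xi> (z l))) - F x\<bar> \<le> L * norm (\<Sum>l<n. \<xi> (z l))"
          using lipschitz_abs_le[OF F, of "x + (\<Sum>l<n. \<xi> (z l))" x] by (simp add: dist_norm)
        also have "\<dots> \<le> L * (\<Sum>l<n. norm (\<xi> (z l)))" using L by (intro mult_left_mono norm_sum)
        finally have "\<bar>F (x + (\<Sum>l<n. \<xi> (z l)))\<bar> \<le> \<bar>F x\<bar> + L * (\<Sum>l<n. norm (\<xi> (z l)))" by linarith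
        then show "norm (F (x + (\<Sum>l<n. \<xi> (z l)))) \<le> norm (\<bar>F x\<bar> + L * (\<Sum>l<n. norm (\<xi> (z l))))" by simp
      qed
    qed measurable
  qed
  then show "integrable (tuples n N) (\<lambda>z. F (x + (\<Sum>l<n. \<xi> (z l))))" using F .
  show "(\<integral>z. F (x + (\<Sum>l<n. \<xi> (z l))) \<partial>tuples n N) = (smooth_by ?\<mu> ^^ n) F x"
    using F
  proof (induction n arbitrary: F)
    case 0
    interpret P: prob_space "tuples 0 N" by (intro prob_space_PiM N)
    show ?case using P.prob_space by simp
  next
    case (Suc n)
    have [measurable]: "F \<in> borel_measurable borel" by (rule lipschitz_borel_measurable[OF Suc.prems])
    have ii: "integrable (Pi\<^sub>M (insert n {..<n}) (\<lambda>_. N)) (\<lambda>z. F (x + (\<Sum>l<Suc n. \<xi> (z l))))"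
      using int[OF Suc.prems, of "Suc n" x] by (simp only: lessThan_Suc)
    have "(\<integral>z. F (x + (\<Sum>l<Suc n. \<xi> (z l))) \<partial>tuples (Suc n) N)
        = (\<integral>z. (\<integral>y. F (x + (\<Sum>l<Suc n. \<xi> ((z(n := y)) l))) \<partial>N) \<partial>tuples n N)"
      unfolding lessThan_Suc[of n] by (rule product_integral_insert[OF finite_lessThan _ ii[unfolded lessThan_Suc]]) simp
    also have "\<dots> = (\<integral>z. smooth_by ?\<mu> F (x + (\<Sum>l<n. \<xi> (z l))) \<partial>tuples n N)"
      by (simp add: smooth_by_def integral_distr add.assoc)
    also have "\<dots> = (smooth_by ?\<mu> ^^ n) (smooth_by ?\<mu> F) x"
      by (rule Suc.IH[OF smooth_by_lipschitz[OF \<mu> Suc.prems]])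
    finally show ?case by (simp add: funpow_swap1)
  qed
qed

section \<open>From the sample space to the product space\<close>

lemma iid_tuple_law:
  assumes M: "prob_space M" and iid: "iid M S Z" and n: "n \<ge> 1"
  shows "(\<lambda>\<omega>. \<lambda>l\<in>{..<n}. Z l \<omega>) \<in> measurable M (tuples n (distr M S (Z 0)))"
    "distr M (tuples n (distr M S (Z 0))) (\<lambda>\<omega>. \<lambda>l\<in>{..<n}. Z l \<omega>) = tuples n (distr M S (Z 0))"
proof -
  interpret prob_space M by fact
  let ?N = "distr M S (Z 0)"
  have ind: "indep_vars (\<lambda>_. S) Z UNIV" and eq: "distr M S (Z i) = ?N" for i using iid unfolding iid_def by blast+
  have Zm[measurable]: "Z i \<in> measurable M S" for i using ind unfolding indep_vars_def by blast
  have s: "sets (tuples n ?N) = sets (tuples n S)" by (intro sets_PiM_cong) auto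
  show "(\<lambda>\<omega>. \<lambda>l\<in>{..<n}. Z l \<omega>) \<in> measurable M (tuples n ?N)"
    by (intro measurable_restrict) simp
  have ne: "{..<n} \<noteq> {}" using n by (simp add: lessThan_empty_iff)
  have "indep_vars (\<lambda>_. S) Z {..<n}" by (rule indep_vars_subset[OF ind]) auto
  then have "distr M (tuples n S) (\<lambda>\<omega>. \<lambda>l\<in>{..<n}. Z l \<omega>) = Pi\<^sub>M {..<n} (\<lambda>i. distr M S (Z i))"
    by (rule iffD1[OF indep_vars_iff_distr_eq_PiM[where M'="\<lambda>_. S", OF ne Zm]])
  also have "\<dots> = tuples n ?N" by (rule arg_cong[where f="Pi\<^sub>M {..<n}"]) (rule ext, rule eq)
  also have "distr M (tuples n S) (\<lambda>\<omega>. \<lambda>l\<in>{..<n}. Z l \<omega>) = distr M (tuples n ?N) (\<lambda>\<omega>. \<lambda>l\<in>{..<n}. Z l \<omega>)"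
    by (rule distr_cong) (simp_all add: s)
  finally show "distr M (tuples n ?N) (\<lambda>\<omega>. \<lambda>l\<in>{..<n}. Z l \<omega>) = tuples n ?N" .
qed

lemma iid_transfer:
  fixes H :: "(nat \<Rightarrow> 'z) \<Rightarrow> 'b :: {banach, second_countable_topology}"
  assumes M: "prob_space M" and iid: "iid M S Z" and n: "n \<ge> 1"
    and H: "H \<in> borel_measurable (tuples n (distr M S (Z 0)))"
  shows "(\<integral>\<omega>. H (\<lambda>l\<in>{..<n}. Z l \<omega>) \<partial>M) = (\<integral>z. H z \<partial>tuples n (distr M S (Z 0)))"
    "integrable M (\<lambda>\<omega>. H (\<lambda>l\<in>{..<n}. Z l \<omega>)) \<longleftrightarrow> integrable (tuples n (distr M S (Z 0))) H"
  using integral_distr[OF iid_tuple_law(1)[OF M iid n] H] integrable_distr_eq[OF iid_tuple_law(1)[OF M iid n] H]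
  unfolding iid_tuple_law(2)[OF M iid n] by simp_all

text \<open>Test both sides on the events \<open>Z 0 \<in> B\<close>. Their indicator depends on
  coordinate \<open>0\<close> only, so it leaves the inner integral when the tuple is split at that
  coordinate.\<close>

lemma cond_exp_hajek_kernel:
  fixes F :: "(nat \<Rightarrow> 'z) \<Rightarrow> real"
  assumes M: "prob_space M" and iid: "iid M S Z" and r: "r \<ge> 1"
    and F: "integrable (tuples r (distr M S (Z 0))) F"
  shows "AE \<omega> in M. real_cond_exp M (vimage_algebra (space M) (Z 0) S) (\<lambda>\<omega>. F (\<lambda>k\<in>{..<r}. Z k \<omega>)) \<omega>
    = hajek_kernel r (distr M S (Z 0)) F (Z 0 \<omega>)"
proof -
  interpret M: prob_space M by fact
  let ?N = "distr M S (Z 0)"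
  let ?G = "vimage_algebra (space M) (Z 0) S"
  let ?g = "hajek_kernel r ?N F"
  have Zm[measurable]: "Z 0 \<in> measurable M S" using iid unfolding iid_def M.indep_vars_def by blast
  interpret N: prob_space ?N by (rule M.prob_space_distr) simp
  have Zsp: "Z 0 \<in> space M \<rightarrow> space S" using measurable_space[OF Zm] by auto
  have sub: "subalgebra M ?G"
    unfolding subalgebra_def sets_vimage_algebra2[OF Zsp] by auto
  interpret finite_measure_subalgebra M ?G by unfold_locales (rule sub)
  have 0: "0 \<in> {..<r}" using r by auto
  note g = hajek_kernel_integral[OF N.prob_space_axioms r F]
  have Fm: "F \<in> borel_measurable (tuples r ?N)" using F by simp
  have gm[measurable]: "?g \<in> borel_measurable S" using g(1) by simp
  show ?thesis
  proof (rule real_cond_exp_charact)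
    show "integrable M (\<lambda>\<omega>. F (\<lambda>k\<in>{..<r}. Z k \<omega>))" using iid_transfer(2)[OF M iid r Fm] F by simp
    show "integrable M (\<lambda>\<omega>. ?g (Z 0 \<omega>))" using g(1) by (subst (asm) integrable_distr_eq) simp_all
    show "(\<lambda>\<omega>. ?g (Z 0 \<omega>)) \<in> borel_measurable ?G"
      by (rule measurable_compose[OF measurable_vimage_algebra1[OF Zsp] gm])
    fix A assume "A \<in> sets ?G"
    then obtain B where B[measurable]: "B \<in> sets S" and A: "A = Z 0 -` B \<inter> space M"
      unfolding sets_vimage_algebra2[OF Zsp] by auto
    let ?H = "\<lambda>y. indicator B (y 0) * F y"
    have Hi: "integrable (tuples r ?N) ?H"
    proof (rule Bochner_Integration.integrable_bound[OF F])
      show "?H \<in> borel_measurable (tuples r ?N)"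
        using 0 Fm by (intro borel_measurable_times measurable_compose[OF measurable_component_singleton]) auto
    qed (auto simp: indicator_def)
    have "(\<integral>\<omega>\<in>A. F (\<lambda>k\<in>{..<r}. Z k \<omega>) \<partial>M) = (\<integral>\<omega>. ?H (\<lambda>k\<in>{..<r}. Z k \<omega>) \<partial>M)"
      unfolding set_lebesgue_integral_def using 0 by (intro Bochner_Integration.integral_cong refl) (auto simp: A indicator_def)
    also have "\<dots> = (\<integral>y. ?H y \<partial>tuples r ?N)" using Hi by (intro iid_transfer(1)[OF M iid r]) simp
    also have "\<dots> = (\<integral>z. (\<integral>y. ?H (y(0 := z)) \<partial>tuples r ?N) \<partial>?N)"
      by (rule integral_PiM_section(2)[OF N.prob_space_axioms finite_lessThan 0 Hi, symmetric])
    also have "\<dots> = (\<integral>z. indicator B z * ?g z \<partial>?N)" by (simp add: hajek_kernel_def)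
    also have "\<dots> = (\<integral>\<omega>. indicator B (Z 0 \<omega>) * ?g (Z 0 \<omega>) \<partial>M)" by (subst integral_distr) simp_all
    also have "\<dots> = (\<integral>\<omega>\<in>A. ?g (Z 0 \<omega>) \<partial>M)"
      unfolding set_lebesgue_integral_def by (intro Bochner_Integration.integral_cong refl) (auto simp: A indicator_def)
    finally show "(\<integral>\<omega>\<in>A. F (\<lambda>k\<in>{..<r}. Z k \<omega>) \<partial>M) = (\<integral>\<omega>\<in>A. ?g (Z 0 \<omega>) \<partial>M)" .
  qed
qed

lemma norm_cube_le:
  fixes x :: "real^'d"
  shows "norm x ^ 3 \<le> real CARD('d) ^ 3 * (\<Sum>i\<in>UNIV. \<bar>x $ i\<bar> ^ 3)"
proof -
  define m where "m = Max (range (\<lambda>i. \<bar>x $ i\<bar>))"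
  have "m \<in> range (\<lambda>i. \<bar>x $ i\<bar>)" unfolding m_def by (intro Max_in) auto
  then obtain k where k: "m = \<bar>x $ k\<bar>" by auto
  have "norm x \<le> (\<Sum>i\<in>UNIV. \<bar>x $ i\<bar>)" by (rule norm_le_l1_cart)
  also have "\<dots> \<le> (\<Sum>i\<in>(UNIV::'d set). m)" unfolding m_def by (intro sum_mono Max_ge) auto
  finally have "norm x \<le> real CARD('d) * m" by simp
  then have "norm x ^ 3 \<le> (real CARD('d) * m) ^ 3" by (intro power_mono) auto
  also have "\<dots> = real CARD('d) ^ 3 * \<bar>x $ k\<bar> ^ 3" by (simp add: power_mult_distrib k)
  also have "\<dots> \<le> real CARD('d) ^ 3 * (\<Sum>i\<in>UNIV. \<bar>x $ i\<bar> ^ 3)"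
    by (intro mult_left_mono member_le_sum) auto
  finally show ?thesis .
qed

lemma isotropic_linear_image:
  fixes g :: "'z \<Rightarrow> real^'d" and B :: "real^'d^'d"
  assumes N: "prob_space N" and g[measurable]: "g \<in> borel_measurable N"
    and g3: "\<And>c. integrable N (\<lambda>z. \<bar>g z $ c\<bar> ^ 3)" and g0: "\<And>c. (\<integral>z. g z $ c \<partial>N) = 0"
    and cov: "\<And>c d. (\<integral>z. g z $ c * g z $ d \<partial>N) = S $ c $ d"
    and B: "B ** S ** transpose B = mat 1"
  shows "isotropic_law (distr N borel (\<lambda>z. B *v g z))" "integrable N (\<lambda>z. norm (B *v g z))"
proof -
  interpret prob_space N by fact
  have gc[measurable]: "(\<lambda>z. g z $ c) \<in> borel_measurable N" for c
    by (rule measurable_compose[OF g]) simp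
  have Bm[measurable]: "(\<lambda>x. B *v x) \<in> borel_measurable borel"
    by (intro borel_measurable_continuous_onI linear_continuous_on matrix_vector_mul_bounded_linear)
  have g1: "integrable N (\<lambda>z. g z $ c)" for c
    using integrable_lower_power[OF gc g3, of 1] by (intro integrable_abs_cancel[OF _ gc]) simp
  have g2: "integrable N (\<lambda>z. g z $ c * g z $ d)" for c d
    using integrable_lower_power[OF gc g3, of 2] by (intro integrable_mult_of_squares) auto
  have n3: "integrable N (\<lambda>z. norm (B *v g z) ^ 3)"
  proof (rule Bochner_Integration.integrable_bound)
    let ?K = "onorm ((*v) B) ^ 3 * real CARD('d) ^ 3"
    show "integrable N (\<lambda>z. ?K * (\<Sum>c\<in>UNIV. \<bar>g z $ c\<bar> ^ 3))"
      by (intro integrable_mult_right Bochner_Integration.integrable_sum g3)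
    show "AE z in N. norm (norm (B *v g z) ^ 3) \<le> norm (?K * (\<Sum>c\<in>UNIV. \<bar>g z $ c\<bar> ^ 3))"
    proof (rule AE_I2)
      fix z
      have "norm (B *v g z) ^ 3 \<le> (onorm ((*v) B) * norm (g z)) ^ 3"
        by (intro power_mono onorm matrix_vector_mul_bounded_linear) auto
      also have "\<dots> \<le> onorm ((*v) B) ^ 3 * (real CARD('d) ^ 3 * (\<Sum>c\<in>UNIV. \<bar>g z $ c\<bar> ^ 3))"
        unfolding power_mult_distrib by (intro mult_left_mono norm_cube_le zero_le_power onorm_pos_le matrix_vector_mul_bounded_linear)
      finally show "norm (norm (B *v g z) ^ 3) \<le> norm (?K * (\<Sum>c\<in>UNIV. \<bar>g z $ c\<bar> ^ 3))"
        by (simp add: mult.assoc)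
    qed
  qed measurable
  have m1: "(\<integral>z. (B *v g z) $ i \<partial>N) = 0" for i
    by (simp add: matrix_vector_mult_def g0 g1)
  have m2: "(\<integral>z. (B *v g z) $ i * (B *v g z) $ j \<partial>N) = (if i = j then 1 else 0)" for i j
  proof -
    have "(\<integral>z. (B *v g z) $ i * (B *v g z) $ j \<partial>N)
        = (\<integral>z. (\<Sum>c\<in>UNIV. \<Sum>d\<in>UNIV. (B $ i $ c * B $ j $ d) * (g z $ c * g z $ d)) \<partial>N)"
      by (intro Bochner_Integration.integral_cong refl) (simp add: matrix_vector_mult_def sum_product mult_ac)
    also have "\<dots> = (\<Sum>c\<in>UNIV. \<Sum>d\<in>UNIV. (B $ i $ c * B $ j $ d) * S $ c $ d)" by (simp add: g2 cov)
    also have "\<dots> = (B ** S ** transpose B) $ i $ j"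
      by (subst sum.swap) (simp add: matrix_matrix_mult_def transpose_def sum_distrib_left sum_distrib_right mult_ac)
    finally show ?thesis by (simp add: B mat_def)
  qed
  show "isotropic_law (distr N borel (\<lambda>z. B *v g z))"
    unfolding isotropic_law_def
    using n3 by (auto simp: integrable_distr_eq integral_distr m1 m2 intro!: prob_space_distr)
  show "integrable N (\<lambda>z. norm (B *v g z))"
    using integrable_lower_power[of "\<lambda>z. norm (B *v g z)" 3 1] n3 by simp
qed

lemma borel_measurable_vec_lambda:
  fixes f :: "'d::finite \<Rightarrow> 'a \<Rightarrow> real"
  assumes "\<And>c. f c \<in> borel_measurable M"
  shows "(\<lambda>x. \<chi> c. f c x) \<in> borel_measurable M"
  by (subst borel_measurable_euclidean_space) (use assms in \<open>auto simp: Basis_vec_def inner_axis\<close>)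

theorem corollary1:
  fixes M :: "'w measure" and S :: "'z measure"
    and Z :: "nat \<Rightarrow> 'w \<Rightarrow> 'z" and r :: nat
    and h :: "(nat \<Rightarrow> 'z) \<Rightarrow> real ^ 'd"
    and X :: "'w \<Rightarrow> real ^ 'd" and \<Sigma> :: "real ^ 'd ^ 'd"
  assumes X_def: "X = (\<lambda>\<omega>. h (\<lambda>k\<in>{..<r}. Z k \<omega>))"
    and Sigma_def: "\<Sigma> = covariance_matrix M (vec_cond_exp M S (Z 0) X)"
    and "prob_space M"
    and "iid M S Z"
    and "r \<ge> 1"
    and "h \<in> borel_measurable (tuples r S)"
    and "symmetric_kernel r S h"
    and "integrable M (\<lambda>\<omega>. norm (X \<omega>) ^ 3)"
    and "(\<integral>\<omega>. X \<omega> \<partial>M) = 0"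
    and "smallest_eigenvalue \<Sigma> > 0"
  shows "\<exists>C::real. \<forall>n\<ge>r.
    wasserstein1 (distr M borel (\<lambda>\<omega>. (sqrt (real n) / real r) *\<^sub>R U_statistic r h Z n \<omega>))
      (centered_gaussian \<Sigma>) \<le> ennreal (C * real n powr (- 1 / 2))"
proof -
  interpret M: prob_space M by fact
  note iid = \<open>iid M S Z\<close> and r = \<open>r \<ge> 1\<close>
  define N where "N = distr M S (Z 0)"
  have Zm[measurable]: "Z i \<in> measurable M S" for i using iid unfolding iid_def M.indep_vars_def by blast
  interpret N: prob_space N unfolding N_def by (rule M.prob_space_distr) simp
  note N = N.prob_space_axioms
  have sN: "sets (tuples n N) = sets (tuples n S)" for n by (intro sets_PiM_cong) (auto simp: N_def)
  have spN: "space (tuples n N) = space (tuples n S)" for n by (rule sets_eq_imp_space_eq[OF sN])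
  note transfer = iid_transfer[OF \<open>prob_space M\<close> iid, folded N_def]

  define F where "F c y = h y $ c" for c y
  have hm: "h \<in> borel_measurable (tuples r N)" using assms(6) by (simp add: measurable_cong_sets[OF sN refl])
  have Fm: "F c \<in> borel_measurable (tuples r N)" for c
    unfolding F_def by (rule measurable_compose[OF hm]) simp
  have Fsym: "symmetric_kernel r N (F c)" for c
    using assms(7) unfolding symmetric_kernel_def spN F_def by metis
  have h3: "integrable (tuples r N) (\<lambda>y. norm (h y) ^ 3)"
    using transfer(2)[OF r, of "\<lambda>y. norm (h y) ^ 3"] hm assms(8) unfolding X_def by simp
  interpret P: prob_space "tuples r N" by (intro prob_space_PiM N)
  have F3: "integrable (tuples r N) (\<lambda>y. \<bar>F c y\<bar> ^ 3)" for c
  proof (rule Bochner_Integration.integrable_bound[OF h3])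
    show "AE y in tuples r N. norm (\<bar>F c y\<bar> ^ 3) \<le> norm (norm (h y) ^ 3)"
      using component_le_norm_cart[of "h _" c] by (auto simp: F_def intro!: power_mono)
    show "(\<lambda>y. \<bar>F c y\<bar> ^ 3) \<in> borel_measurable (tuples r N)"
      using Fm[of c] by measurable
  qed
  have F2: "integrable (tuples r N) (\<lambda>y. \<bar>F c y\<bar> ^ 2)" for c
    by (rule P.integrable_lower_power[OF Fm F3]) simp
  have Fi: "integrable (tuples r N) (F c)" for c
    using P.integrable_lower_power[OF Fm[of c] F3, of 1] by (intro integrable_abs_cancel[OF _ Fm]) simp
  have F0: "(\<integral>y. F c y \<partial>tuples r N) = 0" for c
  proof -
    have "integrable (tuples r N) (\<lambda>y. norm (h y) ^ 1)"
      using P.integrable_lower_power[of "\<lambda>y. norm (h y)" 3 1] hm h3 by simp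
    then have "integrable (tuples r N) h" using hm by (simp add: integrable_norm_iff)
    then have Xi: "integrable M X" using transfer(2)[OF r hm] by (simp add: X_def)
    have "(\<integral>y. F c y \<partial>tuples r N) = (\<integral>\<omega>. X \<omega> $ c \<partial>M)"
      using transfer(1)[OF r Fm[of c]] by (simp add: X_def F_def)
    also have "\<dots> = (\<integral>\<omega>. X \<omega> \<partial>M) $ c" by (rule integral_bounded_linear[OF bounded_linear_vec_nth Xi])
    finally show ?thesis using assms(9) by simp
  qed

  define g where "g c = hajek_kernel r N (F c)" for c
  have gm[measurable]: "g c \<in> borel_measurable N" for c unfolding g_def by (rule hajek_kernel_measurable[OF N r Fm])
  have g3: "integrable N (\<lambda>z. \<bar>g c z\<bar> ^ 3)" for c unfolding g_def by (rule hajek_kernel_power[OF N r Fm F3]) simp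
  have gi: "integrable N (g c)" and g0: "(\<integral>z. g c z \<partial>N) = 0" for c
    using hajek_kernel_integral[OF N r Fi[of c]] F0 by (simp_all add: g_def)
  define gv where "gv z = (\<chi> c. g c z)" for z
  have gv_nth: "gv z $ c = g c z" for z c by (simp add: gv_def)
  have gvm[measurable]: "gv \<in> borel_measurable N"
    unfolding gv_def[abs_def] by (intro borel_measurable_vec_lambda) simp

  \<comment> \<open>Conditional expectations are known almost everywhere only, but they enter
    \<Sigma> through integrals. The centring terms vanish since \<open>g\<close> has mean
    zero.\<close>
  have S_eq: "\<Sigma> $ c $ d = (\<integral>z. g c z * g d z \<partial>N)" for c d
  proof -
    define V where "V = vec_cond_exp M S (Z 0) X"
    have Vc: "AE \<omega> in M. V \<omega> $ c = g c (Z 0 \<omega>)" for c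
      using cond_exp_hajek_kernel[OF \<open>prob_space M\<close> iid r, of "F c"] Fi[of c]
      by (simp add: V_def vec_cond_exp_def X_def F_def g_def N_def)
    have Vm[measurable]: "(\<lambda>\<omega>. V \<omega> $ c) \<in> borel_measurable M" for c
      unfolding V_def vec_cond_exp_def by (simp add: borel_measurable_cond_exp2)
    have gS[measurable]: "g c \<in> borel_measurable S" for c using gm[of c] by (simp add: N_def)
    have gZ: "(\<integral>\<omega>. f (Z 0 \<omega>) \<partial>M) = (\<integral>z. f z \<partial>N)" if [measurable]: "f \<in> borel_measurable S" for f :: "'z \<Rightarrow> real"
      unfolding N_def by (subst integral_distr) simp_all
    have V0: "(\<integral>\<omega>. V \<omega> $ c \<partial>M) = 0" for c
    proof -
      have "(\<integral>\<omega>. V \<omega> $ c \<partial>M) = (\<integral>\<omega>. g c (Z 0 \<omega>) \<partial>M)" by (rule integral_cong_AE) (use Vc in simp_all)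
      then show ?thesis using gZ[of "g c"] g0 by simp
    qed
    have "\<Sigma> $ c $ d = (\<integral>\<omega>. V \<omega> $ c * V \<omega> $ d \<partial>M)"
      unfolding Sigma_def covariance_matrix_def V_def[symmetric] by (simp add: V0)
    also have "\<dots> = (\<integral>\<omega>. g c (Z 0 \<omega>) * g d (Z 0 \<omega>) \<partial>M)"
      by (rule integral_cong_AE) (use Vc[of c] Vc[of d] in \<open>simp_all, eventually_elim, simp\<close>)
    also have "\<dots> = (\<integral>z. g c z * g d z \<partial>N)" by (rule gZ) simp
    finally show ?thesis .
  qed
  have S_sym: "transpose \<Sigma> = \<Sigma>" by (simp add: transpose_def vec_eq_iff S_eq mult.commute)
  note pd = smallest_eigenvalue_pos_imp_pos_def[OF S_sym assms(10)]
  \<comment> \<open>The very choice made inside \<open>centered_gaussian\<close>, so that the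
    Gaussian law is the image under this \<open>A\<close>.\<close>
  define A where "A = (SOME A :: real^'d^'d. A ** transpose A = \<Sigma>)"
  have A: "A ** transpose A = \<Sigma>" unfolding A_def by (rule someI_ex[OF pos_def_root[OF S_sym pd]])
  \<comment> \<open>\<open>B\<close> whitens the projection: \<open>\<xi>\<close> is isotropic, and
    \<open>A\<close> carries it back to \<open>gv\<close>.\<close>
  obtain B where AB: "A ** B = mat 1" and BSB: "B ** \<Sigma> ** transpose B = mat 1"
    using pos_def_root_inverse[OF A pd] by blast
  define \<xi> where "\<xi> z = B *v gv z" for z
  have Axi: "A *v \<xi> z = gv z" for z by (simp add: \<xi>_def matrix_vector_mul_assoc AB)
  have Alin: "bounded_linear ((*v) A)" by (rule matrix_vector_mul_bounded_linear)
  have Am[measurable]: "(\<lambda>x. A *v x) \<in> borel_measurable borel"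
    by (intro borel_measurable_continuous_onI linear_continuous_on Alin)
  have \<xi>m[measurable]: "\<xi> \<in> borel_measurable N"
    unfolding \<xi>_def by (rule measurable_compose[OF gvm]) (intro borel_measurable_continuous_onI linear_continuous_on matrix_vector_mul_bounded_linear)
  have iso: "isotropic_law (distr N borel \<xi>)" and \<xi>i: "integrable N (\<lambda>z. norm (\<xi> z))"
    using isotropic_linear_image[OF N gvm _ _ _ BSB] unfolding gv_nth \<xi>_def by (simp_all add: g3 g0 S_eq)
  obtain A' where A': "A' \<ge> 0" "\<And>n f L x. L-lipschitz_on UNIV f \<Longrightarrow>
      \<bar>(smooth_by (distr N borel \<xi>) ^^ n) f x - smooth_by (heat_law (real n)) f x\<bar> \<le> L * A'"
    using multivariate_berry_esseen_lipschitz[OF iso] by blast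

  let ?R = "\<lambda>c n z. sqrt n / r * (1 / (n choose r) * (\<Sum>i\<in>inc_maps r n. F c (\<lambda>k\<in>{..<r}. z (i k)))) - 1 / sqrt n * (\<Sum>l<n. g c (z l))"
  have "\<exists>K. \<forall>n\<ge>r. integrable (tuples n N) (?R c n) \<and> (\<integral>z. \<bar>?R c n z\<bar> \<partial>tuples n N) \<le> K / sqrt n" for c
    by (rule hajek_projection_error[OF N r Fm F2 Fsym F0, of c, folded g_def]) (intro exI allI impI conjI)
  then have "\<forall>c. \<exists>K. \<forall>n\<ge>r. integrable (tuples n N) (?R c n) \<and> (\<integral>z. \<bar>?R c n z\<bar> \<partial>tuples n N) \<le> K / sqrt n" ..
  from choice[OF this] obtain K where
    "\<forall>c. \<forall>n\<ge>r. integrable (tuples n N) (?R c n) \<and> (\<integral>z. \<bar>?R c n z\<bar> \<partial>tuples n N) \<le> K c / sqrt n" ..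
  then have K: "\<And>c n. n \<ge> r \<Longrightarrow> integrable (tuples n N) (?R c n)"
      "\<And>c n. n \<ge> r \<Longrightarrow> (\<integral>z. \<bar>?R c n z\<bar> \<partial>tuples n N) \<le> K c / sqrt n"
    by simp_all
  \<comment> \<open>Projection errors are added over the coordinates, as the Euclidean norm is at
    most the sum of the absolute entries; the second term is the error for \<open>\<xi>\<close>,
    transported by \<open>A\<close>.\<close>
  define C where "C = (\<Sum>c\<in>UNIV. K c) + onorm ((*v) A) * A'"

  interpret G: prob_space "std_gaussian :: (real^'d) measure" by (rule prob_space_std_gaussian)
  have cg: "centered_gaussian \<Sigma> = distr std_gaussian borel (\<lambda>x. A *v x)"
    unfolding centered_gaussian_def A_def Let_def ..
  have cg_prob: "prob_space (centered_gaussian \<Sigma>)" unfolding cg by (rule G.prob_space_distr) simp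
  have cg_norm: "integrable (centered_gaussian \<Sigma>) norm"
    unfolding cg
    by (subst integrable_distr_eq)
      (auto intro!: integrable_gauss_dominated[of _ "onorm ((*v) A)" 1 0] onorm[OF Alin])

  have "wasserstein1 (distr M borel (\<lambda>\<omega>. (sqrt (real n) / real r) *\<^sub>R U_statistic r h Z n \<omega>)) (centered_gaussian \<Sigma>)
      \<le> ennreal (C * real n powr (- 1 / 2))" if n: "n \<ge> r" for n
  proof -
    have n1: "n \<ge> 1" using n r by simp
    interpret Pn: prob_space "tuples n N" by (intro prob_space_PiM N)
    \<comment> \<open>\<open>W\<close> is the normalised statistic as a function of the sample,
      \<open>H\<close> its linear projection.\<close>
    define W where "W z = (\<chi> c. sqrt n / r * (1 / (n choose r) * (\<Sum>i\<in>inc_maps r n. F c (\<lambda>k\<in>{..<r}. z (i k)))))" for z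
    define H where "H z = (1 / sqrt n) *\<^sub>R (\<Sum>l<n. gv (z l))" for z
    have WH: "W z $ c - H z $ c = ?R c n z" for z c by (simp add: W_def H_def gv_nth)
    have Wm[measurable]: "W \<in> borel_measurable (tuples n N)"
      unfolding W_def using inc_mapsD(2)
      by (intro borel_measurable_vec_lambda borel_measurable_times borel_measurable_const borel_measurable_sum measurable_compose[OF measurable_PiM_reindex Fm]) auto
    have Hm[measurable]: "H \<in> borel_measurable (tuples n N)" unfolding H_def by measurable
    have UW: "(sqrt (real n) / real r) *\<^sub>R U_statistic r h Z n \<omega> = W (\<lambda>l\<in>{..<n}. Z l \<omega>)" for \<omega>
    proof -
      have "h (\<lambda>k\<in>{..<r}. (\<lambda>l\<in>{..<n}. Z l \<omega>) (i k)) = h (\<lambda>k\<in>{..<r}. Z (i k) \<omega>)" if "i \<in> inc_maps r n" for i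
        using inc_mapsD(2)[OF that] by (intro arg_cong[where f=h] restrict_ext) auto
      then show ?thesis
        unfolding U_statistic_def W_def F_def inc_maps_def[symmetric] by (simp add: vec_eq_iff)
    qed
    have Dist: "norm (W z - H z) \<le> (\<Sum>c\<in>UNIV. \<bar>?R c n z\<bar>)" for z
      using norm_le_l1_cart[of "W z - H z"] by (simp only: vector_minus_component WH)
    have Ri: "integrable (tuples n N) (\<lambda>z. \<Sum>c\<in>UNIV. \<bar>?R c n z\<bar>)"
      by (intro Bochner_Integration.integrable_sum integrable_abs K n)
    have gvn: "integrable N (\<lambda>z. norm (gv z))"
      by (rule Bochner_Integration.integrable_bound[of _ "\<lambda>z. \<Sum>c\<in>UNIV. \<bar>g c z\<bar>"])
        (use gi norm_le_l1_cart[of "gv _"] in \<open>auto simp: gv_nth intro!: order.trans[OF _ abs_ge_self]\<close>)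
    have Hi: "integrable (tuples n N) (\<lambda>z. norm (H z))"
    proof (rule Bochner_Integration.integrable_bound[of _ "\<lambda>z. 1 / sqrt n * (\<Sum>l<n. norm (gv (z l)))"])
      show "integrable (tuples n N) (\<lambda>z. 1 / sqrt n * (\<Sum>l<n. norm (gv (z l))))"
        using integrable_PiM_component(1)[OF N _ gvn, of _ "{..<n}"]
        by (intro integrable_mult_right Bochner_Integration.integrable_sum) auto
      show "AE z in tuples n N. norm (norm (H z)) \<le> norm (1 / sqrt n * (\<Sum>l<n. norm (gv (z l))))"
      proof (rule AE_I2)
        fix z
        have "norm (H z) \<le> 1 / sqrt n * (\<Sum>l<n. norm (gv (z l)))"
          unfolding H_def norm_scaleR using norm_sum[of "\<lambda>l. gv (z l)" "{..<n}"] by (simp add: divide_right_mono)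
        then show "norm (norm (H z)) \<le> norm (1 / sqrt n * (\<Sum>l<n. norm (gv (z l))))" by (simp add: sum_nonneg)
      qed
    qed simp
    have Wi: "integrable (tuples n N) (\<lambda>z. norm (W z))"
    proof (rule Bochner_Integration.integrable_bound[OF Bochner_Integration.integrable_add[OF Ri Hi]])
      show "AE z in tuples n N. norm (norm (W z)) \<le> norm ((\<Sum>c\<in>UNIV. \<bar>?R c n z\<bar>) + norm (H z))"
      proof (rule AE_I2)
        fix z
        have "norm (W z) \<le> norm (W z - H z) + norm (H z)" using norm_triangle_ineq[of "W z - H z" "H z"] by simp
        then show "norm (norm (W z)) \<le> norm ((\<Sum>c\<in>UNIV. \<bar>?R c n z\<bar>) + norm (H z))" using Dist[of z] by simp
      qed
    qed simp
    define \<nu> where "\<nu> = distr M borel (\<lambda>\<omega>. (sqrt (real n) / real r) *\<^sub>R U_statistic r h Z n \<omega>)"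
    have \<nu>: "\<nu> = distr (tuples n N) borel W"
    proof -
      note t = iid_tuple_law[OF \<open>prob_space M\<close> iid n1, folded N_def]
      have "\<nu> = distr M borel (W \<circ> (\<lambda>\<omega>. \<lambda>l\<in>{..<n}. Z l \<omega>))" unfolding \<nu>_def UW by (simp add: o_def)
      also have "\<dots> = distr (distr M (tuples n N) (\<lambda>\<omega>. \<lambda>l\<in>{..<n}. Z l \<omega>)) borel W"
        by (rule distr_distr[symmetric, OF Wm t(1)])
      finally show ?thesis unfolding t(2) .
    qed
    have "wasserstein1 \<nu> (centered_gaussian \<Sigma>) \<le> ennreal (C / sqrt n)"
    proof (rule wasserstein1_le_lipschitz)
      show "prob_space \<nu>" unfolding \<nu> by (rule Pn.prob_space_distr) simp
      show "integrable \<nu> norm" unfolding \<nu> using Wi by (subst integrable_distr_eq) simp_all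
      fix f :: "real^'d \<Rightarrow> real" assume f: "1-lipschitz_on UNIV f"
      have fm[measurable]: "f \<in> borel_measurable borel" by (rule lipschitz_borel_measurable[OF f])
      \<comment> \<open>Absorbs both the root and the normalisation, so that the bound for plain
        sums of \<open>\<xi>\<close> applies.\<close>
      define F' where "F' x = f ((1 / sqrt n) *\<^sub>R (A *v x))" for x
      have F': "(1 / sqrt n * onorm ((*v) A))-lipschitz_on UNIV F'"
      proof (rule lipschitz_onI_abs)
        fix x y
        have "F' x - F' y \<le> norm ((1 / sqrt n) *\<^sub>R (A *v x) - (1 / sqrt n) *\<^sub>R (A *v y))"
          using lipschitz_abs_le[OF f, of "(1 / sqrt n) *\<^sub>R (A *v x)" "(1 / sqrt n) *\<^sub>R (A *v y)"] by (simp add: F'_def dist_norm)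
        also have "\<dots> = 1 / sqrt n * norm (A *v (x - y))"
          by (simp add: scaleR_diff_right[symmetric] matrix_vector_mult_diff_distrib)
        also have "\<dots> \<le> 1 / sqrt n * (onorm ((*v) A) * norm (x - y))" by (intro mult_left_mono onorm[OF Alin]) simp
        finally show "F' x - F' y \<le> 1 / sqrt n * onorm ((*v) A) * dist x y" by (simp add: dist_norm)
      qed (simp add: onorm_pos_le[OF Alin])
      have F'm[measurable]: "F' \<in> borel_measurable borel" by (rule lipschitz_borel_measurable[OF F'])
      have fH: "f (H z) = F' (0 + (\<Sum>l<n. \<xi> (z l)))" for z
        by (simp add: F'_def H_def linear_sum[OF matrix_vector_mul_linear] Axi)
      note sl = sum_law_smooth_by[OF N \<xi>m \<xi>i F', of n 0]
      have fHi: "integrable (tuples n N) (\<lambda>z. f (H z))" unfolding fH by (rule sl(1))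
      have fWi: "integrable (tuples n N) (\<lambda>z. f (W z))"
      proof -
        have "integrable \<nu> f"
          by (rule lipschitz_integrable[OF \<open>prob_space \<nu>\<close> _ \<open>integrable \<nu> norm\<close> f]) (simp add: \<nu>)
        then show ?thesis unfolding \<nu> by (subst (asm) integrable_distr_eq) simp_all
      qed
      have "(\<integral>x. f x \<partial>\<nu>) - (\<integral>z. f (H z) \<partial>tuples n N) = (\<integral>z. f (W z) - f (H z) \<partial>tuples n N)"
        unfolding \<nu> using fHi fWi by (simp add: integral_distr)
      also have "\<dots> \<le> (\<integral>z. (\<Sum>c\<in>UNIV. \<bar>?R c n z\<bar>) \<partial>tuples n N)"
      proof (intro integral_mono Ri Bochner_Integration.integrable_diff fHi fWi)
        show "f (W z) - f (H z) \<le> (\<Sum>c\<in>UNIV. \<bar>?R c n z\<bar>)" for z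
          using lipschitz_abs_le[OF f, of "W z" "H z"] Dist[of z] by (simp only: dist_norm mult_1)
      qed
      also have "\<dots> = (\<Sum>c\<in>UNIV. \<integral>z. \<bar>?R c n z\<bar> \<partial>tuples n N)"
        by (intro Bochner_Integration.integral_sum integrable_abs K n)
      also have "\<dots> \<le> (\<Sum>c\<in>UNIV. K c / sqrt n)" by (intro sum_mono K n)
      finally have 1: "(\<integral>x. f x \<partial>\<nu>) - (\<integral>z. f (H z) \<partial>tuples n N) \<le> (\<Sum>c\<in>UNIV. K c) / sqrt n"
        by (simp add: sum_divide_distrib)
      \<comment> \<open>Heat time \<open>n\<close> scales by \<open>sqrt n\<close>, which cancels
        the normalisation inside \<open>F'\<close>.\<close>
      have "(\<integral>x. f x \<partial>centered_gaussian \<Sigma>) = (\<integral>y. F' (0 + sqrt n *\<^sub>R y) \<partial>std_gaussian)"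
        unfolding cg using n1 by (simp add: integral_distr F'_def matrix_vector_mult_scaleR)
      also have "\<dots> = smooth_by (heat_law (real n)) F' 0" by (rule smooth_by_heat[symmetric]) simp
      finally have "\<bar>(\<integral>z. f (H z) \<partial>tuples n N) - (\<integral>x. f x \<partial>centered_gaussian \<Sigma>)\<bar> \<le> 1 / sqrt n * onorm ((*v) A) * A'"
        using A'(2)[OF F', of n 0] unfolding fH sl(2) by simp
      then show "(\<integral>x. f x \<partial>\<nu>) - (\<integral>x. f x \<partial>centered_gaussian \<Sigma>) \<le> C / sqrt n"
        using 1 by (simp add: C_def add_divide_distrib)
    qed (simp_all add: cg_prob cg_norm, simp_all add: \<nu> cg)
    also have "C / sqrt n = C * real n powr (- 1 / 2)"
      using n1 by (simp add: powr_minus_divide powr_half_sqrt)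
    finally show ?thesis unfolding \<nu>_def .
  qed
  then show ?thesis by blast
qed

end
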